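(* Let $\mathcal{M}$ be a connected complete Riemannian manifold, let $\Pi$ be a $T_1$ topological space with a distinguished non-isolated point $0\in\Pi$ that has a countable basis of neighbourhoods, and let $\pi(t,x)=t$ be the projection $\Pi\times\mathcal{M}\to\Pi$. Let $X\subset\Pi\times\mathcal{M}$ be a set whose sections $X_t=\{x\in\mathcal{M}\mid (t,x)\in X\}$ are closed for all $t\in\Pi$, with $0\in\overline{\pi(X)\setminus\{0\}}$, and assume that $X_t$ converges to $X_0$ in the sense of Kuratowski as $\pi(X)\setminus\{0\}\ni t\to 0$. Let $$M=\{(t,p)\in\Pi\times\mathcal{M}\mid \exists\,\gamma,\tilde\gamma\in\Omega_{X_t,p}:\ \gamma\neq\tilde\gamma\},$$ so that the section $M_t=\{p\in\mathcal{M}\mid (t,p)\in M\}$ is the medial axis of $X_t$. Then $$\liminf_{\pi(M)\ni t\to 0} M_t\supset M_0,$$ where by convention $\liminf M_t=\varnothing$ when $0\notin\overline{\pi(M)\setminus\{0\}}$.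
   Context: Let $d$ be the Riemannian distance on $\mathcal{M}$ (infimum of lengths of piecewise differentiable curves). For a closed nonempty $Y\subset\mathcal{M}$ and $p\in\mathcal{M}$, $\mathrm{dist}(p,Y)=\inf\{d(p,q)\mid q\in Y\}$ and $m(p)=\{x\in Y\mid d(p,x)=\mathrm{dist}(p,Y)\}$. $\Omega_{Y,p}$ denotes the set of minimal-length geodesics (parametrised by arc length, originating from the point of $m(p)$) that connect a point of $m(p)$ with $p$; each has length $\mathrm{dist}(p,Y)$. The medial axis of $Y$ is the set of $p\in\mathcal{M}$ for which $\Omega_{Y,p}$ contains at least two distinct geodesics. If $Y=\varnothing$, then $\Omega_{Y,p}=\varnothing$ and the medial axis is empty. Kuratowski limits: for $Z\subset\Pi\times\mathcal{M}$ with sections $Z_t$ and $0\in\overline{\pi(Z)\setminus\{0\}}$, the limits for $\pi(Z)\setminus\{0\}\ni t\to0$ are defined by: - $x\in\limsup Z_t$ iff for all neighbourhoods $U\ni x$, $V\ni 0$ there is $t\in(\pi(Z)\cap V)\setminus\{0\}$ with $Z_t\cap U\neq\varnothing$; - $x\in\liminf Z_t$ iff for every neighbourhood $U\ni x$ there is a neighbourhood $V\ni 0$ such that $Z_t\cap U\neq\varnothing$ for all $t\in(\pi(Z)\cap V)\setminus\{0\}$. $Z_t$ converges to $Z_0$ in the sense of Kuratowski iff $\limsup Z_t\subset Z_0\subset\liminf Z_t$. In the conclusion, $\liminf$ is taken with $Z=M$, i.e. only along parameters $t$ with $M_t\neq\varnothing$. *)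

theory Defs
  imports "HOL-Analysis.Analysis"
begin

section \<open>Riemannian manifolds\<close>

text \<open>
  The manifold is a whole type \<open>'a\<close> with its class topology; its dimension is \<open>DIM('e)\<close>.
  A chart \<open>(U, \<phi>)\<close> is a domain together with a coordinate map; only the values of \<open>\<phi>\<close> on
  \<open>U\<close> matter.
\<close>

type_synonym ('a, 'e) chart = "'a set \<times> ('a \<Rightarrow> 'e)"

abbreviation chart_inv :: "('a, 'e) chart \<Rightarrow> 'e \<Rightarrow> 'a" where
  "chart_inv c \<equiv> inv_into (fst c) (snd c)"

abbreviation transition :: "('a, 'e) chart \<Rightarrow> ('a, 'e) chart \<Rightarrow> 'e \<Rightarrow> 'e" where
  "transition c d \<equiv> snd d \<circ> chart_inv c"

text \<open>Differentiability classes, to be used on open sets \<open>S\<close> only.\<close>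

fun Ck_on :: "nat \<Rightarrow> 'e set \<Rightarrow> ('e::euclidean_space \<Rightarrow> 'f::real_normed_vector) \<Rightarrow> bool" where
  "Ck_on 0 S f \<longleftrightarrow> continuous_on S f"
| "Ck_on (Suc k) S f \<longleftrightarrow>
     (\<forall>x\<in>S. f differentiable (at x)) \<and>
     (\<forall>i\<in>Basis. Ck_on k S (\<lambda>x. frechet_derivative f (at x) i))"

definition smooth_on :: "'e set \<Rightarrow> ('e::euclidean_space \<Rightarrow> 'f::real_normed_vector) \<Rightarrow> bool" where
  "smooth_on S f \<longleftrightarrow> (\<forall>k. Ck_on k S f)"

definition smooth_atlas ::
  "('a::{t2_space,second_countable_topology}, 'e::euclidean_space) chart set \<Rightarrow> bool" where
  "smooth_atlas A \<longleftrightarrow>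
     (\<forall>c\<in>A. open (fst c) \<and> open (snd c ` fst c) \<and>
            homeomorphism (fst c) (snd c ` fst c) (snd c) (chart_inv c)) \<and>
     (\<Union>c\<in>A. fst c) = UNIV \<and>
     (\<forall>c\<in>A. \<forall>d\<in>A. smooth_on (snd c ` (fst c \<inter> fst d)) (transition c d))"

text \<open>
  The metric is given by its local representations: \<open>g c x\<close> is the inner product on the
  tangent space at the point with coordinates \<open>x\<close>, where tangent vectors are identified with
  \<open>'e\<close> through the chart \<open>c\<close>. The last conjunct is the transformation law of a covariant
  2-tensor.
\<close>

type_synonym ('a, 'e) metric_tensor = "('a, 'e) chart \<Rightarrow> 'e \<Rightarrow> 'e \<Rightarrow> 'e \<Rightarrow> real"

definition riemannian_metric ::
  "('a, 'e::euclidean_space) chart set \<Rightarrow> ('a, 'e) metric_tensor \<Rightarrow> bool" where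
  "riemannian_metric A g \<longleftrightarrow>
     (\<forall>c\<in>A. \<forall>x\<in>snd c ` fst c.
        bilinear (g c x) \<and> (\<forall>u v. g c x u v = g c x v u) \<and> (\<forall>u. u \<noteq> 0 \<longrightarrow> g c x u u > 0)) \<and>
     (\<forall>c\<in>A. \<forall>u v. smooth_on (snd c ` fst c) (\<lambda>x. g c x u v)) \<and>
     (\<forall>c\<in>A. \<forall>d\<in>A. \<forall>p\<in>fst c \<inter> fst d. \<forall>u v.
        g c (snd c p) u v =
        g d (snd d p) (frechet_derivative (transition c d) (at (snd c p)) u)
                      (frechet_derivative (transition c d) (at (snd c p)) v))"

definition riemannian_manifold ::
  "('a::{t2_space,second_countable_topology}, 'e::euclidean_space) chart set
    \<Rightarrow> ('a, 'e) metric_tensor \<Rightarrow> bool" where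
  "riemannian_manifold A g \<longleftrightarrow> smooth_atlas A \<and> riemannian_metric A g"


section \<open>Length and distance\<close>

definition C1_curve ::
  "('a::topological_space, 'e::euclidean_space) chart set \<Rightarrow> real \<Rightarrow> real \<Rightarrow> (real \<Rightarrow> 'a) \<Rightarrow> bool" where
  "C1_curve A a b \<gamma> \<longleftrightarrow>
     continuous_on {a..b} \<gamma> \<and>
     (\<forall>c\<in>A. \<exists>\<gamma>'.
        continuous_on {t\<in>{a..b}. \<gamma> t \<in> fst c} \<gamma>' \<and>
        (\<forall>t\<in>{a..b}. \<gamma> t \<in> fst c \<longrightarrow>
           ((snd c \<circ> \<gamma>) has_vector_derivative \<gamma>' t) (at t within {a..b})))"

text \<open>
  \<open>S\<close> is the set of break points; \<open>\<gamma>\<close> is \<open>C\<^sup>1\<close>, with one-sided derivatives at the end points,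
  on each closed subinterval without break point in its interior.
\<close>

definition piecewise_C1_curve ::
  "('a::topological_space, 'e::euclidean_space) chart set \<Rightarrow> real \<Rightarrow> real \<Rightarrow> (real \<Rightarrow> 'a) \<Rightarrow> bool" where
  "piecewise_C1_curve A a b \<gamma> \<longleftrightarrow>
     continuous_on {a..b} \<gamma> \<and>
     (\<exists>S. finite S \<and>
        (\<forall>u v. a \<le> u \<and> u < v \<and> v \<le> b \<and> {u<..<v} \<inter> S = {} \<longrightarrow> C1_curve A u v \<gamma>))"

text \<open>
  The speed does not depend on the chart, by the transformation law. Where \<open>\<gamma>\<close> has no
  two-sided derivative (break points, end points) its value is irrelevant to the integral.
\<close>

definition speed ::
  "('a, 'e::euclidean_space) chart set \<Rightarrow> ('a, 'e) metric_tensor \<Rightarrow> (real \<Rightarrow> 'a) \<Rightarrow> real \<Rightarrow> real" where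
  "speed A g \<gamma> t =
     (let c = (SOME c. c \<in> A \<and> \<gamma> t \<in> fst c);
          v = vector_derivative (snd c \<circ> \<gamma>) (at t)
      in sqrt (g c (snd c (\<gamma> t)) v v))"

definition curve_length ::
  "('a, 'e::euclidean_space) chart set \<Rightarrow> ('a, 'e) metric_tensor
    \<Rightarrow> real \<Rightarrow> real \<Rightarrow> (real \<Rightarrow> 'a) \<Rightarrow> real" where
  "curve_length A g a b \<gamma> = integral {a..b} (speed A g \<gamma>)"

definition riem_dist ::
  "('a::topological_space, 'e::euclidean_space) chart set \<Rightarrow> ('a, 'e) metric_tensor
    \<Rightarrow> 'a \<Rightarrow> 'a \<Rightarrow> real" where
  "riem_dist A g p q =
     Inf {curve_length A g a b \<gamma> |a b \<gamma>.
            a < b \<and> piecewise_C1_curve A a b \<gamma> \<and> \<gamma> a = p \<and> \<gamma> b = q}"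

definition riem_complete ::
  "('a::topological_space, 'e::euclidean_space) chart set \<Rightarrow> ('a, 'e) metric_tensor \<Rightarrow> bool" where
  "riem_complete A g \<longleftrightarrow> Metric_space.mcomplete (UNIV :: 'a set) (riem_dist A g)"


section \<open>Geodesics\<close>

text \<open>
  The Levi-Civita connection in a chart \<open>c\<close>. Writing \<open>u, v, w\<close> in components,
  \<open>christoffel_first c x u v w\<close> is \<open>[ij,k] u\<^sup>i v\<^sup>j w\<^sup>k\<close>, and raising the index \<open>k\<close> gives the vector
  \<open>christoffel c x u v\<close> with components \<open>\<Gamma>\<^sup>k\<^sub>i\<^sub>j u\<^sup>i v\<^sup>j\<close>; it exists uniquely because \<open>g c x\<close> is
  nondegenerate.
\<close>

definition christoffel_first ::
  "('a, 'e::euclidean_space) metric_tensor \<Rightarrow> ('a, 'e) chart \<Rightarrow> 'e \<Rightarrow> 'e \<Rightarrow> 'e \<Rightarrow> 'e \<Rightarrow> real" where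
  "christoffel_first g c x u v w =
     (frechet_derivative (\<lambda>y. g c y v w) (at x) u
      + frechet_derivative (\<lambda>y. g c y u w) (at x) v
      - frechet_derivative (\<lambda>y. g c y u v) (at x) w) / 2"

definition christoffel ::
  "('a, 'e::euclidean_space) metric_tensor \<Rightarrow> ('a, 'e) chart \<Rightarrow> 'e \<Rightarrow> 'e \<Rightarrow> 'e \<Rightarrow> 'e" where
  "christoffel g c x u v = (THE z. \<forall>w. g c x z w = christoffel_first g c x u v w)"

definition geodesic ::
  "('a::topological_space, 'e::euclidean_space) chart set \<Rightarrow> ('a, 'e) metric_tensor
    \<Rightarrow> real \<Rightarrow> real \<Rightarrow> (real \<Rightarrow> 'a) \<Rightarrow> bool" where
  "geodesic A g a b \<gamma> \<longleftrightarrow>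
     continuous_on {a..b} \<gamma> \<and>
     (\<forall>c\<in>A. \<exists>\<gamma>' \<gamma>''. \<forall>t\<in>{a..b}. \<gamma> t \<in> fst c \<longrightarrow>
        ((snd c \<circ> \<gamma>) has_vector_derivative \<gamma>' t) (at t within {a..b}) \<and>
        (\<gamma>' has_vector_derivative \<gamma>'' t) (at t within {a..b}) \<and>
        \<gamma>'' t + christoffel g c (snd c (\<gamma> t)) (\<gamma>' t) (\<gamma>' t) = 0)"

text \<open>
  Minimal geodesics from \<open>p\<close> to \<open>q\<close>, parametrised by arc length on \<open>{0..d(p,q)}\<close>. They are
  extensional, so that two of them are equal as soon as they agree on that interval.
\<close>

definition minimal_geodesic ::
  "('a::topological_space, 'e::euclidean_space) chart set \<Rightarrow> ('a, 'e) metric_tensor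
    \<Rightarrow> 'a \<Rightarrow> 'a \<Rightarrow> (real \<Rightarrow> 'a) \<Rightarrow> bool" where
  "minimal_geodesic A g p q \<gamma> \<longleftrightarrow>
     \<gamma> \<in> extensional {0..riem_dist A g p q} \<and>
     geodesic A g 0 (riem_dist A g p q) \<gamma> \<and>
     (\<forall>s\<in>{0..riem_dist A g p q}. curve_length A g 0 s \<gamma> = s) \<and>
     \<gamma> 0 = p \<and> \<gamma> (riem_dist A g p q) = q"


section \<open>Medial axis\<close>

definition dist_to_set ::
  "('a::topological_space, 'e::euclidean_space) chart set \<Rightarrow> ('a, 'e) metric_tensor
    \<Rightarrow> 'a \<Rightarrow> 'a set \<Rightarrow> real" where
  "dist_to_set A g p Y = Inf (riem_dist A g p ` Y)"

definition closest_points ::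
  "('a::topological_space, 'e::euclidean_space) chart set \<Rightarrow> ('a, 'e) metric_tensor
    \<Rightarrow> 'a set \<Rightarrow> 'a \<Rightarrow> 'a set" where
  "closest_points A g Y p = {x\<in>Y. riem_dist A g p x = dist_to_set A g p Y}"

definition Omega ::
  "('a::topological_space, 'e::euclidean_space) chart set \<Rightarrow> ('a, 'e) metric_tensor
    \<Rightarrow> 'a set \<Rightarrow> 'a \<Rightarrow> (real \<Rightarrow> 'a) set" where
  "Omega A g Y p = {\<gamma>. \<exists>x\<in>closest_points A g Y p. minimal_geodesic A g x p \<gamma>}"


section \<open>Kuratowski limits\<close>

text \<open>
  For \<open>Z \<subseteq> \<Pi> \<times> \<M>\<close>, the section over \<open>t\<close> is \<open>Z `` {t}\<close> and the projection to \<open>\<Pi>\<close> is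
  \<open>Domain Z\<close>. The case distinction in the lower limit realises the convention that it is empty
  when \<open>t0\<close> is not adherent to the set of parameters.
\<close>

definition kuratowski_limsup ::
  "'t::topological_space \<Rightarrow> ('t \<times> 'a::topological_space) set \<Rightarrow> 'a set" where
  "kuratowski_limsup t0 Z =
     {x. \<forall>U V. open U \<and> x \<in> U \<and> open V \<and> t0 \<in> V \<longrightarrow>
           (\<exists>t\<in>(Domain Z \<inter> V) - {t0}. Z `` {t} \<inter> U \<noteq> {})}"

definition kuratowski_liminf ::
  "'t::topological_space \<Rightarrow> ('t \<times> 'a::topological_space) set \<Rightarrow> 'a set" where
  "kuratowski_liminf t0 Z =
     (if t0 \<in> closure (Domain Z - {t0}) then
        {x. \<forall>U. open U \<and> x \<in> U \<longrightarrow>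
              (\<exists>V. open V \<and> t0 \<in> V \<and>
                 (\<forall>t\<in>(Domain Z \<inter> V) - {t0}. Z `` {t} \<inter> U \<noteq> {}))}
      else {})"

definition kuratowski_converges ::
  "'t::topological_space \<Rightarrow> ('t \<times> 'a::topological_space) set \<Rightarrow> bool" where
  "kuratowski_converges t0 Z \<longleftrightarrow>
     kuratowski_limsup t0 Z \<subseteq> Z `` {t0} \<and> Z `` {t0} \<subseteq> kuratowski_liminf t0 Z"

definition countable_nhds_basis :: "'t::topological_space \<Rightarrow> bool" where
  "countable_nhds_basis t0 \<longleftrightarrow>
     (\<exists>B. countable B \<and> (\<forall>V\<in>B. open V \<and> t0 \<in> V) \<and>
          (\<forall>W. open W \<and> t0 \<in> W \<longrightarrow> (\<exists>V\<in>B. V \<subseteq> W)))"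

end

theory Submission
  imports Defs
begin

text \<open>
  Suppose that \<open>p\<close> lies in the medial axis of \<open>X\<^sub>0\<close>, while along parameters \<open>t\<^sub>n\<close> tending to \<open>0\<close> some
  neighbourhood of \<open>p\<close> does not meet the medial axes of \<open>X\<^sub>t\<close>. In that neighbourhood the shortest path
  from \<open>X\<^sub>t\<close> to a point is unique, hence depends continuously on the point. For \<open>q\<close> at distance at
  most \<open>\<delta>\<close> from \<open>p\<close> let \<open>z(q)\<close> be the point of that path at distance \<open>2\<delta>\<close> from \<open>q\<close>. Brouwer's theorem,
  applied in geodesic polar coordinates about \<open>p\<close> to the map sending \<open>q\<close> to the point at distance \<open>\<delta>\<close>
  from \<open>p\<close> in the direction opposite to \<open>z(q)\<close>, yields a \<open>q\<close> such that \<open>p\<close> lies between \<open>z(q)\<close> and \<open>q\<close>: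
  the shortest path from \<open>X\<^sub>t\<close> to \<open>p\<close> can be prolonged by \<open>\<delta>\<close>, uniformly in \<open>n\<close>. In the limit all
  shortest paths from \<open>X\<^sub>0\<close> to \<open>p\<close> have a common prolongation beyond \<open>p\<close>; as geodesics do not branch,
  they coincide.

  The Riemannian geometry is derived from the boundary value problem for the geodesic equation, which
  a contraction argument solves for nearby points, with Lipschitz dependence on the end points. The
  first variation formula makes the length of the solution a differentiable function of its end point
  and, by the Cauchy-Schwarz inequality, a lower bound for the length of all curves. Uniqueness for
  initial values and invariance of domain replace the exponential map.
\<close>


section \<open>The geodesic equation in a chart domain\<close>

text \<open>The choice of \<open>2\<delta>\<close> keeps z(q) away from p: q stays within \<delta>
  of p, so z(q) always has a direction as seen from p. Uniqueness of shortest paths alone does not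
  make z continuous; compactness of closed balls is needed as well, and this is where completeness
  enters. The radius \<delta> can be fixed before the closed set because the Brouwer argument takes
  place in a neighbourhood of p that depends on p only. The prolonged points q_n therefore keep the
  distance \<delta> from p and accumulate at some l different from p. Passing to the limit in the
  distances gives d(l, x) \<ge> d(l, p) + dist(p, X_0) for all x in X_0, so that p lies between l
  and every nearest point. Absence of branching is a local fact and has to be continued backwards
  along the two paths. Only a few local properties of the distance are used in this part, which is
  why it is carried out in an abstract metric space. Boundary values, not initial values, are the
  natural data for the local analysis: the length of the solution then becomes a function of two
  points, to be compared with the distance.\<close>

lemma vector_derivative_bound:
  fixes f :: "real \<Rightarrow> 'b::real_normed_vector"
  assumes f: "\<And>t. t \<in> {a..b} \<Longrightarrow> (f has_vector_derivative f' t) (at t within {a..b})"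
    and B: "\<And>t. t \<in> {a..b} \<Longrightarrow> norm (f' t) \<le> B"
    and st: "s \<in> {a..b}" "t \<in> {a..b}"
  shows "norm (f t - f s) \<le> B * \<bar>t - s\<bar>"
proof -
  have "norm (f t - f s) \<le> B * norm (t - s)"
  proof (rule differentiable_bound[of "{a..b}" f "\<lambda>t h. h *\<^sub>R f' t"])
    fix u assume u: "u \<in> {a..b}"
    show "(f has_derivative (\<lambda>h. h *\<^sub>R f' u)) (at u within {a..b})"
      using f[OF u] by (simp add: has_vector_derivative_def)
    show "onorm (\<lambda>h. h *\<^sub>R f' u) \<le> B"
      by (rule onorm_le) (use mult_left_mono[OF B[OF u] abs_ge_zero] in \<open>simp add: mult.commute\<close>)
  qed (use st in auto)
  then show ?thesis by simp
qed

text \<open>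
  \<open>G\<close> stands for the coordinate expression of the metric, \<open>D x h\<close> for its derivative at \<open>x\<close> in
  direction \<open>h\<close>, and \<open>Q x v\<close> for \<open>- \<Gamma>\<^sub>x(v, v)\<close>, so that geodesics solve \<open>x'' = Q x x'\<close>.
\<close>

locale geodesic_domain =
  fixes x0 :: "'e::euclidean_space" and R K :: real
    and G :: "'e \<Rightarrow> 'e \<Rightarrow> 'e \<Rightarrow> real"
    and D :: "'e \<Rightarrow> 'e \<Rightarrow> 'e \<Rightarrow> 'e \<Rightarrow> real"
    and Q :: "'e \<Rightarrow> 'e \<Rightarrow> 'e"
  assumes R_pos: "0 < R" and K_ge1: "1 \<le> K"
    and G_bilinear: "x \<in> ball x0 R \<Longrightarrow> bilinear (G x)"
    and G_sym: "x \<in> ball x0 R \<Longrightarrow> G x u v = G x v u"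
    and G_lower: "x \<in> ball x0 R \<Longrightarrow> (norm v)\<^sup>2 \<le> K * G x v v"
    and G_upper: "x \<in> ball x0 R \<Longrightarrow> \<bar>G x u v\<bar> \<le> K * norm u * norm v"
    and G_deriv: "x \<in> ball x0 R \<Longrightarrow> ((\<lambda>y. G y u v) has_derivative (\<lambda>h. D x h u v)) (at x)"
    and D_bilinear: "x \<in> ball x0 R \<Longrightarrow> bilinear (D x h)"
    and D_bound: "x \<in> ball x0 R \<Longrightarrow> \<bar>D x h u v\<bar> \<le> K * norm h * norm u * norm v"
    and D_lipschitz: "x \<in> ball x0 R \<Longrightarrow> y \<in> ball x0 R \<Longrightarrow>
          \<bar>D x h u v - D y h u v\<bar> \<le> K * norm (x - y) * norm h * norm u * norm v"
    and Q_eq: "x \<in> ball x0 R \<Longrightarrow> G x (Q x v) w = D x w v v / 2 - D x v v w"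
begin

lemma G_linear: "x \<in> ball x0 R \<Longrightarrow> linear (G x u)" "x \<in> ball x0 R \<Longrightarrow> linear (\<lambda>u. G x u v)"
  using G_bilinear by (auto simp: bilinear_def)

lemma G_simps:
  assumes "x \<in> ball x0 R"
  shows "G x (u + w) v = G x u v + G x w v" "G x v (u + w) = G x v u + G x v w"
    "G x (u - w) v = G x u v - G x w v" "G x v (u - w) = G x v u - G x v w"
    "G x (c *\<^sub>R u) v = c * G x u v" "G x v (c *\<^sub>R u) = c * G x v u"
    "G x 0 v = 0" "G x v 0 = 0" "G x (- u) v = - G x u v" "G x v (- u) = - G x v u"
  by (simp_all add: bilinear_ladd[OF G_bilinear[OF assms]] bilinear_radd[OF G_bilinear[OF assms]] bilinear_lsub[OF G_bilinear[OF assms]]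
      bilinear_rsub[OF G_bilinear[OF assms]] bilinear_lmul[OF G_bilinear[OF assms]] bilinear_rmul[OF G_bilinear[OF assms]]
      bilinear_lzero[OF G_bilinear[OF assms]] bilinear_rzero[OF G_bilinear[OF assms]] bilinear_lneg[OF G_bilinear[OF assms]] bilinear_rneg[OF G_bilinear[OF assms]])

lemma D_simps:
  assumes "x \<in> ball x0 R"
  shows "D x h (u + w) v = D x h u v + D x h w v" "D x h v (u + w) = D x h v u + D x h v w"
    "D x h (u - w) v = D x h u v - D x h w v" "D x h v (u - w) = D x h v u - D x h v w"
    "D x h (c *\<^sub>R u) v = c * D x h u v" "D x h v (c *\<^sub>R u) = c * D x h v u"
    "D x h 0 v = 0" "D x h v 0 = 0" "D x h (- u) v = - D x h u v" "D x h v (- u) = - D x h v u"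
  by (simp_all add: bilinear_ladd[OF D_bilinear[OF assms]] bilinear_radd[OF D_bilinear[OF assms]] bilinear_lsub[OF D_bilinear[OF assms]]
      bilinear_rsub[OF D_bilinear[OF assms]] bilinear_lmul[OF D_bilinear[OF assms]] bilinear_rmul[OF D_bilinear[OF assms]]
      bilinear_lzero[OF D_bilinear[OF assms]] bilinear_rzero[OF D_bilinear[OF assms]] bilinear_lneg[OF D_bilinear[OF assms]] bilinear_rneg[OF D_bilinear[OF assms]])

lemma D_linear1: "x \<in> ball x0 R \<Longrightarrow> linear (\<lambda>h. D x h u v)"
  using G_deriv has_derivative_linear by blast

lemma D_simps1:
  assumes "x \<in> ball x0 R"
  shows "D x (h + k) u v = D x h u v + D x k u v" "D x (h - k) u v = D x h u v - D x k u v"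
    "D x (c *\<^sub>R h) u v = c * D x h u v" "D x 0 u v = 0" "D x (- h) u v = - D x h u v"
  using linear_add[OF D_linear1[OF assms]] linear_diff[OF D_linear1[OF assms]]
    linear_scale[OF D_linear1[OF assms]] linear_0[OF D_linear1[OF assms]] linear_neg[OF D_linear1[OF assms]]
  by auto

lemma G_nonneg: "x \<in> ball x0 R \<Longrightarrow> 0 \<le> G x v v"
  using G_lower[of x v] K_ge1 order_trans[OF zero_le_power2, of "norm v" "K * G x v v"]
  by (simp add: zero_le_mult_iff)

lemma G_eq0: "x \<in> ball x0 R \<Longrightarrow> G x v v = 0 \<Longrightarrow> v = 0"
  using G_lower[of x v] by simp

lemma G_cancel:
  assumes x: "x \<in> ball x0 R" and eq: "\<And>h. G x u h = G x v h"
  shows "u = v"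
  using G_eq0[OF x, of "u - v"] eq[of "u - v"] by (simp add: G_simps[OF x])

lemma G_lipschitz:
  assumes "x \<in> ball x0 R" "y \<in> ball x0 R"
  shows "\<bar>G x u v - G y u v\<bar> \<le> K * norm (x - y) * norm u * norm v"
proof -
  have "norm (G x u v - G y u v) \<le> (K * norm u * norm v) * norm (x - y)"
  proof (rule differentiable_bound[of "ball x0 R" "\<lambda>z. G z u v" "\<lambda>z h. D z h u v"])
    fix z assume z: "z \<in> ball x0 R"
    show "((\<lambda>z. G z u v) has_derivative (\<lambda>h. D z h u v)) (at z within ball x0 R)"
      using G_deriv[OF z] has_derivative_at_withinI by blast
    show "onorm (\<lambda>h. D z h u v) \<le> K * norm u * norm v"
      by (rule onorm_le) (use D_bound[OF z, of _ u v] in \<open>simp add: mult.assoc mult.commute mult.left_commute\<close>)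
  qed (use assms in auto)
  then show ?thesis by (simp add: mult.assoc mult.commute mult.left_commute)
qed

text \<open>\<open>Q\<close> is known only through its pairings with \<open>G\<close>. Pairing a
  vector with itself gives a bound that is linear in its norm, while \<open>G_lower\<close> is
  quadratic; one factor cancels.\<close>

lemma norm_le_of_G:
  assumes x: "x \<in> ball x0 R" and G: "G x w w \<le> c * norm w" and c: "0 \<le> c"
  shows "norm w \<le> K * c"
proof (cases "w = 0")
  case True
  then show ?thesis using c K_ge1 by simp
next
  case False
  have "norm w * norm w \<le> K * (c * norm w)"
    using G_lower[OF x, of w] mult_left_mono[OF G, of K] K_ge1 unfolding power2_eq_square by linarith
  then show ?thesis using False by (simp add: mult.assoc[symmetric])
qed

text \<open>A common bound for the Lipschitz constants of \<open>Q\<close> in the position,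
  \<open>4 * K^4\<close>, and in the velocity, \<open>2 * K^2\<close>.\<close>

definition "L = 6 * K ^ 4"

lemma L_ge6: "6 \<le> L"
  unfolding L_def using one_le_power[OF K_ge1, of 4] by simp

lemma Q_bound_aux:
  assumes x: "x \<in> ball x0 R"
  shows "norm (Q x v) \<le> 2 * K^2 * (norm v)\<^sup>2"
proof -
  have "G x (Q x v) (Q x v) \<le> (3/2 * K * (norm v)\<^sup>2) * norm (Q x v)"
    using Q_eq[OF x, of v "Q x v"] D_bound[OF x, of "Q x v" v v] D_bound[OF x, of v v "Q x v"]
    by (simp add: power2_eq_square mult.assoc mult.commute mult.left_commute)
  then have "norm (Q x v) \<le> K * (3/2 * K * (norm v)\<^sup>2)"
    by (rule norm_le_of_G[OF x]) (use K_ge1 in simp)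
  also have "\<dots> \<le> 2 * K^2 * (norm v)\<^sup>2"
    using K_ge1 by (simp add: power2_eq_square mult_right_mono)
  finally show ?thesis .
qed

text \<open>\<open>Q x v\<close> and \<open>Q y v\<close> are represented by different inner
  products. Pairing their difference with itself in \<open>G x\<close> leaves one term in which only
  the base point of \<open>G\<close> moves; it is controlled by \<open>G_lipschitz\<close> together
  with the quadratic bound of \<open>Q\<close>, and it produces the power
  \<open>K^3\<close>.\<close>

lemma Q_lipschitz_pos:
  assumes x: "x \<in> ball x0 R" and y: "y \<in> ball x0 R"
  shows "norm (Q x v - Q y v) \<le> L * norm (x - y) * (norm v)\<^sup>2"
proof -
  define d where "d = Q x v - Q y v"
  define c where "c = norm (x - y) * (norm v)\<^sup>2 * norm d"
  have 1: "G x (Q x v) d - G y (Q y v) d = (D x d v v - D y d v v) / 2 - (D x v v d - D y v v d)"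
    using Q_eq[OF x, of v d] Q_eq[OF y, of v d] by (simp add: field_simps)
  have 2: "\<bar>D x d v v - D y d v v\<bar> \<le> K * c" "\<bar>D x v v d - D y v v d\<bar> \<le> K * c"
    using D_lipschitz[OF x y, of d v v] D_lipschitz[OF x y, of v v d]
    by (simp_all add: c_def power2_eq_square mult.assoc mult.commute mult.left_commute)
  have "\<bar>G x (Q y v) d - G y (Q y v) d\<bar> \<le> K * norm (x - y) * norm (Q y v) * norm d"
    by (rule G_lipschitz[OF x y])
  also have "\<dots> \<le> K * norm (x - y) * (2 * K^2 * (norm v)\<^sup>2) * norm d"
    using Q_bound_aux[OF y, of v] K_ge1 by (intro mult_mono mult_nonneg_nonneg) auto
  also have "\<dots> = 2 * K^3 * c" by (simp add: c_def power2_eq_square power3_eq_cube)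
  finally have 3: "\<bar>G x (Q y v) d - G y (Q y v) d\<bar> \<le> 2 * K^3 * c" .
  have c0: "0 \<le> c" by (simp add: c_def)
  have "G x d d = (G x (Q x v) d - G y (Q y v) d) - (G x (Q y v) d - G y (Q y v) d)"
    by (simp add: d_def G_simps[OF x])
  also have "\<dots> \<le> 3/2 * (K * c) + 2 * K^3 * c" using 1 2(1)[THEN abs_le_D1] 2(2)[THEN abs_le_D2] 3[THEN abs_le_D2] by (simp add: field_simps)
  also have "\<dots> \<le> 3/2 * (K^3 * c) + 2 * K^3 * c"
    using mult_right_mono[OF self_le_power[OF K_ge1, of 3] c0] by (simp add: mult.commute)
  also have "\<dots> \<le> 4 * K^3 * c" using c0 K_ge1 by simp
  finally have "G x d d \<le> (4 * K^3 * norm (x - y) * (norm v)\<^sup>2) * norm d"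
    by (simp add: c_def)
  then have "norm d \<le> K * (4 * K^3 * norm (x - y) * (norm v)\<^sup>2)"
    by (rule norm_le_of_G[OF x]) (use K_ge1 in simp)
  also have "\<dots> = 4 * K^4 * norm (x - y) * (norm v)\<^sup>2"
    by (simp add: power4_eq_xxxx power3_eq_cube)
  also have "\<dots> \<le> L * norm (x - y) * (norm v)\<^sup>2"
    unfolding L_def using K_ge1 by (intro mult_right_mono) auto
  finally show ?thesis by (simp add: d_def)
qed

lemma Q_lipschitz_vel:
  assumes x: "x \<in> ball x0 R"
  shows "norm (Q x v - Q x w) \<le> L * norm (v - w) * (norm v + norm w)"
proof -
  define d where "d = Q x v - Q x w"
  define s where "s = norm v + norm w"
  \<comment> \<open>A difference of quadratic forms at \<open>v\<close> and \<open>w\<close> is a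
    sum of two terms that have \<open>v - w\<close> in one slot.\<close>
  have 1: "G x d d = (D x d (v - w) v + D x d w (v - w)) / 2 - (D x (v - w) v d + D x w (v - w) d)"
    unfolding d_def using Q_eq[OF x, of v] Q_eq[OF x, of w]
    by (simp add: G_simps[OF x] D_simps[OF x] D_simps1[OF x] field_simps)
  have b: "\<bar>D x d (v - w) v + D x d w (v - w)\<bar> \<le> K * norm d * norm (v - w) * s"
    using D_bound[OF x, of d "v-w" v] D_bound[OF x, of d w "v-w"] unfolding s_def
    by (simp add: algebra_simps)
  have c: "\<bar>D x (v - w) v d + D x w (v - w) d\<bar> \<le> K * norm d * norm (v - w) * s"
    using D_bound[OF x, of "v-w" v d] D_bound[OF x, of w "v-w" d] unfolding s_def
    by (simp add: algebra_simps)
  have s0: "0 \<le> s" by (simp add: s_def)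
  have "G x d d \<le> 2 * (K * norm d * norm (v - w) * s)"
    using 1 b c[THEN abs_le_D2] b[THEN abs_le_D1] by (simp add: field_simps)
  then have "norm d \<le> K * (2 * K * norm (v - w) * s)"
    by (intro norm_le_of_G[OF x]) (use K_ge1 s0 in \<open>auto simp: algebra_simps\<close>)
  also have "\<dots> \<le> L * norm (v - w) * s"
  proof -
    have "2 * K^2 \<le> L" unfolding L_def using K_ge1 power_increasing[of 2 4 K] zero_le_power[of K 4] by linarith
    then show ?thesis using s0 mult_right_mono[of "2*K^2" L "norm (v-w) * s"]
      by (simp add: power2_eq_square algebra_simps)
  qed
  finally show ?thesis by (simp add: d_def s_def)
qed

lemma Q_zero: "x \<in> ball x0 R \<Longrightarrow> Q x 0 = 0"
  using Q_bound_aux[of x 0] by simp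

lemma Q_scale: "x \<in> ball x0 R \<Longrightarrow> Q x (c *\<^sub>R v) = c\<^sup>2 *\<^sub>R Q x v"
  by (rule G_cancel[of x]) (auto simp: Q_eq G_simps D_simps D_simps1 power2_eq_square algebra_simps)

text \<open>On curves of velocity at most \<open>\<epsilon>\<close> the right-hand side of the geodesic equation has Lipschitz
  constant \<open>1 / 8\<close> on the time interval \<open>[0, 1]\<close>. Closeness of end points is replaced by this bound
  on the velocity throughout.\<close>

definition "\<epsilon> = min (R / 2) (1 / (24 * L))"

text \<open>The bound \<open>R / 2\<close> keeps curves of unit duration that start in the half ball
  inside the domain. Since \<open>\<epsilon> \<le> 1\<close>, the quadratic term is at most
  \<open>\<epsilon>\<close>, and \<open>24\<close> is \<open>3\<close> times
  \<open>8\<close>.\<close>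

lemma eps_pos: "0 < \<epsilon>" and eps_R: "\<epsilon> \<le> R / 2" and eps_L: "L * (\<epsilon>\<^sup>2 + 2 * \<epsilon>) \<le> 1 / 8"
proof -
  show "0 < \<epsilon>" "\<epsilon> \<le> R / 2" using R_pos L_ge6 by (auto simp: \<epsilon>_def)
  have 1: "\<epsilon> \<le> 1 / (24 * L)" "0 < \<epsilon>" using R_pos L_ge6 by (auto simp: \<epsilon>_def)
  then have "\<epsilon> \<le> 1" using L_ge6 by (smt (verit) divide_le_eq_1_pos)
  then have "\<epsilon>\<^sup>2 \<le> \<epsilon>" using 1 by (simp add: power2_eq_square mult_left_le)
  then have "L * (\<epsilon>\<^sup>2 + 2 * \<epsilon>) \<le> L * (3 * \<epsilon>)" using L_ge6 by simp
  also have "\<dots> \<le> L * (3 * (1 / (24 * L)))" using 1 L_ge6 by (intro mult_left_mono) auto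
  also have "\<dots> = 1/8" using L_ge6 by simp
  finally show "L * (\<epsilon>\<^sup>2 + 2 * \<epsilon>) \<le> 1 / 8" .
qed

lemma Q_contract:
  assumes x: "x \<in> ball x0 R" and y: "y \<in> ball x0 R"
    and v: "norm v \<le> \<epsilon>" and w: "norm w \<le> \<epsilon>"
    and xy: "norm (x - y) \<le> c" and vw: "norm (v - w) \<le> c"
  shows "norm (Q x v - Q y w) \<le> c / 8"
proof -
  have c0: "0 \<le> c" using xy norm_ge_zero order_trans by blast
  have "norm (Q x v - Q y w) \<le> norm (Q x v - Q y v) + norm (Q y v - Q y w)"
    using norm_triangle_ineq[of "Q x v - Q y v" "Q y v - Q y w"] by simp
  also have "\<dots> \<le> L * norm (x - y) * (norm v)\<^sup>2 + L * norm (v - w) * (norm v + norm w)"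
    using Q_lipschitz_pos[OF x y] Q_lipschitz_vel[OF y] by (intro add_mono) auto
  also have "\<dots> \<le> L * c * \<epsilon>\<^sup>2 + L * c * (\<epsilon> + \<epsilon>)"
    using assms L_ge6 eps_pos c0 by (intro add_mono mult_mono power_mono mult_nonneg_nonneg) auto
  also have "\<dots> = (L * (\<epsilon>\<^sup>2 + 2 * \<epsilon>)) * c" by (simp add: algebra_simps)
  also have "\<dots> \<le> 1/8 * c" using eps_L c0 by (intro mult_right_mono) auto
  finally show ?thesis by simp
qed

text \<open>Time is normalised to \<open>[0, 1]\<close>, so that the mean velocity is the
  displacement. The velocity bound is part of the notion because without it two geodesics with the
  same end points need not coincide.\<close>

definition is_sol :: "(real \<Rightarrow> 'e) \<Rightarrow> (real \<Rightarrow> 'e) \<Rightarrow> bool" where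
  "is_sol x v \<longleftrightarrow> (\<forall>t\<in>{0..1}. x t \<in> ball x0 R \<and> norm (v t) \<le> \<epsilon> \<and>
     (x has_vector_derivative v t) (at t within {0..1}) \<and>
     (v has_vector_derivative Q (x t) (v t)) (at t within {0..1}))"

lemma is_solD:
  assumes "is_sol x v" "t \<in> {0..1}"
  shows "x t \<in> ball x0 R" "norm (v t) \<le> \<epsilon>"
    "(x has_vector_derivative v t) (at t within {0..1})"
    "(v has_vector_derivative Q (x t) (v t)) (at t within {0..1})"
  using assms by (auto simp: is_sol_def)

lemma is_sol_const: "a \<in> ball x0 R \<Longrightarrow> is_sol (\<lambda>_. a) (\<lambda>_. 0)"
  using eps_pos by (auto simp: is_sol_def Q_zero)

text \<open>Let \<open>S\<close> be the maximal difference of the velocities. The accelerations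
  differ by at most \<open>(h0 + S) / 8\<close>, so the difference of the velocities is nearly
  constant in time. Its mean is the difference of the displacements, its value at \<open>0\<close>
  the difference of the initial velocities; knowledge of either one bounds \<open>S\<close> once the
  summand \<open>S / 8\<close> is absorbed.\<close>

lemma sol_compare:
  assumes xv: "is_sol x v" and yw: "is_sol y w" and t: "t \<in> {0..1}"
  shows sol_compare_bvp: "norm (w t - v t) \<le> 2 * (norm ((y 1 - x 1) - (y 0 - x 0)) + norm (y 0 - x 0))"
    and sol_compare_ivp: "norm (w t - v t) \<le> 2 * (norm (w 0 - v 0) + norm (y 0 - x 0))"
proof -
  define u where "u = (\<lambda>t. w t - v t)"
  define h0 where "h0 = norm (y 0 - x 0)"
  have du: "(u has_vector_derivative (Q (y t) (w t) - Q (x t) (v t))) (at t within {0..1})"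
    if "t \<in> {0..1}" for t
    unfolding u_def using is_solD[OF xv that] is_solD[OF yw that]
    by (auto intro!: derivative_eq_intros)
  have dh: "((\<lambda>t. y t - x t) has_vector_derivative u t) (at t within {0..1})" if "t \<in> {0..1}" for t
    unfolding u_def using is_solD[OF xv that] is_solD[OF yw that]
    by (auto intro!: derivative_eq_intros)
  have "continuous_on {0..1} (\<lambda>t. norm (u t))"
    by (intro continuous_on_norm) (rule continuous_on_vector_derivative[OF du])
  then obtain \<tau> where \<tau>: "\<tau> \<in> {0..1}" and max: "\<And>t. t \<in> {0..1} \<Longrightarrow> norm (u t) \<le> norm (u \<tau>)"
    using continuous_attains_sup[of "{0..1::real}" "\<lambda>t. norm (u t)"] by auto
  define S where "S = norm (u \<tau>)"
  have S0: "0 \<le> S" and h00: "0 \<le> h0" by (auto simp: S_def h0_def)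
  have pos: "norm (y t - x t - (y 0 - x 0)) \<le> S" if "t \<in> {0..1}" for t
  proof -
    have "norm (y t - x t - (y 0 - x 0)) \<le> S * \<bar>t - 0\<bar>"
      by (rule vector_derivative_bound[of 0 1 "\<lambda>t. y t - x t" u]) (use dh max that in \<open>auto simp: S_def\<close>)
    also have "\<dots> \<le> S" using that S0 by (simp add: mult_left_le)
    finally show ?thesis .
  qed
  have pos': "norm (y t - x t) \<le> h0 + S" if "t \<in> {0..1}" for t
    using pos[OF that] norm_triangle_ineq[of "y t - x t - (y 0 - x 0)" "y 0 - x 0"] by (simp add: h0_def)
  have acc: "norm (Q (y t) (w t) - Q (x t) (v t)) \<le> (h0 + S) / 8" if "t \<in> {0..1}" for t
    using is_solD[OF xv that] is_solD[OF yw that] pos'[OF that] max[OF that] h00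
    by (intro Q_contract) (auto simp: u_def S_def)
  have osc: "norm (u s - u t) \<le> (h0 + S) / 8" if "s \<in> {0..1}" "t \<in> {0..1}" for s t
  proof -
    have "norm (u s - u t) \<le> (h0 + S) / 8 * \<bar>s - t\<bar>"
      using vector_derivative_bound[of 0 1 u "\<lambda>t. Q (y t) (w t) - Q (x t) (v t)", OF du acc that(2) that(1)] .
    also have "\<dots> \<le> (h0 + S) / 8 * 1" using that h00 S0 by (intro mult_left_mono) auto
    finally show ?thesis by simp
  qed
  \<comment> \<open>The difference of the displacements is the mean of \<open>u\<close>, hence as
    close to the maximal value \<open>u \<tau>\<close> as the oscillation of \<open>u\<close>
    allows.\<close>
  have endpoint: "norm ((y 1 - x 1) - (y 0 - x 0) - u \<tau>) \<le> (h0 + S) / 8"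
  proof -
    have "norm ((\<lambda>t. y t - x t - t *\<^sub>R u \<tau>) 1 - (\<lambda>t. y t - x t - t *\<^sub>R u \<tau>) 0) \<le> (h0 + S) / 8 * \<bar>1 - 0\<bar>"
    proof (rule vector_derivative_bound[of 0 1 _ "\<lambda>t. u t - u \<tau>"])
      fix t :: real assume t: "t \<in> {0..1}"
      show "((\<lambda>t. y t - x t - t *\<^sub>R u \<tau>) has_vector_derivative u t - u \<tau>) (at t within {0..1})"
        using has_vector_derivative_diff[OF dh[OF t] has_vector_derivative_scaleR[OF DERIV_ident has_vector_derivative_const]]
        by simp
      show "norm (u t - u \<tau>) \<le> (h0 + S) / 8" using osc t \<tau> by auto
    qed auto
    then show ?thesis by (simp add: algebra_simps)
  qed
  define n where "n = norm ((y 1 - x 1) - (y 0 - x 0))"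
  have n0: "0 \<le> n" by (simp add: n_def)
  have "S \<le> n + (h0 + S) / 8"
    using endpoint norm_triangle_ineq2[of "u \<tau>" "(y 1 - x 1) - (y 0 - x 0)"]
      norm_minus_commute[of "u \<tau>" "(y 1 - x 1) - (y 0 - x 0)"] S_def n_def by linarith
  then have "S \<le> 2 * (n + h0)" using h00 n0 by argo
  then show "norm (w t - v t) \<le> 2 * (norm ((y 1 - x 1) - (y 0 - x 0)) + norm (y 0 - x 0))"
    using max[OF t] by (simp add: S_def h0_def u_def n_def)
  have "norm (u \<tau> - u 0) \<le> (h0 + S) / 8" using osc[OF \<tau>, of 0] by simp
  then have "norm (u \<tau>) \<le> norm (u 0) + (h0 + S) / 8"
    using norm_triangle_ineq2[of "u \<tau>" "u 0"] by argo
  moreover define m where "m = norm (u 0)"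
  moreover have "0 \<le> m" by (simp add: m_def)
  ultimately have "S \<le> 2 * (norm (u 0) + h0)" unfolding S_def[symmetric] using h00 by argo
  then show "norm (w t - v t) \<le> 2 * (norm (w 0 - v 0) + norm (y 0 - x 0))"
    using max[OF t] by (simp add: S_def h0_def u_def)
qed

lemma sol_eqI:
  assumes xv: "is_sol x v" and yw: "is_sol y w" and t: "t \<in> {0..1}"
    and 0: "x 0 = y 0" and 1: "x 1 = y 1 \<or> v 0 = w 0"
  shows "x t = y t" "v t = w t"
proof -
  have v: "v t = w t" if "t \<in> {0..1}" for t
    using sol_compare[OF xv yw that] 0 1 by auto
  then show "v t = w t" using t by simp
  have "norm ((\<lambda>t. y t - x t) t - (\<lambda>t. y t - x t) 0) \<le> 0 * \<bar>t - 0\<bar>"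
  proof (rule vector_derivative_bound[of 0 1 _ "\<lambda>t. w t - v t"])
    fix t :: real assume t: "t \<in> {0..1}"
    show "((\<lambda>t. y t - x t) has_vector_derivative w t - v t) (at t within {0..1})"
      using is_solD[OF xv t] is_solD[OF yw t] by (auto intro!: derivative_eq_intros)
  qed (use t v in auto)
  then show "x t = y t" using 0 by simp
qed

end

section \<open>Existence for the boundary value problem, reparametrisation, constancy of the
  speed\<close>

context geodesic_domain
begin

lemma continuous_on_Q:
  assumes f: "continuous_on T f" and g: "continuous_on T g" and T: "f ` T \<subseteq> ball x0 R"
  shows "continuous_on T (\<lambda>t. Q (f t) (g t))"
  unfolding continuous_on_def
proof
  fix t assume t: "t \<in> T"
  have ft: "(f \<longlongrightarrow> f t) (at t within T)" and gt: "(g \<longlongrightarrow> g t) (at t within T)"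
    using f g t by (auto simp: continuous_on_def)
  have "((\<lambda>s. Q (f s) (g s) - Q (f t) (g t)) \<longlongrightarrow> 0) (at t within T)"
  proof (rule Lim_null_comparison)
    show "\<forall>\<^sub>F s in at t within T. norm (Q (f s) (g s) - Q (f t) (g t)) \<le>
      L * norm (f s - f t) * (norm (g s))\<^sup>2 + L * norm (g s - g t) * (norm (g s) + norm (g t))"
      unfolding eventually_at_filter
    proof (intro always_eventually allI impI)
      fix s assume "s \<in> T"
      then have "f s \<in> ball x0 R" "f t \<in> ball x0 R" using T t by auto
      then show "norm (Q (f s) (g s) - Q (f t) (g t)) \<le>
          L * norm (f s - f t) * (norm (g s))\<^sup>2 + L * norm (g s - g t) * (norm (g s) + norm (g t))"
        using Q_lipschitz_pos[of "f s" "f t" "g s"] Q_lipschitz_vel[of "f t" "g s" "g t"]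
          norm_triangle_ineq[of "Q (f s) (g s) - Q (f t) (g s)" "Q (f t) (g s) - Q (f t) (g t)"]
        by simp
    qed
    have "((\<lambda>s. L * norm (f s - f t) * (norm (g s))\<^sup>2 + L * norm (g s - g t) * (norm (g s) + norm (g t)))
      \<longlongrightarrow> L * norm (f t - f t) * (norm (g t))\<^sup>2 + L * norm (g t - g t) * (norm (g t) + norm (g t)))
      (at t within T)"
      by (intro tendsto_intros ft gt)
    then show "((\<lambda>s. L * norm (f s - f t) * (norm (g s))\<^sup>2 + L * norm (g s - g t) * (norm (g s) + norm (g t)))
      \<longlongrightarrow> 0) (at t within T)" by simp
  qed
  then show "((\<lambda>t. Q (f t) (g t)) \<longlongrightarrow> Q (f t) (g t)) (at t within T)"
    by (simp add: Lim_null[of _ "Q (f t) (g t)"])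
qed

text \<open>The unknown of the fixed point problem is the velocity \<open>w\<close>. The position
  \<open>X w\<close> starts at \<open>a\<close> by construction, \<open>q w\<close> is the
  acceleration along it, and on \<open>[0, 1]\<close> the function \<open>T w\<close> is the
  primitive of \<open>q w\<close> with mean \<open>b - a\<close>. A fixed point thus solves the
  equation and ends at \<open>b\<close>.\<close>

lemma bvp_exists:
  assumes a: "a \<in> ball x0 (R / 2)" and b: "norm (b - a) \<le> \<epsilon> / 2"
  shows "\<exists>x v. is_sol x v \<and> x 0 = a \<and> x 1 = b"
proof -
  define X where "X = (\<lambda>(w::real \<Rightarrow> 'e) (t::real). a + integral {0..t} w)"
  define q where "q = (\<lambda>(w::real \<Rightarrow> 'e) (s::real). Q (X w s) (w s))"
  define I where "I = (\<lambda>(w::real \<Rightarrow> 'e) (t::real). integral {0..t} (q w))"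
  \<comment> \<open>Clamping the time to \<open>[0, 1]\<close> makes \<open>T w\<close> a bounded
    continuous function on the whole line, so that Banach's theorem applies in a complete space.
    Subtracting the mean of \<open>I w\<close> prescribes the displacement.\<close>
  define T where "T = (\<lambda>(w::real \<Rightarrow> 'e) (t::real). (b - a) + I w (max 0 (min 1 t)) - integral {0..1} (I w))"
  define Y where "Y = (cball 0 \<epsilon> :: (real \<Rightarrow>\<^sub>C 'e) set)"
  have Yb: "norm (apply_bcontfun w t) \<le> \<epsilon>" if "w \<in> Y" for w t
    using order_trans[OF norm_bounded[of w t]] that by (simp add: Y_def)
  have cX: "continuous_on {0..1} (X w)" if "continuous_on {0..1} w" for w
    unfolding X_def by (intro continuous_intros indefinite_integral_continuous_1 integrable_continuous_real that)
  have int: "w integrable_on {0..t}" if "continuous_on {0..1} w" "t \<in> {0..1}" for w :: "real \<Rightarrow> 'e" and t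
    using that by (intro integrable_continuous_real) (auto elim: continuous_on_subset)
  have bound: "norm (integral {0..t} w) \<le> B"
    if "continuous_on {0..1} w" "t \<in> {0..1}" "\<And>s. s \<in> {0..1} \<Longrightarrow> norm (w s) \<le> B"
    for w :: "real \<Rightarrow> 'e" and t B
  proof -
    have B0: "0 \<le> B" using order_trans[OF norm_ge_zero that(3)[of 0]] by simp
    have "norm (integral {0..t} w) \<le> B * (t - 0)"
      using that by (intro integral_bound) (auto elim: continuous_on_subset)
    also have "\<dots> \<le> B" using that(2) B0 by (simp add: mult_left_le)
    finally show ?thesis .
  qed
  have Xball: "X w t \<in> ball x0 R"
    if "continuous_on {0..1} w" "\<And>t. t \<in> {0..1} \<Longrightarrow> norm (w t) \<le> \<epsilon>" "t \<in> {0..1}" for w t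
  proof -
    have "norm (X w t - a) \<le> \<epsilon>" using bound[OF that(1,3,2)] by (simp add: X_def)
    then show ?thesis using a eps_R norm_triangle_ineq[of "X w t - a" "a - x0"]
      by (simp add: dist_norm norm_minus_commute)
  qed
  have cq: "continuous_on {0..1} (q w)"
    if "continuous_on {0..1} w" "\<And>t. t \<in> {0..1} \<Longrightarrow> norm (w t) \<le> \<epsilon>" for w
    unfolding q_def by (intro continuous_on_Q cX that) (use Xball that in auto)
  have cI: "continuous_on {0..1} (I w)"
    if "continuous_on {0..1} w" "\<And>t. t \<in> {0..1} \<Longrightarrow> norm (w t) \<le> \<epsilon>" for w
    unfolding I_def by (intro indefinite_integral_continuous_1 integrable_continuous_real cq that)
  have Idiff: "norm (I w t - I w' t) \<le> c / 8" 
    if w: "continuous_on {0..1} w" "\<And>t. t \<in> {0..1} \<Longrightarrow> norm (w t) \<le> \<epsilon>"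
      and w': "continuous_on {0..1} w'" "\<And>t. t \<in> {0..1} \<Longrightarrow> norm (w' t) \<le> \<epsilon>"
      and c: "\<And>t. t \<in> {0..1} \<Longrightarrow> norm (w t - w' t) \<le> c" and t: "t \<in> {0..1}" for w w' c t
  proof -
    have q_le: "norm (q w s - q w' s) \<le> c / 8" if s: "s \<in> {0..1}" for s
    proof -
      have "norm (X w s - X w' s) \<le> c"
        using bound[OF continuous_on_diff[OF w(1) w'(1)] s c]
          Henstock_Kurzweil_Integration.integral_diff[OF int[OF w(1) s] int[OF w'(1) s]]
        by (simp add: X_def)
      then show ?thesis
        unfolding q_def using w w' c s Xball by (intro Q_contract) auto
    qed
    have "norm (integral {0..t} (\<lambda>s. q w s - q w' s)) \<le> c / 8"
      by (rule bound[OF continuous_on_diff[OF cq[OF w] cq[OF w']] t q_le])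
    then show ?thesis
      using Henstock_Kurzweil_Integration.integral_diff[OF int[OF cq[OF w] t] int[OF cq[OF w'] t]]
      by (simp add: I_def)
  qed
  \<comment> \<open>Both \<open>I w\<close> and its mean contribute \<open>c / 8\<close>. The weaker
    bound \<open>c / 2\<close> is enough for the contraction, and for the invariance of the ball as
    well: \<open>T\<close> maps the zero function to \<open>b - a\<close>, whose norm is at most
    \<open>\<epsilon> / 2\<close>.\<close>
  have Tdiff: "norm (T w t - T w' t) \<le> c / 2" 
    if w: "continuous_on {0..1} w" "\<And>t. t \<in> {0..1} \<Longrightarrow> norm (w t) \<le> \<epsilon>"
      and w': "continuous_on {0..1} w'" "\<And>t. t \<in> {0..1} \<Longrightarrow> norm (w' t) \<le> \<epsilon>"
      and c: "\<And>t. t \<in> {0..1} \<Longrightarrow> norm (w t - w' t) \<le> c" for w w' c t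
  proof -
    define t' where "t' = max 0 (min 1 t)"
    have t': "t' \<in> {0..1}" by (auto simp: t'_def)
    have c0: "0 \<le> c" using order_trans[OF norm_ge_zero c[of 0]] by simp
    have "norm (integral {0..1} (\<lambda>s. I w s - I w' s)) \<le> c / 8"
      using Idiff[OF that] cI[OF w] cI[OF w'] by (intro bound continuous_on_diff) auto
    then have i: "norm (integral {0..1} (I w) - integral {0..1} (I w')) \<le> c / 8"
      using int[OF cI[OF w], of 1] int[OF cI[OF w'], of 1]
      by (simp add: Henstock_Kurzweil_Integration.integral_diff)
    have "norm (T w t - T w' t) \<le> c / 8 + c / 8"
      using order_trans[OF norm_triangle_ineq4 add_mono[OF Idiff[OF that t'] i]]
      by (simp add: T_def t'_def algebra_simps)
    then show ?thesis using c0 by simp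
  qed
  have T0: "T (\<lambda>_. 0) t = b - a" for t
  proof -
    have "q (\<lambda>_. 0) s = 0" for s using Q_zero[of a] a R_pos by (simp add: q_def X_def)
    then have "q (\<lambda>_. 0) = (\<lambda>_. 0)" by (simp add: fun_eq_iff)
    then have "I (\<lambda>_. 0) = (\<lambda>_. 0)" by (simp add: I_def)
    then show ?thesis by (simp add: T_def)
  qed
  have Tb: "norm (T w t) \<le> \<epsilon>"
    if w: "continuous_on {0..1} w" "\<And>t. t \<in> {0..1} \<Longrightarrow> norm (w t) \<le> \<epsilon>" for w t
  proof -
    have "norm (T w t - T (\<lambda>_. 0) t) \<le> \<epsilon> / 2"
      by (rule Tdiff[OF w]) (use w eps_pos in auto)
    then show ?thesis using b norm_triangle_ineq[of "T w t - (b - a)" "b - a"] by (simp add: T0)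
  qed
  have cT: "continuous_on UNIV (T w)"
    if w: "continuous_on {0..1} w" "\<And>t. t \<in> {0..1} \<Longrightarrow> norm (w t) \<le> \<epsilon>" for w
    unfolding T_def
    by (intro continuous_intros continuous_on_compose2[OF cI[OF w]]) auto
  define F where "F = (\<lambda>w. Bcontfun (T (apply_bcontfun w)))"
  have F: "apply_bcontfun (F w) = T (apply_bcontfun w)" if "w \<in> Y" for w
    unfolding F_def using Tb[of "apply_bcontfun w"] cT[of "apply_bcontfun w"] Yb[OF that]
    by (intro Bcontfun_inverse bcontfun_normI) auto
  have "\<exists>!w\<in>Y. F w = w"
  proof (rule Banach_fix[where c = "1/2"])
    show "complete Y" unfolding Y_def using complete_eq_closed by blast
    show "Y \<noteq> {}" using eps_pos by (auto simp: Y_def)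
    show "F ` Y \<subseteq> Y"
    proof
      fix u assume "u \<in> F ` Y"
      then obtain w where w: "w \<in> Y" "u = F w" by auto
      have "norm u \<le> \<epsilon>" using Tb[of "apply_bcontfun w"] Yb[OF w(1)] F[OF w(1)] w(2)
        by (intro norm_bound) auto
      then show "u \<in> Y" by (simp add: Y_def)
    qed
    show "dist (F w) (F w') \<le> 1/2 * dist w w'" if "w \<in> Y" "w' \<in> Y" for w w'
    proof (rule dist_bound)
      fix t
      have "norm (T w t - T w' t) \<le> dist w w' / 2"
        using Yb that by (intro Tdiff) (auto simp: dist_norm[symmetric] dist_bounded)
      then show "dist (F w t) (F w' t) \<le> 1/2 * dist w w'" using F that by (simp add: dist_norm)
    qed
  qed auto
  then obtain w where w: "w \<in> Y" "F w = w" by blast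
  have fp: "w t = T w t" for t using F[OF w(1)] w(2) by simp
  have cw: "continuous_on {0..1} (apply_bcontfun w)" by simp
  have bw: "norm (w t) \<le> \<epsilon>" for t using Yb[OF w(1)] .
  have cw': "continuous_on {0..1} (apply_bcontfun w)" "\<And>t. t \<in> {0..1} \<Longrightarrow> norm (w t) \<le> \<epsilon>"
    using cw bw by auto
  have sol: "is_sol (X w) w"
    unfolding is_sol_def
  proof (intro ballI conjI)
    fix t :: real assume t: "t \<in> {0..1}"
    show "X w t \<in> ball x0 R" using Xball[OF cw' t] .
    show "norm (w t) \<le> \<epsilon>" by (rule bw)
    show "(X w has_vector_derivative w t) (at t within {0..1})"
      unfolding X_def using integral_has_vector_derivative[OF cw t]
      by (auto intro!: derivative_eq_intros)
    have "(I w has_vector_derivative q w t) (at t within {0..1})"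
      unfolding I_def using integral_has_vector_derivative[OF cq[OF cw'] t] .
    then have d: "((\<lambda>t. (b - a) + I w t - integral {0..1} (I w)) has_vector_derivative q w t) (at t within {0..1})"
      by (auto intro!: derivative_eq_intros)
    have "w s = (b - a) + I w s - integral {0..1} (I w)" if "s \<in> {0..1}" for s
      using fp[of s] that by (simp add: T_def)
    then show "(w has_vector_derivative Q (X w t) (w t)) (at t within {0..1})"
      using has_vector_derivative_transform[OF t _ d] by (simp add: q_def)
  qed
  have "integral {0..1} w = integral {0..1} (\<lambda>t. ((b - a) - integral {0..1} (I w)) + I w t)"
    by (rule integral_cong) (use fp in \<open>auto simp: T_def\<close>)
  also have "\<dots> = b - a"
    using int[OF cI[OF cw'], of 1] by (subst Henstock_Kurzweil_Integration.integral_add) auto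
  finally have "X w 1 = b" by (simp add: X_def)
  moreover have "X w 0 = a" by (simp add: X_def)
  ultimately show ?thesis using sol by blast
qed

text \<open>Negative \<open>d\<close> reverses time, so the reversal of a path is a special case. As
  \<open>c\<close> and \<open>c + d\<close> lie in the unit interval,
  \<open>\<bar>d\<bar> \<le> 1\<close> and the velocity bound survives; the factor
  \<open>d^2\<close> of the acceleration is the one in \<open>Q_scale\<close>.\<close>

lemma is_sol_affine:
  assumes xv: "is_sol x v" and c: "c \<in> {0..1}" "c + d \<in> {0..1}"
  shows "is_sol (\<lambda>t. x (c + t * d)) (\<lambda>t. d *\<^sub>R v (c + t * d))"
proof -
  have mem: "c + t * d \<in> {0..1}" if "t \<in> {0..1}" for t
  proof -
    have "c + t * d = (1 - t) * c + t * (c + d)" by (simp add: algebra_simps)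
    moreover have "(1 - t) * c \<ge> 0" "t * (c + d) \<ge> 0" using that c by auto
    moreover have "(1 - t) * c \<le> (1 - t)" "t * (c + d) \<le> t"
      using that c by (auto intro: mult_left_le)
    ultimately show ?thesis by auto
  qed
  have aff: "((\<lambda>t. c + t * d) has_vector_derivative d) (at t within {0..1})" for t
    by (auto intro!: derivative_eq_intros simp flip: has_real_derivative_iff_has_vector_derivative)
  have sub: "(\<lambda>t. c + t * d) ` {0..1} \<subseteq> {0..1}" using mem by auto
  have d1: "\<bar>d\<bar> \<le> 1" using c by auto
  show ?thesis
    unfolding is_sol_def
  proof (intro ballI conjI)
    fix t :: real assume t: "t \<in> {0..1}"
    note s = is_solD[OF xv mem[OF t]]
    show "x (c + t * d) \<in> ball x0 R" by (rule s)
    have "\<bar>d\<bar> * norm (v (c + t * d)) \<le> 1 * \<epsilon>" using s(2) d1 by (intro mult_mono) auto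
    then show "norm (d *\<^sub>R v (c + t * d)) \<le> \<epsilon>" by simp
    show "((\<lambda>t. x (c + t * d)) has_vector_derivative d *\<^sub>R v (c + t * d)) (at t within {0..1})"
      using vector_diff_chain_within[OF aff has_vector_derivative_within_subset[OF s(3) sub]]
      by (simp add: o_def)
    have vd: "((\<lambda>t. v (c + t * d)) has_vector_derivative d *\<^sub>R Q (x (c + t * d)) (v (c + t * d))) (at t within {0..1})"
      using vector_diff_chain_within[OF aff has_vector_derivative_within_subset[OF s(4) sub]]
      by (simp add: o_def)
    show "((\<lambda>t. d *\<^sub>R v (c + t * d)) has_vector_derivative
        Q (x (c + t * d)) (d *\<^sub>R v (c + t * d))) (at t within {0..1})"
      using has_vector_derivative_scaleR[OF DERIV_const[of d] vd]
      by (simp add: Q_scale[OF s(1)] power2_eq_square)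
  qed
qed

lemma bilinear_expand:
  fixes h :: "'e \<Rightarrow> 'e \<Rightarrow> real"
  assumes "bilinear h"
  shows "h u v = (\<Sum>i\<in>Basis. \<Sum>j\<in>Basis. ((u \<bullet> i) * (v \<bullet> j)) * h i j)"
proof -
  have "h u v = h (\<Sum>i\<in>Basis. (u \<bullet> i) *\<^sub>R i) (\<Sum>j\<in>Basis. (v \<bullet> j) *\<^sub>R j)"
    by (simp add: euclidean_representation)
  also have "\<dots> = (\<Sum>i\<in>Basis. \<Sum>j\<in>Basis. h ((u \<bullet> i) *\<^sub>R i) ((v \<bullet> j) *\<^sub>R j))"
    by (simp add: bilinear_sum[OF assms] sum.cartesian_product)
  finally show ?thesis
    by (simp add: bilinear_lmul[OF assms] bilinear_rmul[OF assms] mult_ac)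
qed

text \<open>\<open>D\<close> differentiates \<open>G\<close> with fixed vectors in its slots.
  Expansion in the basis reduces the case of moving vectors to the product rule for real
  functions.\<close>

lemma G_has_vector_derivative:
  assumes t: "t \<in> S" and S: "\<And>s. s \<in> S \<Longrightarrow> x s \<in> ball x0 R"
    and x: "(x has_vector_derivative x') (at t within S)"
    and u: "(u has_vector_derivative u') (at t within S)"
    and w: "(w has_vector_derivative w') (at t within S)"
  shows "((\<lambda>t. G (x t) (u t) (w t)) has_vector_derivative
     (D (x t) x' (u t) (w t) + G (x t) u' (w t) + G (x t) (u t) w')) (at t within S)"
proof -
  have xt: "x t \<in> ball x0 R" using S[OF t] .
  have Gx: "((\<lambda>t. G (x t) i j) has_real_derivative D (x t) x' i j) (at t within S)" for i j
  proof -
    have "((\<lambda>y. G y i j) \<circ> x has_derivative (\<lambda>h. D (x t) h i j) \<circ> (\<lambda>h. h *\<^sub>R x')) (at t within S)"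
      using x has_derivative_at_withinI[OF G_deriv[OF xt]]
      by (intro diff_chain_within) (auto simp: has_vector_derivative_def)
    then show ?thesis
      by (simp add: has_field_derivative_def o_def D_simps1[OF xt] mult_commute_abs)
  qed
  have ui: "((\<lambda>t. u t \<bullet> i) has_real_derivative u' \<bullet> i) (at t within S)" for i
    unfolding has_real_derivative_iff_has_vector_derivative
    using bounded_linear.has_vector_derivative[OF bounded_linear_inner_left u] .
  have wi: "((\<lambda>t. w t \<bullet> i) has_real_derivative w' \<bullet> i) (at t within S)" for i
    unfolding has_real_derivative_iff_has_vector_derivative
    using bounded_linear.has_vector_derivative[OF bounded_linear_inner_left w] .
  have "((\<lambda>t. \<Sum>i\<in>Basis. \<Sum>j\<in>Basis. ((u t \<bullet> i) * (w t \<bullet> j)) * G (x t) i j) has_real_derivative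
     (\<Sum>i\<in>Basis. \<Sum>j\<in>Basis. ((u t \<bullet> i) * (w t \<bullet> j)) * D (x t) x' i j
       + ((u' \<bullet> i) * (w t \<bullet> j)) * G (x t) i j + ((u t \<bullet> i) * (w' \<bullet> j)) * G (x t) i j)) (at t within S)"
    by (intro DERIV_sum) (auto intro!: derivative_eq_intros Gx ui wi simp: algebra_simps)
  also have "(\<Sum>i\<in>Basis. \<Sum>j\<in>Basis. ((u t \<bullet> i) * (w t \<bullet> j)) * D (x t) x' i j
       + ((u' \<bullet> i) * (w t \<bullet> j)) * G (x t) i j + ((u t \<bullet> i) * (w' \<bullet> j)) * G (x t) i j)
     = D (x t) x' (u t) (w t) + G (x t) u' (w t) + G (x t) (u t) w'"
    by (simp add: sum.distrib bilinear_expand[OF D_bilinear[OF xt], of x' "u t" "w t"]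
        bilinear_expand[OF G_bilinear[OF xt], of u' "w t"] bilinear_expand[OF G_bilinear[OF xt], of "u t" w'])
  finally show ?thesis
    unfolding has_real_derivative_iff_has_vector_derivative
    by (rule has_vector_derivative_transform[OF t, rotated])
      (use bilinear_expand[OF G_bilinear] S in blast)
qed

text \<open>By \<open>Q_eq\<close> the two acceleration terms contribute
  \<open>2 * (1/2 - 1)\<close> times \<open>D (x t) (v t) (v t) (v t)\<close>, which cancels the
  derivative of the metric along the solution.\<close>

lemma sol_speed_const:
  assumes xv: "is_sol x v" and t: "t \<in> {0..1}"
  shows "G (x t) (v t) (v t) = G (x 0) (v 0) (v 0)"
proof -
  have "norm (G (x t) (v t) (v t) - G (x 0) (v 0) (v 0)) \<le> 0 * \<bar>t - 0\<bar>"
  proof (rule vector_derivative_bound[of 0 1 "\<lambda>t. G (x t) (v t) (v t)" "\<lambda>_. 0"])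
    fix t :: real assume t: "t \<in> {0..1}"
    note s = is_solD[OF xv t]
    show "((\<lambda>t. G (x t) (v t) (v t)) has_vector_derivative 0) (at t within {0..1})"
      using G_has_vector_derivative[OF t is_solD(1)[OF xv] s(3) s(4) s(4)]
      by (simp add: Q_eq[OF s(1)] G_sym[OF s(1), of "v t"])
  qed (use t in auto)
  then show ?thesis by simp
qed

end

section \<open>Length of short geodesics and the first variation\<close>

context geodesic_domain
begin

text \<open>Points of \<open>N1\<close> are close enough to be joined by a unique solution, and solutions joining points of
  \<open>N2\<close> stay in \<open>N1\<close> and may be glued without exceeding the velocity \<open>\<epsilon>\<close>.\<close>

definition "N1 = ball x0 (\<epsilon> / 4)"
definition "N2 = ball x0 (\<epsilon> / 20)"

lemma N2_N1: "a \<in> N2 \<Longrightarrow> a \<in> N1" and N1_B: "a \<in> N1 \<Longrightarrow> a \<in> ball x0 R"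
  and x0_N1 [simp]: "x0 \<in> N1" and x0_N2 [simp]: "x0 \<in> N2" and open_N1: "open N1" and open_N2: "open N2"
  using eps_pos eps_R by (auto simp: N1_def N2_def)

text \<open>The next three definitions are meaningful only for end points in \<open>N1\<close>.\<close>

definition gsol :: "'e \<Rightarrow> 'e \<Rightarrow> (real \<Rightarrow> 'e) \<times> (real \<Rightarrow> 'e)" where
  "gsol a b = (SOME p. is_sol (fst p) (snd p) \<and> fst p 0 = a \<and> fst p 1 = b)"

definition "gpath a b = fst (gsol a b)"
definition "vel a b = snd (gsol a b)"

lemma path_sol:
  assumes "a \<in> N1" "b \<in> N1"
  shows "is_sol (gpath a b) (vel a b)" "gpath a b 0 = a" "gpath a b 1 = b"
proof -
  have "a \<in> ball x0 (R / 2)" using assms eps_R eps_pos by (auto simp: N1_def)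
  moreover have "norm (b - a) \<le> \<epsilon> / 2"
    using assms norm_triangle_ineq4[of "b - x0" "a - x0"] by (auto simp: N1_def dist_norm norm_minus_commute)
  ultimately have "\<exists>p. is_sol (fst p) (snd p) \<and> fst p 0 = a \<and> fst p 1 = b"
    using bvp_exists by auto
  then have "is_sol (fst (gsol a b)) (snd (gsol a b)) \<and> fst (gsol a b) 0 = a \<and> fst (gsol a b) 1 = b"
    unfolding gsol_def by (rule someI_ex)
  then show "is_sol (gpath a b) (vel a b)" "gpath a b 0 = a" "gpath a b 1 = b"
    by (auto simp: gpath_def vel_def)
qed

lemma path_unique:
  assumes "a \<in> N1" "b \<in> N1" "is_sol x v" "x 0 = a" "x 1 = b" "t \<in> {0..1}"
  shows "gpath a b t = x t" "vel a b t = v t"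
  using sol_eqI[OF path_sol(1)[OF assms(1,2)] assms(3,6)] path_sol[OF assms(1,2)] assms by auto

lemma path_affine:
  assumes ab: "a \<in> N1" "b \<in> N1" and c: "c \<in> {0..1}" "c + d \<in> {0..1}" and t: "t \<in> {0..1}"
    and N: "gpath a b c \<in> N1" "gpath a b (c + d) \<in> N1"
  shows "gpath (gpath a b c) (gpath a b (c + d)) t = gpath a b (c + t * d)"
    and "vel (gpath a b c) (gpath a b (c + d)) t = d *\<^sub>R vel a b (c + t * d)"
  by (rule path_unique[OF N is_sol_affine[OF path_sol(1)[OF ab] c]]; use t in simp)+

lemma path_rev:
  assumes "a \<in> N1" "b \<in> N1" "t \<in> {0..1}"
  shows "gpath b a t = gpath a b (1 - t)" "vel b a t = - vel a b (1 - t)"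
  using path_affine[OF assms(1,2), of 1 "-1" t] path_sol[OF assms(1,2)] assms by auto

lemma vel_lipschitz:
  assumes "a \<in> N1" "b \<in> N1" "a' \<in> N1" "b' \<in> N1" "t \<in> {0..1}"
  shows "norm (vel a' b' t - vel a b t) \<le> 2 * (norm ((b' - b) - (a' - a)) + norm (a' - a))"
  using sol_compare_bvp[OF path_sol(1)[OF assms(1,2)] path_sol(1)[OF assms(3,4)] assms(5)]
    path_sol[OF assms(1,2)] path_sol[OF assms(3,4)] by (simp add: algebra_simps)

lemma path_lipschitz:
  assumes "a \<in> N1" "b \<in> N1" "a' \<in> N1" "b' \<in> N1" "t \<in> {0..1}"
  shows "norm ((gpath a' b' t - gpath a b t) - (a' - a)) \<le> 2 * (norm ((b' - b) - (a' - a)) + norm (a' - a))"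
    (is "_ \<le> ?B")
proof -
  have "norm ((gpath a' b' t - gpath a b t) - (gpath a' b' 0 - gpath a b 0)) \<le> ?B * \<bar>t - 0\<bar>"
  proof (rule vector_derivative_bound[of 0 1 _ "\<lambda>t. vel a' b' t - vel a b t"])
    fix t :: real assume "t \<in> {0..1}"
    then show "((\<lambda>t. gpath a' b' t - gpath a b t) has_vector_derivative vel a' b' t - vel a b t) (at t within {0..1})"
      using is_solD(3)[OF path_sol(1)[OF assms(1,2)]] is_solD(3)[OF path_sol(1)[OF assms(3,4)]]
      by (intro has_vector_derivative_diff) auto
    show "norm (vel a' b' t - vel a b t) \<le> ?B" using vel_lipschitz[OF assms(1-4)] \<open>t \<in> {0..1}\<close> .
  qed (use assms in auto)
  also have "\<dots> \<le> ?B * 1" using assms(5) by (intro mult_left_mono) auto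
  finally show ?thesis using path_sol[OF assms(1,2)] path_sol[OF assms(3,4)] by simp
qed

lemma path_refl: "a \<in> N1 \<Longrightarrow> t \<in> {0..1} \<Longrightarrow> gpath a a t = a" "a \<in> N1 \<Longrightarrow> t \<in> {0..1} \<Longrightarrow> vel a a t = 0"
  using path_unique[of a a "\<lambda>_. a" "\<lambda>_. 0" t] is_sol_const[OF N1_B] by auto

lemma vel_upper: "a \<in> N1 \<Longrightarrow> b \<in> N1 \<Longrightarrow> t \<in> {0..1} \<Longrightarrow> norm (vel a b t) \<le> 2 * norm (b - a)"
  using vel_lipschitz[of a a a b t] path_refl[of a t] by simp

lemma path_near: "a \<in> N1 \<Longrightarrow> b \<in> N1 \<Longrightarrow> t \<in> {0..1} \<Longrightarrow> norm (gpath a b t - a) \<le> 2 * norm (b - a)"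
  using path_lipschitz[of a a a b t] path_refl[of a t] by simp

text \<open>The path strays from \<open>a\<close> by at most twice \<open>norm (b - a)\<close>. Its
  distance from the centre is therefore at most \<open>2 + 3\<close> times the radius of
  \<open>N2\<close>, which is exactly the radius of \<open>N1\<close>.\<close>

lemma path_in_N1:
  assumes "a \<in> N2" "b \<in> N2" "t \<in> {0..1}"
  shows "gpath a b t \<in> N1"
proof -
  have "norm (gpath a b t - x0) \<le> norm (gpath a b t - a) + norm (a - x0)"
    using norm_triangle_ineq[of "gpath a b t - a" "a - x0"] by simp
  also have "norm (gpath a b t - a) \<le> 2 * norm (b - a)" using path_near N2_N1 assms by auto
  also have "norm (b - a) \<le> norm (b - x0) + norm (a - x0)"
    using norm_triangle_ineq4[of "b - x0" "a - x0"] by simp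
  finally have "norm (gpath a b t - x0) \<le> 2 * norm (b - x0) + 3 * norm (a - x0)" by simp
  moreover have "norm (b - x0) < \<epsilon> / 20" "norm (a - x0) < \<epsilon> / 20"
    using assms by (auto simp: N2_def dist_norm norm_minus_commute)
  ultimately show ?thesis by (auto simp: N1_def dist_norm norm_minus_commute)
qed

lemma vel_ivp:
  assumes "a \<in> N1" "b \<in> N1" "b' \<in> N1" "vel a b 0 = vel a b' 0"
  shows "b = b'"
  using sol_eqI(1)[OF path_sol(1)[OF assms(1,2)] path_sol(1)[OF assms(1,3)], of 1]
    path_sol[OF assms(1,2)] path_sol[OF assms(1,3)] assms(4) by auto

text \<open>Comparison with the constant solution at \<open>a\<close> bounds all velocities by twice
  the initial one.\<close>

lemma vel0_lower:
  assumes "a \<in> N1" "b \<in> N1"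
  shows "norm (b - a) \<le> 2 * norm (vel a b 0)"
proof -
  note P = path_sol[OF assms]
  have v: "norm (vel a b t) \<le> 2 * norm (vel a b 0)" if "t \<in> {0..1}" for t
    using sol_compare_ivp[OF is_sol_const[OF N1_B[OF assms(1)]] P(1) that] P by simp
  have "norm (gpath a b 1 - gpath a b 0) \<le> 2 * norm (vel a b 0) * \<bar>1 - 0\<bar>"
    by (rule vector_derivative_bound[of 0 1 _ "vel a b"]) (use v is_solD(3)[OF P(1)] in auto)
  then show ?thesis using P by simp
qed

text \<open>The squared speed, which is constant along the solution. As time runs over
  \<open>[0, 1]\<close>, its square root \<open>\<rho>\<close> is the length of the
  solution.\<close>

definition "En a b = G a (vel a b 0) (vel a b 0)"
definition "\<rho> a b = sqrt (En a b)"

lemma En_speed: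
  assumes "a \<in> N1" "b \<in> N1" "t \<in> {0..1}"
  shows "G (gpath a b t) (vel a b t) (vel a b t) = En a b"
  using sol_speed_const[OF path_sol(1)[OF assms(1,2)] assms(3)] path_sol[OF assms(1,2)]
  by (simp add: En_def)

lemma En_nonneg: "a \<in> N1 \<Longrightarrow> 0 \<le> En a b"
  by (simp add: En_def G_nonneg[OF N1_B])

lemma rho_sq: "a \<in> N1 \<Longrightarrow> (\<rho> a b)\<^sup>2 = En a b"
  by (simp add: \<rho>_def En_nonneg)

lemma rho_nonneg: "a \<in> N1 \<Longrightarrow> 0 \<le> \<rho> a b"
  by (simp add: \<rho>_def En_nonneg)

lemma En_sym: "a \<in> N1 \<Longrightarrow> b \<in> N1 \<Longrightarrow> En b a = En a b"
  using En_speed[of a b 1] path_rev[of a b 0] path_sol[of a b]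
  by (simp add: En_def[of b] G_simps[OF N1_B])

lemma rho_sym: "a \<in> N1 \<Longrightarrow> b \<in> N1 \<Longrightarrow> \<rho> b a = \<rho> a b"
  by (simp add: \<rho>_def En_sym)

lemma rho_lower:
  assumes "a \<in> N1" "b \<in> N1"
  shows "norm (b - a) \<le> 2 * K * \<rho> a b"
proof -
  have "(norm (vel a b 0))\<^sup>2 \<le> K * En a b" using G_lower[OF N1_B[OF assms(1)]] by (simp add: En_def)
  also have "\<dots> \<le> K\<^sup>2 * En a b"
    using K_ge1 En_nonneg[OF assms(1)] by (intro mult_right_mono) (auto simp: power2_eq_square)
  also have "\<dots> = (K * \<rho> a b)\<^sup>2" by (simp add: power_mult_distrib rho_sq[OF assms(1)])
  finally have "norm (vel a b 0) \<le> K * \<rho> a b"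
    using K_ge1 rho_nonneg[OF assms(1)] power2_le_imp_le by auto
  then show ?thesis using vel0_lower[OF assms] by simp
qed

lemma rho_upper:
  assumes "a \<in> N1" "b \<in> N1"
  shows "\<rho> a b \<le> 2 * K * norm (b - a)"
proof -
  have "(\<rho> a b)\<^sup>2 \<le> K * norm (vel a b 0) * norm (vel a b 0)"
    using G_upper[OF N1_B[OF assms(1)], of "vel a b 0" "vel a b 0"] by (simp add: rho_sq[OF assms(1)] En_def)
  also have "\<dots> \<le> K * (2 * norm (b - a)) * (2 * norm (b - a))"
    using vel_upper[OF assms, of 0] K_ge1 by (intro mult_mono) auto
  also have "\<dots> = K * (4 * (norm (b - a))\<^sup>2)" by (simp add: power2_eq_square)
  also have "\<dots> \<le> K\<^sup>2 * (4 * (norm (b - a))\<^sup>2)"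
    using K_ge1 by (intro mult_right_mono) (auto simp: power2_eq_square)
  also have "\<dots> = (2 * K * norm (b - a))\<^sup>2" by (simp add: power2_eq_square)
  finally show ?thesis using K_ge1 by (intro power2_le_imp_le[of "\<rho> a b"]) auto
qed

lemma rho_eq0: "a \<in> N1 \<Longrightarrow> b \<in> N1 \<Longrightarrow> \<rho> a b = 0 \<longleftrightarrow> a = b"
  using rho_lower[of a b] rho_upper[of a b] rho_nonneg[of a b] by auto

lemma rho_pos: "a \<in> N1 \<Longrightarrow> b \<in> N1 \<Longrightarrow> a \<noteq> b \<Longrightarrow> 0 < \<rho> a b"
  using rho_eq0[of a b] rho_nonneg[of a b] by auto

text \<open>The derivative of the remainder at \<open>z\<close> is the difference of
  \<open>D\<close> at \<open>z\<close> and at \<open>x\<close>. By its Lipschitz condition it is of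
  order \<open>norm (y - x)\<close> on the segment, and the mean value inequality supplies the
  second factor.\<close>

lemma G_taylor:
  assumes x: "x \<in> ball x0 R" and y: "y \<in> ball x0 R"
  shows "\<bar>G y u v - G x u v - D x (y - x) u v\<bar> \<le> K * (norm (y - x))\<^sup>2 * norm u * norm v"
proof -
  define S where "S = closed_segment x y"
  have S: "S \<subseteq> ball x0 R" unfolding S_def using x y by (intro closed_segment_subset) auto
  have "norm ((\<lambda>z. G z u v - D x (z - x) u v) y - (\<lambda>z. G z u v - D x (z - x) u v) x) \<le>
    (K * norm (y - x) * norm u * norm v) * norm (y - x)"
  proof (rule differentiable_bound[of S _ "\<lambda>z h. D z h u v - D x h u v"])
    fix z assume z: "z \<in> S"
    then have zB: "z \<in> ball x0 R" using S by auto
    have lin: "bounded_linear (\<lambda>h. D x h u v)" using G_deriv[OF x] has_derivative_bounded_linear by blast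
    have "((\<lambda>z. D x (z - x) u v) has_derivative (\<lambda>h. D x h u v)) (at z within S)"
      by (rule bounded_linear.has_derivative[OF lin]) (auto intro!: derivative_eq_intros)
    then show "((\<lambda>z. G z u v - D x (z - x) u v) has_derivative (\<lambda>h. D z h u v - D x h u v)) (at z within S)"
      using has_derivative_at_withinI[OF G_deriv[OF zB]] by (intro has_derivative_diff) auto
    show "onorm (\<lambda>h. D z h u v - D x h u v) \<le> K * norm (y - x) * norm u * norm v"
    proof (rule onorm_le)
      fix h
      have "norm (D z h u v - D x h u v) \<le> K * norm (z - x) * norm h * norm u * norm v"
        using D_lipschitz[OF zB x] by simp
      also have "\<dots> \<le> K * norm (y - x) * norm h * norm u * norm v"
        using segment_bound1[of z x y] z K_ge1 unfolding S_def
        by (intro mult_right_mono mult_left_mono) auto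
      finally show "norm (D z h u v - D x h u v) \<le> K * norm (y - x) * norm u * norm v * norm h"
        by (simp add: mult_ac)
    qed
  qed (auto simp: S_def)
  then show ?thesis by (simp add: D_simps1[OF x] power2_eq_square mult_ac diff_diff_eq add.commute)
qed

lemma eps_le1: "\<epsilon> \<le> 1"
proof -
  have "\<epsilon> \<le> 1 / (24 * L)" by (simp add: \<epsilon>_def)
  also have "\<dots> \<le> 1" using L_ge6 by simp
  finally show ?thesis .
qed

text \<open>Pairing the difference of two solutions with the velocity of the first one turns the energy
  difference into a boundary term; what remains is quadratic in the difference.\<close>

lemma first_variation:
  assumes a: "a \<in> N1" and b: "b \<in> N1" and b': "b' \<in> N1"
  shows "\<bar>En a b' - En a b - 2 * G b (vel a b 1) (b' - b)\<bar> \<le> 16 * K * (norm (b' - b))\<^sup>2"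
proof -
  define x v y w where "x = gpath a b" and "v = vel a b" and "y = gpath a b'" and "w = vel a b'"
  define H where "H = (\<lambda>t. y t - x t)"
  define h where "h = norm (b' - b)"
  note X = path_sol[OF a b, folded x_def v_def] and Y = path_sol[OF a b', folded y_def w_def]
  \<comment> \<open>\<open>\<phi>\<close> vanishes at \<open>0\<close> and equals the quantity to be
    estimated at \<open>1\<close>, because \<open>H\<close> vanishes at \<open>0\<close> and is
    \<open>b' - b\<close> at \<open>1\<close>. Constancy of the two energies permits the linear
    function of time.\<close>
  define \<phi> where "\<phi> = (\<lambda>t. t * (En a b' - En a b) - 2 * G (x t) (v t) (H t))"
  \<comment> \<open>This is the derivative of \<open>\<phi>\<close> after the geodesic equation has
    removed all terms linear in \<open>H\<close> and its derivative. What remains is a Taylor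
    remainder, a Lipschitz difference and a square, each of second order.\<close>
  define \<phi>' where "\<phi>' = (\<lambda>t. (G (y t) (v t) (v t) - G (x t) (v t) (v t) - D (x t) (H t) (v t) (v t))
     + 2 * (G (y t) (v t) (w t - v t) - G (x t) (v t) (w t - v t)) + G (y t) (w t - v t) (w t - v t))"
  have dphi: "(\<phi> has_vector_derivative \<phi>' t) (at t within {0..1})" if t: "t \<in> {0..1}" for t
  proof -
    note xs = is_solD[OF X(1) t] and ys = is_solD[OF Y(1) t]
    have dH: "(H has_vector_derivative w t - v t) (at t within {0..1})"
      unfolding H_def using xs ys by (intro has_vector_derivative_diff) auto
    have 1: "((\<lambda>t. G (x t) (v t) (H t)) has_vector_derivative
        D (x t) (v t) (v t) (H t) + G (x t) (Q (x t) (v t)) (H t) + G (x t) (v t) (w t - v t)) (at t within {0..1})"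
      by (rule G_has_vector_derivative[OF t is_solD(1)[OF X(1)] xs(3) xs(4) dH])
    have "En a b' = G (y t) (w t) (w t)" "En a b = G (x t) (v t) (v t)"
      using En_speed[OF a b t] En_speed[OF a b' t] by (simp_all add: x_def v_def y_def w_def)
    moreover have "G (y t) (w t) (w t) = G (y t) (v t) (v t) + 2 * G (y t) (v t) (w t - v t) + G (y t) (w t - v t) (w t - v t)"
      by (simp add: G_simps[OF ys(1)] G_sym[OF ys(1), of "w t" "v t"])
    ultimately have "(En a b' - En a b) - 2 * (D (x t) (v t) (v t) (H t) + G (x t) (Q (x t) (v t)) (H t) + G (x t) (v t) (w t - v t)) = \<phi>' t"
      by (simp add: \<phi>'_def Q_eq[OF xs(1)] algebra_simps)
    moreover have "(\<phi> has_vector_derivative (En a b' - En a b) - 2 * (D (x t) (v t) (v t) (H t) + G (x t) (Q (x t) (v t)) (H t) + G (x t) (v t) (w t - v t))) (at t within {0..1})"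
      unfolding \<phi>_def using 1 by (auto intro!: derivative_eq_intros simp flip: has_real_derivative_iff_has_vector_derivative)
    ultimately show ?thesis by simp
  qed
  have bound: "norm (\<phi>' t) \<le> 16 * K * h\<^sup>2" if t: "t \<in> {0..1}" for t
  proof -
    note xs = is_solD[OF X(1) t] and ys = is_solD[OF Y(1) t]
    have wv: "norm (w t - v t) \<le> 2 * h"
      using vel_lipschitz[OF a b a b' t] by (simp add: w_def v_def h_def)
    have H: "norm (H t) \<le> 2 * h"
      using path_lipschitz[OF a b a b' t] by (simp add: H_def x_def y_def h_def)
    have v: "norm (v t) \<le> 1" using xs(2) eps_le1 by simp
    have h0: "0 \<le> h" and K0: "0 \<le> K" using K_ge1 by (simp_all add: h_def)
    have "\<bar>G (y t) (v t) (v t) - G (x t) (v t) (v t) - D (x t) (H t) (v t) (v t)\<bar> \<le> K * (norm (H t))\<^sup>2 * norm (v t) * norm (v t)"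
      using G_taylor[OF xs(1) ys(1)] by (simp add: H_def)
    also have "\<dots> \<le> K * (2 * h)\<^sup>2 * 1 * 1"
      using v H K0 h0 by (intro mult_mono power_mono mult_nonneg_nonneg) auto
    finally have 1: "\<bar>G (y t) (v t) (v t) - G (x t) (v t) (v t) - D (x t) (H t) (v t) (v t)\<bar> \<le> 4 * (K * h\<^sup>2)"
      by (simp add: power_mult_distrib)
    have "\<bar>G (y t) (v t) (w t - v t) - G (x t) (v t) (w t - v t)\<bar> \<le> K * norm (H t) * norm (v t) * norm (w t - v t)"
      using G_lipschitz[OF ys(1) xs(1)] by (simp add: H_def)
    also have "\<dots> \<le> K * (2 * h) * 1 * (2 * h)"
      using v H K0 h0 wv by (intro mult_mono mult_nonneg_nonneg) auto
    finally have 2: "\<bar>G (y t) (v t) (w t - v t) - G (x t) (v t) (w t - v t)\<bar> \<le> 4 * (K * h\<^sup>2)"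
      by (simp add: power2_eq_square)
    have "\<bar>G (y t) (w t - v t) (w t - v t)\<bar> \<le> K * norm (w t - v t) * norm (w t - v t)"
      by (rule G_upper[OF ys(1)])
    also have "\<dots> \<le> K * (2 * h) * (2 * h)"
      using K0 h0 wv by (intro mult_mono mult_nonneg_nonneg) auto
    finally have 3: "\<bar>G (y t) (w t - v t) (w t - v t)\<bar> \<le> 4 * (K * h\<^sup>2)"
      by (simp add: power2_eq_square)
    \<comment> \<open>The constant \<open>16\<close> is \<open>4 + 2 * 4 + 4\<close>, one summand
      for each of the three terms.\<close>
    have tri: "\<bar>p + 2 * q + r\<bar> \<le> 16 * c" if "\<bar>p\<bar> \<le> 4 * c" "\<bar>q\<bar> \<le> 4 * c" "\<bar>r\<bar> \<le> 4 * c" for p q r c :: real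
      using that by arith
    show ?thesis using tri[OF 1 2 3] by (simp add: \<phi>'_def mult.assoc)
  qed
  have "norm (\<phi> 1 - \<phi> 0) \<le> 16 * K * h\<^sup>2 * \<bar>1 - 0\<bar>"
    by (rule vector_derivative_bound[OF dphi bound]) auto
  moreover have "\<phi> 0 = 0" "\<phi> 1 = En a b' - En a b - 2 * G b (v 1) (b' - b)"
    using X Y G_simps[OF N1_B[OF a]] by (simp_all add: \<phi>_def H_def)
  ultimately show ?thesis by (simp add: h_def v_def)
qed

lemma En_has_derivative:
  assumes a: "a \<in> N1" and b: "b \<in> N1"
  shows "(En a has_derivative (\<lambda>h. 2 * G b (vel a b 1) h)) (at b)"
  unfolding has_derivative_at_within
proof (intro conjI)
  have "linear (\<lambda>h. G b (vel a b 1) h)" using G_linear(1)[OF N1_B[OF b]] .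
  then show "bounded_linear (\<lambda>h. 2 * G b (vel a b 1) h)"
    by (intro bounded_linear_mult_right[THEN bounded_linear_compose, unfolded o_def] linear_conv_bounded_linear[THEN iffD1])
  show "((\<lambda>y. (En a y - En a b - 2 * G b (vel a b 1) (y - b)) /\<^sub>R norm (y - b)) \<longlongrightarrow> 0) (at b)"
  proof (rule Lim_null_comparison)
    have "\<forall>\<^sub>F y in at b. y \<in> N1" using eventually_at_topological open_N1 b by blast
    then show "\<forall>\<^sub>F y in at b. norm ((En a y - En a b - 2 * G b (vel a b 1) (y - b)) /\<^sub>R norm (y - b)) \<le> 16 * K * norm (y - b)"
    proof eventually_elim
      case (elim y)
      have "\<bar>En a y - En a b - 2 * G b (vel a b 1) (y - b)\<bar> \<le> (16 * K * norm (y - b)) * norm (y - b)"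
        using first_variation[OF a b elim] by (simp add: power2_eq_square)
      then show ?case
        by (cases "y = b") (simp_all add: divide_simps mult_ac)
    qed
    have "((\<lambda>y. 16 * K * norm (y - b)) \<longlongrightarrow> 16 * K * norm (b - b)) (at b)"
      by (intro tendsto_intros)
    then show "((\<lambda>y. 16 * K * norm (y - b)) \<longlongrightarrow> 0) (at b)" by simp
  qed
qed

lemma G_Cauchy_Schwarz:
  assumes x: "x \<in> ball x0 R"
  shows "\<bar>G x u v\<bar> \<le> sqrt (G x u u) * sqrt (G x v v)"
proof -
  have "(G x u v)\<^sup>2 \<le> G x u u * G x v v"
  proof (cases "G x u u = 0")
    case True
    then show ?thesis using G_eq0[OF x True] by (simp add: G_simps[OF x])
  next
    case False
    then have pos: "0 < G x u u" using G_nonneg[OF x, of u] by simp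
    define c where "c = G x u v / G x u u"
    have "0 \<le> G x (v - c *\<^sub>R u) (v - c *\<^sub>R u)" by (rule G_nonneg[OF x])
    also have "\<dots> = G x v v - 2 * c * G x u v + c * (c * G x u u)"
      by (simp add: G_simps[OF x] G_sym[OF x, of v u] algebra_simps)
    also have "c * G x u u = G x u v" using pos by (simp add: c_def)
    finally have "c * G x u v \<le> G x v v" by simp
    then show ?thesis using pos by (simp add: c_def field_simps power2_eq_square)
  qed
  then have "sqrt ((G x u v)\<^sup>2) \<le> sqrt (G x u u * G x v v)" by (rule real_sqrt_le_mono)
  then show ?thesis by (simp add: real_sqrt_mult)
qed

lemma rho_has_derivative:
  assumes a: "a \<in> N1" and b: "b \<in> N1" and "a \<noteq> b"
  shows "(\<rho> a has_derivative (\<lambda>h. G b (vel a b 1) h / \<rho> a b)) (at b)"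
proof -
  have pos: "0 < En a b" using rho_pos[OF assms] by (simp add: \<rho>_def)
  have "((\<lambda>y. sqrt (En a y)) has_derivative (\<lambda>h. 2 * G b (vel a b 1) h * (inverse (sqrt (En a b)) / 2))) (at b)"
    using En_has_derivative[OF a b] pos by (auto intro!: derivative_eq_intros)
  moreover have "(\<lambda>y. sqrt (En a y)) = \<rho> a" by (simp add: \<rho>_def fun_eq_iff)
  ultimately show ?thesis by (simp add: \<rho>_def field_simps)
qed

text \<open>The regularisation by \<open>\<eta>\<close> avoids the singularity of \<open>\<rho> a\<close> at \<open>a\<close>.\<close>

lemma rho_le_length:
  assumes a: "a \<in> N1" and \<alpha>\<beta>: "\<alpha> \<le> \<beta>" and c: "\<And>t. t \<in> {\<alpha>..\<beta>} \<Longrightarrow> c t \<in> N1"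
    and dc: "\<And>t. t \<in> {\<alpha>..\<beta>} \<Longrightarrow> (c has_vector_derivative c' t) (at t within {\<alpha>..\<beta>})"
    and int: "((\<lambda>t. sqrt (G (c t) (c' t) (c' t))) has_integral l) {\<alpha>..\<beta>}"
  shows "\<rho> a (c \<beta>) \<le> \<rho> a (c \<alpha>) + l"
proof (rule field_le_epsilon)
  fix \<eta> :: real assume \<eta>: "0 < \<eta>"
  define f where "f = (\<lambda>t. sqrt (En a (c t) + \<eta>\<^sup>2))"
  define f' where "f' = (\<lambda>t. G (c t) (vel a (c t) 1) (c' t) / f t)"
  have pos: "0 < En a y + \<eta>\<^sup>2" for y using En_nonneg[OF a] \<eta> by (simp add: add_nonneg_pos)
  have df: "(f has_vector_derivative f' t) (at t within {\<alpha>..\<beta>})" if t: "t \<in> {\<alpha>..\<beta>}" for t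
  proof -
    have "((\<lambda>y. sqrt (En a y + \<eta>\<^sup>2)) has_derivative
        (\<lambda>h. 2 * G (c t) (vel a (c t) 1) h * (inverse (sqrt (En a (c t) + \<eta>\<^sup>2)) / 2))) (at (c t))"
      using En_has_derivative[OF a c[OF t]] pos by (auto intro!: derivative_eq_intros)
    then have "((\<lambda>y. sqrt (En a y + \<eta>\<^sup>2)) \<circ> c has_derivative
       (\<lambda>h. 2 * G (c t) (vel a (c t) 1) h * (inverse (sqrt (En a (c t) + \<eta>\<^sup>2)) / 2)) \<circ> (\<lambda>h. h *\<^sub>R c' t)) (at t within {\<alpha>..\<beta>})"
      using dc[OF t] has_derivative_at_withinI
      by (intro diff_chain_within) (auto simp: has_vector_derivative_def)
    then show ?thesis
      unfolding has_vector_derivative_def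
      by (simp add: o_def f_def f'_def G_simps[OF N1_B[OF c[OF t]]] field_simps)
  qed
  \<comment> \<open>By constancy of the speed, the final velocity of the solution has length
    \<open>\<rho> a (c t)\<close> in the metric at \<open>c t\<close>. Cauchy-Schwarz then shows
    that the regularised length grows no faster than the curve moves.\<close>
  have f'_le: "f' t \<le> sqrt (G (c t) (c' t) (c' t))" if t: "t \<in> {\<alpha>..\<beta>}" for t
  proof -
    note cB = N1_B[OF c[OF t]]
    have fpos: "0 < f t" using pos by (simp add: f_def)
    have "G (c t) (vel a (c t) 1) (c' t) \<le> sqrt (En a (c t)) * sqrt (G (c t) (c' t) (c' t))"
      using G_Cauchy_Schwarz[OF cB, of "vel a (c t) 1" "c' t"] En_speed[OF a c[OF t], of 1] path_sol(3)[OF a c[OF t]]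
      by simp
    also have "\<dots> \<le> f t * sqrt (G (c t) (c' t) (c' t))"
      unfolding f_def using G_nonneg[OF cB] by (intro mult_right_mono real_sqrt_le_mono) auto
    finally show ?thesis using fpos by (simp add: f'_def field_simps)
  qed
  have "(f' has_integral (f \<beta> - f \<alpha>)) {\<alpha>..\<beta>}"
    using fundamental_theorem_of_calculus[OF \<alpha>\<beta> df] .
  then have "f \<beta> - f \<alpha> \<le> l" using has_integral_le[OF _ int f'_le] by blast
  moreover have "\<rho> a (c \<beta>) \<le> f \<beta>" by (simp add: \<rho>_def f_def)
  moreover have "f \<alpha> \<le> \<rho> a (c \<alpha>) + \<eta>"
  proof -
    have "f \<alpha> \<le> sqrt (En a (c \<alpha>)) + sqrt (\<eta>\<^sup>2)"
      unfolding f_def using En_nonneg[OF a] by (intro sqrt_add_le_add_sqrt) auto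
    then show ?thesis using \<eta> by (simp add: \<rho>_def)
  qed
  ultimately show "\<rho> a (c \<beta>) \<le> \<rho> a (c \<alpha>) + l + \<eta>" by simp
qed

end

section \<open>Gluing and extending geodesics\<close>

lemma has_vector_derivative_glue:
  fixes f g :: "real \<Rightarrow> 'b::real_normed_vector"
  assumes "a \<le> b" "b \<le> c" and t: "t \<in> {a..c}"
    and f: "\<And>t. t \<in> {a..b} \<Longrightarrow> (f has_vector_derivative f' t) (at t within {a..b})"
    and g: "\<And>t. t \<in> {b..c} \<Longrightarrow> (g has_vector_derivative g' t) (at t within {b..c})"
    and eq: "f b = g b" "f' b = g' b"
  shows "((\<lambda>t. if t \<le> b then f t else g t) has_vector_derivative (if t \<le> b then f' t else g' t)) (at t within {a..c})"
proof -
  have u: "{a..c} = {a..b} \<union> {b..c}" using assms by auto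
  have i: "{a..b} \<inter> {b..c} = {b}" using assms by auto
  have "((\<lambda>t. if t \<in> {a..b} then f t else g t) has_vector_derivative (if t \<in> {a..b} then f' t else g' t)) (at t within {a..c})"
    by (rule has_vector_derivative_If_within_closures[OF _ u])
      (use t u f g eq assms(1,2) in \<open>auto simp: i insert_absorb\<close>)
  then have "((\<lambda>t. if t \<in> {a..b} then f t else g t) has_vector_derivative (if t \<le> b then f' t else g' t)) (at t within {a..c})"
    using t by auto
  then show ?thesis
    by (rule has_vector_derivative_transform[OF t, rotated]) auto
qed

context geodesic_domain
begin

text \<open>The solution from \<open>m\<close> to \<open>b\<close> stays in \<open>N1\<close> and
  has constant speed \<open>\<rho> m b\<close>; it is one of the curves to which
  \<open>rho_le_length\<close> applies.\<close>

lemma rho_triangle: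
  assumes "a \<in> N2" "m \<in> N2" "b \<in> N2"
  shows "\<rho> a b \<le> \<rho> a m + \<rho> m b"
proof -
  note N = assms[THEN N2_N1]
  note P = path_sol[OF N(2,3)]
  have "((\<lambda>t. \<rho> m b) has_integral \<rho> m b) {0..1::real}"
    using has_integral_const_real[of "\<rho> m b" 0 1] by simp
  then have "((\<lambda>t. sqrt (G (gpath m b t) (vel m b t) (vel m b t))) has_integral \<rho> m b) {0..1}"
    by (rule has_integral_cong[THEN iffD1, rotated]) (use En_speed[OF N(2,3)] in \<open>simp add: \<rho>_def\<close>)
  then show ?thesis
    using rho_le_length[OF N(1), of 0 1 "gpath m b" "vel m b" "\<rho> m b"]
      path_in_N1[OF assms(2,3)] is_solD(3)[OF P(1)] P(2,3) by auto
qed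

lemma dist_N2: "a \<in> N2 \<Longrightarrow> b \<in> N2 \<Longrightarrow> norm (a - b) < \<epsilon> / 10"
  using norm_triangle_ineq4[of "a - x0" "b - x0"] by (auto simp: N2_def dist_norm norm_minus_commute)

text \<open>Run at constant speed over \<open>[0, 1]\<close>, the two paths meet at time
  \<open>1 / (1 + l)\<close>. The hypothesis makes the velocities agree there, and since
  \<open>Q\<close> is quadratic in the velocity the accelerations agree too. The concatenation is
  therefore a solution, and uniqueness identifies it with the path from \<open>a\<close> to
  \<open>b\<close>.\<close>

lemma glue:
  assumes a: "a \<in> N2" and m: "m \<in> N2" and b: "b \<in> N2" and l: "0 < l"
    and v: "vel m b 0 = l *\<^sub>R vel a m 1"
  shows "gpath a b (1 / (1 + l)) = m" "\<rho> a b = \<rho> a m + \<rho> m b" "\<rho> m b = l * \<rho> a m"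
proof -
  note N = a[THEN N2_N1] m[THEN N2_N1] b[THEN N2_N1]
  define k where "k = 1 + l"
  define \<theta> where "\<theta> = 1 / k"
  have k: "1 < k" "k * \<theta> = 1" "0 < \<theta>" "\<theta> < 1" using l by (auto simp: k_def \<theta>_def)
  note P = path_sol[OF N(1,2)] and P' = path_sol[OF N(2,3)]
  define z where "z = (\<lambda>t. if t \<le> \<theta> then gpath a m (k * t) else gpath m b ((k * t - 1) / l))"
  define u where "u = (\<lambda>t. if t \<le> \<theta> then k *\<^sub>R vel a m (k * t) else (k / l) *\<^sub>R vel m b ((k * t - 1) / l))"
  define u' where "u' = (\<lambda>t. if t \<le> \<theta> then k *\<^sub>R (k *\<^sub>R Q (gpath a m (k * t)) (vel a m (k * t)))
     else (k / l) *\<^sub>R ((k / l) *\<^sub>R Q (gpath m b ((k * t - 1) / l)) (vel m b ((k * t - 1) / l))))"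
  have m1: "k * t \<in> {0..1}" if "t \<in> {0..\<theta>}" for t
    using that k mult_left_mono[of t \<theta> k] by auto
  have m2: "(k * t - 1) / l \<in> {0..1}" if "t \<in> {\<theta>..1}" for t
  proof -
    have "1 \<le> k * t" using that k mult_left_mono[of \<theta> t k] by auto
    moreover have "k * t \<le> k" using that k mult_left_mono[of t 1 k] by auto
    ultimately show ?thesis using l by (auto simp: k_def field_simps)
  qed
  have aff1: "((\<lambda>t. k * t) has_vector_derivative k) (at t within {0..\<theta>})" for t
    by (auto intro!: derivative_eq_intros simp flip: has_real_derivative_iff_has_vector_derivative)
  have aff2: "((\<lambda>t. (k * t - 1) / l) has_vector_derivative (k / l)) (at t within {\<theta>..1})" for t
    using l by (auto intro!: derivative_eq_intros simp flip: has_real_derivative_iff_has_vector_derivative)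
  have sub1: "(\<lambda>t. k * t) ` {0..\<theta>} \<subseteq> {0..1}" and sub2: "(\<lambda>t. (k * t - 1) / l) ` {\<theta>..1} \<subseteq> {0..1}"
    using m1 m2 by auto
  have d1: "((\<lambda>t. x (k * t)) has_vector_derivative k *\<^sub>R x') (at t within {0..\<theta>})"
    if "(x has_vector_derivative x') (at (k * t) within {0..1})" for x :: "real \<Rightarrow> 'e" and x' t
    using vector_diff_chain_within[OF aff1 has_vector_derivative_within_subset[OF that sub1]] by (simp add: o_def)
  have d2: "((\<lambda>t. x ((k * t - 1) / l)) has_vector_derivative (k / l) *\<^sub>R x') (at t within {\<theta>..1})"
    if "(x has_vector_derivative x') (at ((k * t - 1) / l) within {0..1})" for x :: "real \<Rightarrow> 'e" and x' t
    using vector_diff_chain_within[OF aff2 has_vector_derivative_within_subset[OF that sub2]] by (simp add: o_def)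
  have e1: "((\<lambda>t. c *\<^sub>R x t) has_vector_derivative c *\<^sub>R x') (at t within S)"
    if "(x has_vector_derivative x') (at t within S)" for x :: "real \<Rightarrow> 'e" and x' t S c
    using has_vector_derivative_scaleR[OF DERIV_const[of c] that] by simp
  have joint: "(k * \<theta> - 1) / l = 0" using k by simp
  have dz: "(z has_vector_derivative u t) (at t within {0..1})" if t: "t \<in> {0..1}" for t
    unfolding z_def u_def
  proof (rule has_vector_derivative_glue[OF _ _ t])
    show "((\<lambda>t. gpath a m (k * t)) has_vector_derivative k *\<^sub>R vel a m (k * s)) (at s within {0..\<theta>})"
      if "s \<in> {0..\<theta>}" for s by (rule d1[OF is_solD(3)[OF P(1) m1[OF that]]])
    show "((\<lambda>t. gpath m b ((k * t - 1) / l)) has_vector_derivative (k / l) *\<^sub>R vel m b ((k * s - 1) / l)) (at s within {\<theta>..1})"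
      if "s \<in> {\<theta>..1}" for s by (rule d2[OF is_solD(3)[OF P'(1) m2[OF that]]])
  qed (use k l joint v P P' in auto)
  have du: "(u has_vector_derivative u' t) (at t within {0..1})" if t: "t \<in> {0..1}" for t
    unfolding u_def u'_def
  proof (rule has_vector_derivative_glue[OF _ _ t])
    show "((\<lambda>t. k *\<^sub>R vel a m (k * t)) has_vector_derivative k *\<^sub>R k *\<^sub>R Q (gpath a m (k * s)) (vel a m (k * s))) (at s within {0..\<theta>})"
      if "s \<in> {0..\<theta>}" for s by (rule e1[OF d1[OF is_solD(4)[OF P(1) m1[OF that]]]])
    show "((\<lambda>t. (k / l) *\<^sub>R vel m b ((k * t - 1) / l)) has_vector_derivative
        (k / l) *\<^sub>R (k / l) *\<^sub>R Q (gpath m b ((k * s - 1) / l)) (vel m b ((k * s - 1) / l))) (at s within {\<theta>..1})"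
      if "s \<in> {\<theta>..1}" for s by (rule e1[OF d2[OF is_solD(4)[OF P'(1) m2[OF that]]]])
  qed (use k l joint v P P' Q_scale[OF N1_B[OF N(2)]] in \<open>auto simp: power2_eq_square\<close>)
  have sm: "norm (m - a) < \<epsilon> / 10" "norm (b - m) < \<epsilon> / 10" using dist_N2 a b m by auto
  have vm: "norm (m - a) \<le> 2 * norm (vel a m 1)"
    using vel0_lower[OF N(2,1)] path_rev[OF N(1,2), of 0] by (simp add: norm_minus_commute)
  have nv: "norm (vel m b 0) = l * norm (vel a m 1)" using v l by simp
  \<comment> \<open>This and the next estimate show that \<open>l\<close> is comparable to the
    quotient of \<open>norm (b - m)\<close> and \<open>norm (m - a)\<close>, so that neither piece
    becomes too fast after the time change.\<close>
  have lm: "l * norm (m - a) \<le> 4 * norm (b - m)"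
  proof -
    have "l * norm (m - a) \<le> l * (2 * norm (vel a m 1))" using vm l by (intro mult_left_mono) auto
    also have "\<dots> = 2 * norm (vel m b 0)" using nv by simp
    also have "\<dots> \<le> 4 * norm (b - m)" using vel_upper[OF N(2,3), of 0] by simp
    finally show ?thesis .
  qed
  have bm: "norm (b - m) \<le> 4 * (l * norm (m - a))"
  proof -
    have "norm (b - m) \<le> 2 * (l * norm (vel a m 1))" using vel0_lower[OF N(2,3)] nv by simp
    also have "\<dots> \<le> 2 * (l * (2 * norm (m - a)))"
      using vel_upper[OF N(1,2), of 1] l by (intro mult_left_mono) auto
    finally show ?thesis by simp
  qed
  have sol: "is_sol z u"
    unfolding is_sol_def
  proof (intro ballI conjI)
    fix t :: real assume t: "t \<in> {0..1}"
    show "(z has_vector_derivative u t) (at t within {0..1})" by (rule dz[OF t])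
    show zB: "z t \<in> ball x0 R"
      using t m1[of t] m2[of t] is_solD(1)[OF P(1), of "k * t"] is_solD(1)[OF P'(1), of "(k * t - 1) / l"]
      by (auto simp: z_def)
    have "u' t = Q (z t) (u t)"
      using t m1[of t] m2[of t] is_solD(1)[OF P(1), of "k * t"] is_solD(1)[OF P'(1), of "(k * t - 1) / l"]
      by (auto simp: z_def u_def u'_def Q_scale power2_eq_square)
    then show "(u has_vector_derivative Q (z t) (u t)) (at t within {0..1})" using du[OF t] by simp
    \<comment> \<open>In both cases the bound is \<open>2 + 8\<close> times the diameter
      \<open>\<epsilon> / 10\<close> of \<open>N2\<close>: the second summand is an estimate
      \<open>2 * 4\<close> from the comparison of the pieces. Hence the radius
      \<open>\<epsilon> / 20\<close> of \<open>N2\<close>.\<close>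
    show "norm (u t) \<le> \<epsilon>"
    proof (cases "t \<le> \<theta>")
      case True
      then have "norm (u t) = k * norm (vel a m (k * t))" using k by (simp add: u_def)
      also have "\<dots> \<le> k * (2 * norm (m - a))"
        using k True t m1 by (intro mult_left_mono vel_upper N) auto
      also have "\<dots> = 2 * norm (m - a) + 2 * (l * norm (m - a))" by (simp add: k_def algebra_simps)
      finally show ?thesis using lm sm by simp
    next
      case False
      then have "norm (u t) = (k / l) * norm (vel m b ((k * t - 1) / l))" using k l by (simp add: u_def)
      also have "\<dots> \<le> (k / l) * (2 * norm (b - m))"
        using k l False t m2 by (intro mult_left_mono vel_upper N) auto
      also have "\<dots> = 2 * norm (b - m) + 2 * (norm (b - m) / l)" using l by (simp add: k_def field_simps)
      also have "norm (b - m) / l \<le> 4 * norm (m - a)" using bm l by (simp add: field_simps)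
      finally show ?thesis using sm by simp
    qed
  qed
  have z01: "z 0 = a" "z 1 = b" using k l P P' by (auto simp: z_def k_def)
  have "gpath a b \<theta> = z \<theta>" using path_unique[OF N(1,3) sol z01, of \<theta>] k by auto
  then show "gpath a b (1 / (1 + l)) = m" using k P by (simp add: z_def \<theta>_def k_def)
  have "vel a b 0 = u 0" using path_unique[OF N(1,3) sol z01, of 0] by auto
  then have "En a b = k\<^sup>2 * En a m"
    using k by (simp add: En_def u_def G_simps[OF N1_B[OF N(1)]] power2_eq_square)
  then have 1: "\<rho> a b = k * \<rho> a m" using k by (simp add: \<rho>_def real_sqrt_mult)
  have "En m b = l\<^sup>2 * En a m"
    using En_speed[OF N(1,2), of 1] P(3) by (simp add: En_def[of m] v G_simps[OF N1_B[OF N(2)]] power2_eq_square)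
  then show 2: "\<rho> m b = l * \<rho> a m" using l by (simp add: \<rho>_def real_sqrt_mult)
  show "\<rho> a b = \<rho> a m + \<rho> m b" using 1 2 by (simp add: k_def algebra_simps)
qed

text \<open>At an interior point \<open>m\<close> of a shortest path, \<open>\<lambda>y. \<rho> a y + \<rho> y b\<close> is minimal, so that the
  first variation formula excludes a corner at \<open>m\<close>.\<close>

lemma aligned:
  assumes a: "a \<in> N2" and m: "m \<in> N2" and b: "b \<in> N2" and ne: "a \<noteq> m" "m \<noteq> b"
    and eq: "\<rho> a b = \<rho> a m + \<rho> m b"
  shows "vel m b 0 = (\<rho> m b / \<rho> a m) *\<^sub>R vel a m 1"
proof -
  note N = a[THEN N2_N1] m[THEN N2_N1] b[THEN N2_N1]
  have pos: "0 < \<rho> a m" "0 < \<rho> m b" using rho_pos N ne by auto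
  have sym: "\<rho> b m = \<rho> m b" by (rule rho_sym[OF N(2,3)])
  have "((\<lambda>y. \<rho> a y + \<rho> b y) has_derivative (\<lambda>h. G m (vel a m 1) h / \<rho> a m + G m (vel b m 1) h / \<rho> b m)) (at m)"
    using rho_has_derivative[OF N(1,2)] rho_has_derivative[OF N(3,2)] ne
    by (intro has_derivative_add) auto
  moreover have "\<forall>y\<in>N2. \<rho> a m + \<rho> b m \<le> \<rho> a y + \<rho> b y"
  proof
    fix y assume y: "y \<in> N2"
    have "\<rho> a b \<le> \<rho> a y + \<rho> y b" by (rule rho_triangle[OF a y b])
    then show "\<rho> a m + \<rho> b m \<le> \<rho> a y + \<rho> b y"
      using eq sym rho_sym[OF N2_N1[OF y] N(3)] by simp
  qed
  ultimately have "(\<lambda>h. G m (vel a m 1) h / \<rho> a m + G m (vel b m 1) h / \<rho> b m) = (\<lambda>h. 0)"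
    using differential_zero_maxmin[OF m open_N2] by blast
  then have 0: "G m (vel a m 1) h / \<rho> a m + G m (vel b m 1) h / \<rho> m b = 0" for h
    using sym by (simp add: fun_eq_iff)
  have "vel b m 1 = - vel m b 0" using path_rev(2)[OF N(2,3), of 1] by simp
  then have "G m (vel m b 0) h = (\<rho> m b / \<rho> a m) * G m (vel a m 1) h" for h
    using 0[of h] pos by (simp add: G_simps[OF N1_B[OF N(2)]] field_simps)
  then show ?thesis
    by (intro G_cancel[OF N1_B[OF N(2)]]) (simp add: G_simps[OF N1_B[OF N(2)]])
qed

text \<open>Equality in the triangle inequality rules out a corner at \<open>m\<close>, so
  \<open>glue\<close> applies with \<open>l\<close> equal to \<open>\<rho> m b / \<rho> a m\<close>,
  and the meeting time \<open>1 / (1 + l)\<close> is the stated quotient. The degenerate positions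
  of \<open>m\<close> are treated separately.\<close>

lemma between_on_path:
  assumes a: "a \<in> N2" and m: "m \<in> N2" and b: "b \<in> N2" and ab: "a \<noteq> b"
    and eq: "\<rho> a b = \<rho> a m + \<rho> m b"
  shows "m = gpath a b (\<rho> a m / \<rho> a b)"
proof -
  note N = a[THEN N2_N1] m[THEN N2_N1] b[THEN N2_N1]
  have pos: "0 < \<rho> a b" using rho_pos N ab by auto
  consider "m = a" | "m = b" | "a \<noteq> m" "m \<noteq> b" by blast
  then show ?thesis
  proof cases
    case 1
    then show ?thesis using path_sol[OF N(1,3)] rho_eq0[OF N(1,1)] by simp
  next
    case 2
    then show ?thesis using path_sol[OF N(1,3)] pos by simp
  next
    case 3
    have p: "0 < \<rho> a m" "0 < \<rho> m b" using rho_pos N 3 by auto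
    then have "gpath a b (1 / (1 + \<rho> m b / \<rho> a m)) = m"
      by (intro glue(1)[OF a m b _ aligned[OF a m b 3 eq]]) simp
    moreover have "1 / (1 + \<rho> m b / \<rho> a m) = \<rho> a m / \<rho> a b" using p eq by (simp add: field_simps)
    ultimately show ?thesis by simp
  qed
qed

text \<open>Geodesics do not branch: by \<open>aligned\<close> both continuations leave
  \<open>m\<close> with the same multiple of the velocity of arrival, and solutions are determined
  by their initial values.\<close>

lemma extension_unique:
  assumes a: "a \<in> N2" and m: "m \<in> N2" and b: "b \<in> N2" and b': "b' \<in> N2" and ne: "a \<noteq> m"
    and eq: "\<rho> a b = \<rho> a m + \<rho> m b" "\<rho> a b' = \<rho> a m + \<rho> m b'" and "\<rho> m b = \<rho> m b'"
  shows "b = b'"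
proof (cases "m = b \<or> m = b'")
  case True
  then show ?thesis using rho_eq0[OF N2_N1[OF m] N2_N1[OF b]] rho_eq0[OF N2_N1[OF m] N2_N1[OF b']] assms(8) by auto
next
  case False
  then have "vel m b 0 = vel m b' 0"
    using aligned[OF a m b ne _ eq(1)] aligned[OF a m b' ne _ eq(2)] assms(8) by auto
  then show ?thesis using vel_ivp[OF N2_N1[OF m] N2_N1[OF b] N2_N1[OF b']] by simp
qed

lemma rho_along_path:
  assumes a: "a \<in> N2" and b: "b \<in> N2" and s: "s \<in> {0..1}" "s' \<in> {0..1}"
  shows "\<rho> (gpath a b s) (gpath a b s') = \<bar>s' - s\<bar> * \<rho> a b"
proof -
  note N = a[THEN N2_N1] b[THEN N2_N1]
  note P = path_in_N1[OF a b s(1)] path_in_N1[OF a b s(2)]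
  have "vel (gpath a b s) (gpath a b s') 0 = (s' - s) *\<^sub>R vel a b s"
    using path_affine(2)[OF N s(1), of "s' - s" 0] s P by simp
  then have "En (gpath a b s) (gpath a b s') = (s' - s)\<^sup>2 * En a b"
    using En_speed[OF N s(1)] by (simp add: En_def[of "gpath a b s"] G_simps[OF N1_B[OF P(1)]] power2_eq_square)
  then show ?thesis by (simp add: \<rho>_def real_sqrt_mult)
qed

lemma continuous_on_vel0: "p \<in> N1 \<Longrightarrow> continuous_on N1 (\<lambda>b. vel p b 0)"
proof (rule lipschitz_on_continuous_on, rule lipschitz_onI)
  show "p \<in> N1 \<Longrightarrow> x \<in> N1 \<Longrightarrow> y \<in> N1 \<Longrightarrow> dist (vel p x 0) (vel p y 0) \<le> 2 * dist x y" for x y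
    using vel_lipschitz[of p y p x 0] by (simp add: dist_norm)
qed simp

text \<open>Here \<open>lg\<close> is the inverse of the exponential map at \<open>x0\<close>; by invariance of domain its image contains
  a ball, on which Brouwer's theorem is applied.\<close>

lemma extension_exists:
  obtains \<delta>0 where "0 < \<delta>0"
    "\<And>\<delta> z. 0 < \<delta> \<Longrightarrow> \<delta> \<le> \<delta>0 \<Longrightarrow> continuous_on {b\<in>N2. \<rho> x0 b \<le> \<delta>} z \<Longrightarrow>
      (\<And>b. b \<in> N2 \<Longrightarrow> \<rho> x0 b \<le> \<delta> \<Longrightarrow> z b \<in> N2 \<and> z b \<noteq> x0) \<Longrightarrow>
      \<exists>q\<in>N2. \<rho> x0 q = \<delta> \<and> \<rho> (z q) q = \<rho> (z q) x0 + \<delta>"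
proof -
  define lg where "lg = (\<lambda>b. vel x0 b 0)"
  have B: "x0 \<in> ball x0 R" using R_pos by simp
  have cont: "continuous_on N2 lg"
    unfolding lg_def by (rule continuous_on_subset[OF continuous_on_vel0[OF x0_N1]]) (use N2_N1 in blast)
  have inj: "inj_on lg N2" unfolding lg_def inj_on_def using vel_ivp[OF x0_N1] N2_N1 by blast
  have op: "open (lg ` N2)" by (rule invariance_of_domain[OF cont open_N2 inj])
  have "lg x0 = 0" by (simp add: lg_def path_refl)
  then have "0 \<in> lg ` N2" using imageI[OF x0_N2, of lg] by simp
  then obtain e where e: "0 < e" "ball 0 e \<subseteq> lg ` N2" using openE[OF op] by metis
  obtain ex where ex: "homeomorphism N2 (lg ` N2) lg ex"
    using invariance_of_domain_homeomorphism[OF open_N2 cont _ inj] by auto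
  \<comment> \<open>\<open>K * \<delta>0\<close> is \<open>e / 2\<close>, which places the set
    \<open>S\<close> below inside the ball of radius \<open>e\<close> contained in the image of
    \<open>lg\<close>.\<close>
  define \<delta>0 where "\<delta>0 = e / (2 * K)"
  have normG: "norm v \<le> K * sqrt (G x0 v v)" for v
  proof -
    have "(norm v)\<^sup>2 \<le> K * G x0 v v" by (rule G_lower[OF B])
    also have "\<dots> \<le> K\<^sup>2 * G x0 v v"
      using K_ge1 G_nonneg[OF B] by (intro mult_right_mono) (auto simp: power2_eq_square)
    also have "\<dots> = (K * sqrt (G x0 v v))\<^sup>2" using G_nonneg[OF B] by (simp add: power_mult_distrib)
    finally show ?thesis by (rule power2_le_imp_le) (use K_ge1 G_nonneg[OF B, of v] in simp)
  qed
  have rho_lg: "\<rho> x0 b = sqrt (G x0 (lg b) (lg b))" for b by (simp add: \<rho>_def En_def lg_def)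
  show ?thesis
  proof (rule that[of \<delta>0])
    show "0 < \<delta>0" using e K_ge1 by (simp add: \<delta>0_def)
    fix \<delta> :: real and z :: "'e \<Rightarrow> 'e"
    assume \<delta>: "0 < \<delta>" "\<delta> \<le> \<delta>0" and z: "continuous_on {b\<in>N2. \<rho> x0 b \<le> \<delta>} z"
      and zN: "\<And>b. b \<in> N2 \<Longrightarrow> \<rho> x0 b \<le> \<delta> \<Longrightarrow> z b \<in> N2 \<and> z b \<noteq> x0"
    \<comment> \<open>The ball of radius \<open>\<delta>\<close> for the inner product at the
      centre. In coordinates it is an ellipsoid; its compactness and convexity are what Brouwer's
      theorem requires.\<close>
    define S where "S = {v. G x0 v v \<le> \<delta>\<^sup>2}"
    have S_sqrt: "v \<in> S \<longleftrightarrow> sqrt (G x0 v v) \<le> \<delta>" for v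
      using real_sqrt_le_iff[of "G x0 v v" "\<delta>\<^sup>2"] \<delta> by (simp add: S_def)
    have Se: "S \<subseteq> ball 0 e"
    proof
      fix v assume "v \<in> S"
      then have "sqrt (G x0 v v) \<le> \<delta>" using S_sqrt by simp
      then have "norm v \<le> K * \<delta>" using order_trans[OF normG mult_left_mono] K_ge1 by auto
      also have "\<dots> \<le> K * \<delta>0" using \<delta> K_ge1 by simp
      also have "\<dots> < e" using e K_ge1 by (simp add: \<delta>0_def)
      finally show "v \<in> ball 0 e" by simp
    qed
    have contG: "continuous_on UNIV (\<lambda>v. G x0 v v)"
      by (rule bilinear_continuous_on_compose[OF continuous_on_id continuous_on_id G_bilinear[OF B]])
    have "compact S"
      unfolding compact_eq_bounded_closed
    proof
      show "bounded S" using Se bounded_ball bounded_subset by blast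
      show "closed S" unfolding S_def using contG by (intro closed_Collect_le) auto
    qed
    moreover have "convex S"
      unfolding convex_def
    proof (intro ballI allI impI)
      fix x y u v assume x: "x \<in> S" and y: "y \<in> S" and uv: "0 \<le> (u::real)" "0 \<le> v" "u + v = 1"
      have "2 * G x0 x y \<le> G x0 x x + G x0 y y"
        using G_nonneg[OF B, of "x - y"] by (simp add: G_simps[OF B] G_sym[OF B, of y x])
      then have "(u * v) * (2 * G x0 x y) \<le> (u * v) * (G x0 x x + G x0 y y)"
        using uv by (intro mult_left_mono) auto
      then have "G x0 (u *\<^sub>R x + v *\<^sub>R y) (u *\<^sub>R x + v *\<^sub>R y)
          \<le> u * (u + v) * G x0 x x + v * (u + v) * G x0 y y"
        by (simp add: G_simps[OF B] G_sym[OF B, of y x] algebra_simps)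
      also have "\<dots> \<le> u * \<delta>\<^sup>2 + v * \<delta>\<^sup>2"
        using uv x y by (auto simp: S_def intro!: add_mono mult_left_mono)
      also have "\<dots> = \<delta>\<^sup>2" using uv by (simp flip: distrib_right)
      finally show "u *\<^sub>R x + v *\<^sub>R y \<in> S" by (simp add: S_def)
    qed
    moreover have "S \<noteq> {}" using \<delta> by (auto simp: S_def G_simps[OF B] intro!: exI[of _ 0])
    moreover
    have exS: "ex v \<in> N2" "lg (ex v) = v" "\<rho> x0 (ex v) \<le> \<delta>" if "v \<in> S" for v
    proof -
      have v: "v \<in> lg ` N2" using that Se e by auto
      show "ex v \<in> N2" "lg (ex v) = v" using ex v by (auto simp: homeomorphism_def)
      then show "\<rho> x0 (ex v) \<le> \<delta>" using that S_sqrt by (simp add: rho_lg)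
    qed
    \<comment> \<open>The vector of length \<open>\<delta>\<close> opposite to the direction of
      \<open>z\<close>. All values lie on the boundary of \<open>S\<close>, so a fixed point has
      distance exactly \<open>\<delta>\<close> from the centre.\<close>
    define F where "F = (\<lambda>v. (- (\<delta> / \<rho> x0 (z (ex v)))) *\<^sub>R lg (z (ex v)))"
    have zpos: "0 < \<rho> x0 (z (ex v))" if "v \<in> S" for v
      using zN[OF exS(1,3)[OF that]] rho_pos[OF x0_N1 N2_N1] by auto
    have cz: "continuous_on S (\<lambda>v. lg (z (ex v)))"
    proof (rule continuous_on_compose2[OF cont])
      have "continuous_on S ex"
        by (rule continuous_on_subset[OF homeomorphism_cont2[OF ex]]) (use Se e in blast)
      then show "continuous_on S (\<lambda>v. z (ex v))"
        by (rule continuous_on_compose2[OF z]) (use exS in auto)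
      show "(\<lambda>v. z (ex v)) ` S \<subseteq> N2" using zN exS by auto
    qed
    have "continuous_on S F"
      unfolding F_def rho_lg
    proof (intro continuous_intros cz)
      show "continuous_on S (\<lambda>v. G x0 (lg (z (ex v))) (lg (z (ex v))))"
        by (rule continuous_on_compose2[OF contG cz]) auto
      show "\<forall>v\<in>S. sqrt (G x0 (lg (z (ex v))) (lg (z (ex v)))) \<noteq> 0"
        using zpos unfolding rho_lg by (metis less_irrefl)
    qed
    moreover
    have GF: "sqrt (G x0 (F v) (F v)) = \<delta>" if "v \<in> S" for v
    proof -
      have "G x0 (F v) (F v) = (\<delta> / \<rho> x0 (z (ex v)))\<^sup>2 * G x0 (lg (z (ex v))) (lg (z (ex v)))"
        by (simp add: F_def G_simps[OF B] power2_eq_square)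
      then have "sqrt (G x0 (F v) (F v)) = \<bar>\<delta> / \<rho> x0 (z (ex v))\<bar> * \<rho> x0 (z (ex v))"
        by (simp add: real_sqrt_mult rho_lg)
      then show ?thesis using zpos[OF that] \<delta> by simp
    qed
    then have "F \<in> S \<rightarrow> S" using S_sqrt by auto
    ultimately obtain v where v: "v \<in> S" "F v = v"
      using brouwer[of S F] by (metis image_subset_iff_funcset)
    define q where "q = ex v"
    define l where "l = \<delta> / \<rho> x0 (z q)"
    have q: "q \<in> N2" "lg q = v" "\<rho> x0 q \<le> \<delta>" using exS[OF v(1)] by (auto simp: q_def)
    have zq: "z q \<in> N2" "z q \<noteq> x0" using zN q by auto
    have pos: "0 < l" using \<delta> zpos[OF v(1)] by (simp add: l_def q_def)
    have rq: "\<rho> x0 q = \<delta>" using GF[OF v(1)] v(2) q(2) by (simp add: rho_lg)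
    \<comment> \<open>Opposite initial velocities at the centre become matching ones when the path
      to \<open>z q\<close> is reversed, which is the hypothesis of \<open>glue\<close>.\<close>
    have "vel x0 q 0 = - (l *\<^sub>R vel x0 (z q) 0)"
      using v(2) q(2) by (simp add: F_def lg_def l_def q_def)
    also have "\<dots> = l *\<^sub>R vel (z q) x0 1"
      using path_rev(2)[OF x0_N1 N2_N1[OF zq(1)], of 1] by simp
    finally have "vel x0 q 0 = l *\<^sub>R vel (z q) x0 1" .
    from glue(2)[OF zq(1) x0_N2 q(1) pos this]
    show "\<exists>q\<in>N2. \<rho> x0 q = \<delta> \<and> \<rho> (z q) q = \<rho> (z q) x0 + \<delta>"
      using q rq by auto
  qed
qed

end

section \<open>Riemannian metrics in charts\<close>

lemma smooth_on_continuous: "smooth_on S f \<Longrightarrow> continuous_on S f"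
  unfolding smooth_on_def by (metis Ck_on.simps(1))

lemma smooth_on_differentiable: "smooth_on S f \<Longrightarrow> x \<in> S \<Longrightarrow> f differentiable (at x)"
  unfolding smooth_on_def by (metis Ck_on.simps(2))

lemma smooth_on_has_derivative:
  "smooth_on S f \<Longrightarrow> x \<in> S \<Longrightarrow> (f has_derivative frechet_derivative f (at x)) (at x)"
  using smooth_on_differentiable frechet_derivative_works by blast

lemma smooth_on_partial:
  "smooth_on S f \<Longrightarrow> i \<in> Basis \<Longrightarrow> smooth_on S (\<lambda>x. frechet_derivative f (at x) i)"
  unfolding smooth_on_def by (metis Ck_on.simps(2))

lemma linear_basis_sum:
  fixes f :: "'e::euclidean_space \<Rightarrow> 'f::real_vector"
  assumes "linear f"
  shows "f u = (\<Sum>i\<in>Basis. (u \<bullet> i) *\<^sub>R f i)"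
proof -
  have "f u = f (\<Sum>i\<in>Basis. (u \<bullet> i) *\<^sub>R i)" by (simp add: euclidean_representation)
  then show ?thesis by (simp add: linear_sum[OF assms] linear_scale[OF assms])
qed

lemma frechet_basis_sum:
  assumes "smooth_on S f" "x \<in> S"
  shows "frechet_derivative f (at x) u = (\<Sum>i\<in>Basis. (u \<bullet> i) *\<^sub>R frechet_derivative f (at x) i)"
  using linear_basis_sum has_derivative_linear[OF smooth_on_has_derivative[OF assms]] by blast

text \<open>\<open>smooth_on\<close> speaks of derivatives in the basis directions only; a varying
  direction is expanded in the basis.\<close>

lemma continuous_on_frechet:
  assumes f: "smooth_on S f" and x: "continuous_on T x" "x ` T \<subseteq> S" and u: "continuous_on T u"
  shows "continuous_on T (\<lambda>t. frechet_derivative f (at (x t)) (u t))"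
proof -
  have "continuous_on T (\<lambda>t. \<Sum>i\<in>Basis. (u t \<bullet> i) *\<^sub>R frechet_derivative f (at (x t)) i)"
    by (intro continuous_intros u
        continuous_on_compose2[OF smooth_on_continuous[OF smooth_on_partial[OF f]] x])
  then show ?thesis
    by (rule continuous_on_cong[THEN iffD1, rotated -1])
      (use frechet_basis_sum[OF f] x in auto)
qed

lemma smooth_on_bounded:
  fixes f :: "'e::euclidean_space \<Rightarrow> real"
  assumes "smooth_on S f" "cball a r \<subseteq> S"
  shows "\<exists>B. \<forall>x\<in>cball a r. \<bar>f x\<bar> \<le> B"
proof -
  have "bounded (f ` cball a r)"
    using assms compact_cball
    by (intro compact_imp_bounded compact_continuous_image)
      (auto intro: continuous_on_subset smooth_on_continuous)
  then show ?thesis by (auto simp: bounded_iff)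
qed

lemma smooth_on_lipschitz:
  fixes f :: "'e::euclidean_space \<Rightarrow> real"
  assumes f: "smooth_on S f" and S: "cball a r \<subseteq> S"
  shows "\<exists>B. \<forall>x\<in>cball a r. \<forall>y\<in>cball a r. \<bar>f x - f y\<bar> \<le> B * norm (x - y)"
proof -
  obtain b where b: "\<And>i x. i \<in> Basis \<Longrightarrow> x \<in> cball a r \<Longrightarrow> \<bar>frechet_derivative f (at x) i\<bar> \<le> b i"
    using smooth_on_bounded[OF smooth_on_partial[OF f] S] by metis
  define B where "B = (\<Sum>i\<in>(Basis::'e set). b i)"
  have "norm (f x - f y) \<le> B * norm (x - y)" if xy: "x \<in> cball a r" "y \<in> cball a r" for x y
  proof (rule differentiable_bound[of "cball a r" f "\<lambda>x. frechet_derivative f (at x)"])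
    fix z assume z: "z \<in> cball a r"
    then have zS: "z \<in> S" using S by auto
    show "(f has_derivative frechet_derivative f (at z)) (at z within cball a r)"
      using smooth_on_has_derivative[OF f zS] has_derivative_at_withinI by blast
    show "onorm (frechet_derivative f (at z)) \<le> B"
    proof (rule onorm_le)
      fix h
      have "norm (frechet_derivative f (at z) h) \<le> (\<Sum>i\<in>Basis. norm ((h \<bullet> i) *\<^sub>R frechet_derivative f (at z) i))"
        unfolding frechet_basis_sum[OF f zS, of h] by (rule norm_sum)
      also have "\<dots> \<le> (\<Sum>i\<in>Basis. norm h * b i)"
      proof (rule sum_mono)
        fix i :: 'e assume i: "i \<in> Basis"
        show "norm ((h \<bullet> i) *\<^sub>R frechet_derivative f (at z) i) \<le> norm h * b i"
          using b[OF i z] Basis_le_norm[OF i, of h] by (simp add: abs_mult mult_mono)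
      qed
      finally show "norm (frechet_derivative f (at z) h) \<le> B * norm h"
        by (simp add: B_def sum_distrib_left mult.commute)
    qed
  qed (use xy in auto)
  then show ?thesis unfolding real_norm_def by blast
qed

lemma sum_mult_bound:
  fixes a :: "'e::euclidean_space \<Rightarrow> real"
  assumes "\<And>i. i \<in> Basis \<Longrightarrow> \<bar>a i\<bar> \<le> B"
  shows "\<bar>\<Sum>i\<in>Basis. (u \<bullet> i) * a i\<bar> \<le> real (DIM('e)) * B * norm u"
proof -
  have "\<bar>\<Sum>i\<in>Basis. (u \<bullet> i) * a i\<bar> \<le> (\<Sum>i\<in>Basis. \<bar>(u \<bullet> i) * a i\<bar>)" by (rule sum_abs)
  also have "\<dots> \<le> (\<Sum>i\<in>(Basis::'e set). norm u * B)"
    using assms Basis_le_norm[of _ u] by (intro sum_mono) (auto simp: abs_mult intro!: mult_mono)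
  finally show ?thesis by (simp add: mult_ac)
qed

lemma bilinear_bound:
  fixes B :: "'e::euclidean_space \<Rightarrow> 'e \<Rightarrow> real"
  assumes B: "bilinear B" and M: "\<And>i j. i \<in> Basis \<Longrightarrow> j \<in> Basis \<Longrightarrow> \<bar>B i j\<bar> \<le> M"
  shows "\<bar>B u v\<bar> \<le> (real (DIM('e)))\<^sup>2 * M * norm u * norm v"
proof -
  have lin: "linear (\<lambda>u. B u v)" "linear (B w)" for v w using B by (auto simp: bilinear_def)
  have 1: "\<bar>B i v\<bar> \<le> real (DIM('e)) * M * norm v" if "i \<in> Basis" for i
    using sum_mult_bound[of "B i" M v] M[OF that] linear_basis_sum[OF lin(2), of i v] by simp
  show ?thesis
    using sum_mult_bound[of "\<lambda>i. B i v", OF 1] linear_basis_sum[OF lin(1), of u v]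
    by (simp add: power2_eq_square mult_ac)
qed

text \<open>The linear map \<open>T\<close> represents \<open>B\<close> in the basis. Definiteness
  makes it injective, hence surjective in finite dimension. The lemma guarantees that the definite
  description in \<open>christoffel\<close> denotes.\<close>

lemma riesz_bilinear:
  fixes B :: "'e::euclidean_space \<Rightarrow> 'e \<Rightarrow> real"
  assumes B: "bilinear B" and pos: "\<And>u. u \<noteq> 0 \<Longrightarrow> B u u > 0" and \<phi>: "linear \<phi>"
  shows "\<exists>!z. \<forall>w. B z w = \<phi> w"
proof -
  have lin: "linear (\<lambda>u. B u v)" "linear (B w)" for v w using B by (auto simp: bilinear_def)
  define T where "T = (\<lambda>z. \<Sum>i\<in>Basis. B z i *\<^sub>R i)"
  have Ti: "T z \<bullet> i = B z i" if "i \<in> Basis" for z i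
    using that by (simp add: T_def inner_sum_left inner_Basis if_distrib cong: if_cong)
  have T: "linear T"
    unfolding T_def
    by (intro linear_compose_sum ballI linear_compose[OF lin(1), unfolded o_def, of "\<lambda>r. r *\<^sub>R _"])
      (simp add: linear_iff scaleR_add_left)
  have uniq: "z = 0" if "\<And>i. i \<in> Basis \<Longrightarrow> B z i = 0" for z
  proof (rule ccontr)
    assume "z \<noteq> 0"
    moreover have "B z z = 0" using linear_basis_sum[OF lin(2), of z z] that by simp
    ultimately show False using pos[of z] by simp
  qed
  have "inj T"
    unfolding linear_injective_0[OF T]
  proof (intro allI impI)
    fix z assume "T z = 0"
    then have "B z i = 0" if "i \<in> Basis" for i using Ti[OF that, of z] by simp
    then show "z = 0" using uniq by blast
  qed
  then have "surj T" using linear_injective_imp_surjective[OF T] by blast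
  then obtain z where z: "T z = (\<Sum>i\<in>Basis. \<phi> i *\<^sub>R i)" by (metis surjD)
  have zi: "B z i = \<phi> i" if "i \<in> Basis" for i
    using Ti[OF that, of z] that unfolding z by (simp add: inner_sum_left inner_Basis if_distrib cong: if_cong)
  have "B z w = \<phi> w" for w
    using linear_basis_sum[OF lin(2), of z w] linear_basis_sum[OF \<phi>, of w] zi by simp
  moreover have "y = z" if "\<forall>w. B y w = \<phi> w" for y
  proof -
    have "B (y - z) i = 0" if "i \<in> Basis" for i
      using \<open>\<forall>w. B y w = \<phi> w\<close> zi[OF that] by (simp add: bilinear_lsub[OF B])
    then show ?thesis using uniq[of "y - z"] by simp
  qed
  ultimately show ?thesis by blast
qed

section \<open>From an atlas with a metric tensor to a coordinate domain of the preceding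
  kind\<close>

locale riemannian =
  fixes A :: "('a::{t2_space,second_countable_topology}, 'e::euclidean_space) chart set"
    and g :: "('a, 'e) metric_tensor"
  assumes manifold: "riemannian_manifold A g"
begin

lemma chart:
  assumes "c \<in> A"
  shows "open (fst c)" "open (snd c ` fst c)"
    and "homeomorphism (fst c) (snd c ` fst c) (snd c) (chart_inv c)"
  using assms manifold by (auto simp: riemannian_manifold_def smooth_atlas_def)

lemma chart_cover: "\<exists>c\<in>A. p \<in> fst c"
  using manifold by (auto simp: riemannian_manifold_def smooth_atlas_def)

lemma chart_inv_left: "c \<in> A \<Longrightarrow> p \<in> fst c \<Longrightarrow> chart_inv c (snd c p) = p"
  using chart(3) unfolding homeomorphism_def by blast

lemma chart_inv_right: "c \<in> A \<Longrightarrow> x \<in> snd c ` fst c \<Longrightarrow> snd c (chart_inv c x) = x"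
  using chart(3) unfolding homeomorphism_def by blast

lemma chart_inv_in: "c \<in> A \<Longrightarrow> x \<in> snd c ` fst c \<Longrightarrow> chart_inv c x \<in> fst c"
  using chart(3) unfolding homeomorphism_def by blast

lemma transition_smooth: "c \<in> A \<Longrightarrow> d \<in> A \<Longrightarrow> smooth_on (snd c ` (fst c \<inter> fst d)) (transition c d)"
  using manifold by (auto simp: riemannian_manifold_def smooth_atlas_def)

lemma metric:
  assumes "c \<in> A" "x \<in> snd c ` fst c"
  shows "bilinear (g c x)" "g c x u v = g c x v u" "u \<noteq> 0 \<Longrightarrow> g c x u u > 0"
  using assms manifold unfolding riemannian_manifold_def riemannian_metric_def by blast+

lemma metric_nonneg: "c \<in> A \<Longrightarrow> x \<in> snd c ` fst c \<Longrightarrow> 0 \<le> g c x u u"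
  using metric(3)[of c x u] bilinear_lzero[OF metric(1)[of c x]] by (cases "u = 0") auto

lemma metric_smooth: "c \<in> A \<Longrightarrow> smooth_on (snd c ` fst c) (\<lambda>x. g c x u v)"
  using manifold unfolding riemannian_manifold_def riemannian_metric_def by blast

lemma metric_transform:
  assumes "c \<in> A" "d \<in> A" "p \<in> fst c" "p \<in> fst d"
  shows "g c (snd c p) u v =
        g d (snd d p) (frechet_derivative (transition c d) (at (snd c p)) u)
                      (frechet_derivative (transition c d) (at (snd c p)) v)"
  using assms manifold unfolding riemannian_manifold_def riemannian_metric_def by blast

definition dmetric :: "('a, 'e) chart \<Rightarrow> 'e \<Rightarrow> 'e \<Rightarrow> 'e \<Rightarrow> 'e \<Rightarrow> real" where
  "dmetric c x h u v = frechet_derivative (\<lambda>y. g c y u v) (at x) h"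

text \<open>The sign is chosen so that the geodesic equation reads \<open>x'' = acc c x x'\<close>;
  this is the instance of \<open>Q\<close> in the chart, as \<open>dmetric\<close> is that of
  \<open>D\<close>.\<close>

definition acc :: "('a, 'e) chart \<Rightarrow> 'e \<Rightarrow> 'e \<Rightarrow> 'e" where
  "acc c x v = - christoffel g c x v v"

lemma metric_has_derivative:
  "c \<in> A \<Longrightarrow> x \<in> snd c ` fst c \<Longrightarrow> ((\<lambda>y. g c y u v) has_derivative (\<lambda>h. dmetric c x h u v)) (at x)"
  unfolding dmetric_def using smooth_on_has_derivative[OF metric_smooth] by blast

text \<open>The algebraic laws of \<open>g c y\<close> hold only for \<open>y\<close> in the image
  of the chart. As this image is open, agreement there determines the derivative.\<close>

lemma dmetric_eqI:
  assumes c: "c \<in> A" and x: "x \<in> snd c ` fst c" and f: "(f has_derivative f') (at x)"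
    and eq: "\<And>y. y \<in> snd c ` fst c \<Longrightarrow> f y = g c y u v"
  shows "dmetric c x h u v = f' h"
proof -
  have "((\<lambda>y. g c y u v) has_derivative f') (at x)"
    using has_derivative_transform_within_open[OF f chart(2)[OF c] x eq] .
  then show ?thesis using metric_has_derivative[OF c x] has_derivative_unique by metis
qed

lemma dmetric_bilinear:
  assumes c: "c \<in> A" and x: "x \<in> snd c ` fst c"
  shows "bilinear (dmetric c x h)"
  unfolding bilinear_def linear_iff
proof (intro conjI allI)
  note d = metric_has_derivative[OF c x]
  note B = metric(1)[OF c]
  fix u v w r
  show "dmetric c x h u (v + w) = dmetric c x h u v + dmetric c x h u w"
    by (rule dmetric_eqI[OF c x has_derivative_add[OF d d], where h = h]) (simp add: bilinear_radd[OF B])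
  show "dmetric c x h (v + w) u = dmetric c x h v u + dmetric c x h w u"
    by (rule dmetric_eqI[OF c x has_derivative_add[OF d d], where h = h]) (simp add: bilinear_ladd[OF B])
  show "dmetric c x h u (r *\<^sub>R v) = r *\<^sub>R dmetric c x h u v"
    by (rule dmetric_eqI[OF c x has_derivative_scaleR_right[OF d], where h = h]) (simp add: bilinear_rmul[OF B])
  show "dmetric c x h (r *\<^sub>R v) u = r *\<^sub>R dmetric c x h v u"
    by (rule dmetric_eqI[OF c x has_derivative_scaleR_right[OF d], where h = h]) (simp add: bilinear_lmul[OF B])
qed

lemma dmetric_linear: "c \<in> A \<Longrightarrow> x \<in> snd c ` fst c \<Longrightarrow> linear (\<lambda>h. dmetric c x h u v)"
  using metric_has_derivative has_derivative_linear by blast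

text \<open>On the diagonal the first two terms of the Christoffel symbol of the first kind
  coincide, which removes the factor \<open>1/2\<close> from them; \<open>riesz_bilinear\<close>
  justifies the definite description.\<close>

lemma acc_eq:
  assumes c: "c \<in> A" and x: "x \<in> snd c ` fst c"
  shows "g c x (acc c x v) w = dmetric c x w v v / 2 - dmetric c x v v w"
proof -
  define \<phi> where "\<phi> = (\<lambda>w. dmetric c x v v w - dmetric c x w v v / 2)"
  have eq: "christoffel_first g c x v v = \<phi>"
    by (simp add: christoffel_first_def \<phi>_def dmetric_def fun_eq_iff field_simps)
  have "linear \<phi>"
    using dmetric_bilinear[OF c x, of v] dmetric_linear[OF c x, of v v]
    by (auto simp: \<phi>_def bilinear_def linear_iff field_simps)
  then have "\<exists>!z. \<forall>w. g c x z w = \<phi> w"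
    using riesz_bilinear[OF metric(1)[OF c x] metric(3)[OF c x]] by blast
  then have "\<forall>w. g c x (christoffel g c x v v) w = \<phi> w"
    unfolding christoffel_def eq by (rule theI')
  then show ?thesis
    by (simp add: acc_def \<phi>_def bilinear_lneg[OF metric(1)[OF c x]])
qed

lemma continuous_on_metric:
  assumes c: "c \<in> A" and x: "continuous_on T x" "x ` T \<subseteq> snd c ` fst c"
    and u: "continuous_on T u" and v: "continuous_on T v"
  shows "continuous_on T (\<lambda>t. g c (x t) (u t) (v t))"
proof -
  have eq: "g c (x t) (u t) (v t) = (\<Sum>i\<in>Basis. (u t \<bullet> i) *\<^sub>R (\<Sum>j\<in>Basis. (v t \<bullet> j) *\<^sub>R g c (x t) i j))"
    if "t \<in> T" for t
  proof -
    have B: "bilinear (g c (x t))" using metric(1)[OF c] x that by blast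
    have lin: "linear (\<lambda>u. g c (x t) u v)" "linear (g c (x t) w)" for v w using B by (auto simp: bilinear_def)
    show ?thesis
      using linear_basis_sum[OF lin(1)[of "v t"], of "u t"] linear_basis_sum[OF lin(2), of _ "v t"] by simp
  qed
  have "continuous_on T (\<lambda>t. \<Sum>i\<in>Basis. (u t \<bullet> i) *\<^sub>R (\<Sum>j\<in>Basis. (v t \<bullet> j) *\<^sub>R g c (x t) i j))"
    by (intro continuous_intros u v continuous_on_compose2[OF smooth_on_continuous[OF metric_smooth[OF c]] x])
  then show ?thesis
    by (rule continuous_on_cong[THEN iffD1, rotated -1]) (use eq in auto)
qed

text \<open>All constants are extrema over a compact coordinate ball. Bounds on matrix entries
  become bounds on forms at the cost of one factor \<open>n\<close> per argument, that is
  \<open>n^2\<close> for the metric and \<open>n^3\<close> for its derivative; \<open>K\<close>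
  dominates all of them at once.\<close>

lemma geodesic_domain_exists:
  assumes c: "c \<in> A" and p: "p \<in> fst c"
  obtains R K where "geodesic_domain (snd c p) R K (g c) (dmetric c) (acc c)" "ball (snd c p) R \<subseteq> snd c ` fst c"
proof -
  define x0 where "x0 = snd c p"
  define V where "V = snd c ` fst c"
  have "x0 \<in> V" using p by (auto simp: V_def x0_def)
  then obtain R where R: "0 < R" "cball x0 R \<subseteq> V"
    using chart(2)[OF c] open_contains_cball[of V] by (auto simp: V_def)
  have V: "x \<in> V" if "x \<in> ball x0 R" for x using that R by auto
  define n where "n = real (DIM('e))"
  have n1: "1 \<le> n" by (simp add: n_def DIM_positive Suc_leI)
  \<comment> \<open>The ellipticity constant is the inverse of the minimum of the quadratic form
    over the compact product of the ball and the unit sphere.\<close>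
  obtain k1 where k1: "\<And>x u. x \<in> cball x0 R \<Longrightarrow> (norm u)\<^sup>2 \<le> k1 * g c x u u" and k1pos: "0 < k1"
  proof -
    define S where "S = cball x0 R \<times> sphere (0::'e) 1"
    have "continuous_on S (\<lambda>z. g c (fst z) (snd z) (snd z))"
      using R by (intro continuous_on_metric[OF c] continuous_intros) (auto simp: S_def V_def)
    moreover have "compact S" unfolding S_def by (intro compact_Times compact_cball compact_sphere)
    moreover have "S \<noteq> {}" using R by (auto simp: S_def)
    ultimately obtain z where z: "z \<in> S" "\<And>y. y \<in> S \<Longrightarrow> g c (fst z) (snd z) (snd z) \<le> g c (fst y) (snd y) (snd y)"
      using continuous_attains_inf[of S "\<lambda>z. g c (fst z) (snd z) (snd z)"] by auto
    define m where "m = g c (fst z) (snd z) (snd z)"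
    have "snd z \<noteq> 0" "fst z \<in> V" using z(1) R by (auto simp: S_def)
    then have m: "0 < m" unfolding m_def V_def using metric(3)[OF c] by blast
    have "(norm u)\<^sup>2 \<le> (1 / m) * g c x u u" if x: "x \<in> cball x0 R" for x u
    proof (cases "u = 0")
      case True
      then show ?thesis using metric_nonneg[OF c, of x u] x R m by (auto simp: V_def)
    next
      case False
      have B: "bilinear (g c x)" using metric(1)[OF c] x R V_def by blast
      define w where "w = u /\<^sub>R norm u"
      have "m \<le> g c x w w"
        using z(2)[of "(x, w)"] x False by (simp add: S_def m_def w_def)
      moreover have "u = norm u *\<^sub>R w" using False by (simp add: w_def)
      then have "g c x u u = norm u * (norm u * g c x w w)"
        using bilinear_lmul[OF B] bilinear_rmul[OF B] by (metis real_scaleR_def)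
      ultimately have "g c x u u \<ge> norm u * (norm u * m)" by (simp add: mult_left_mono)
      then show ?thesis using m by (simp add: field_simps power2_eq_square)
    qed
    then show ?thesis using that[of "1 / m"] m by auto
  qed
  have "\<exists>b. \<forall>i\<in>Basis. \<forall>j\<in>Basis. \<forall>x\<in>cball x0 R. \<bar>g c x i j\<bar> \<le> b i j"
    using smooth_on_bounded[OF metric_smooth[OF c]] R(2) V_def by metis
  then obtain b2 where b2: "\<And>i j x. i \<in> Basis \<Longrightarrow> j \<in> Basis \<Longrightarrow> x \<in> cball x0 R \<Longrightarrow> \<bar>g c x i j\<bar> \<le> b2 i j"
    by blast
  have sm: "smooth_on V (\<lambda>x. dmetric c x k i j)" if "k \<in> Basis" for k i j
    unfolding dmetric_def V_def by (rule smooth_on_partial[OF metric_smooth[OF c] that])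
  have "\<exists>b. \<forall>k\<in>Basis. \<forall>i\<in>Basis. \<forall>j\<in>Basis. \<forall>x\<in>cball x0 R. \<bar>dmetric c x k i j\<bar> \<le> b k i j"
    using smooth_on_bounded[OF sm R(2)] by metis
  then obtain b3 where b3: "\<And>k i j x. k \<in> Basis \<Longrightarrow> i \<in> Basis \<Longrightarrow> j \<in> Basis \<Longrightarrow> x \<in> cball x0 R \<Longrightarrow> \<bar>dmetric c x k i j\<bar> \<le> b3 k i j"
    by blast
  have "\<exists>b. \<forall>k\<in>Basis. \<forall>i\<in>Basis. \<forall>j\<in>Basis. \<forall>x\<in>cball x0 R. \<forall>y\<in>cball x0 R.
      \<bar>dmetric c x k i j - dmetric c y k i j\<bar> \<le> b k i j * norm (x - y)"
    using smooth_on_lipschitz[OF sm R(2)] by metis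
  then obtain b4 where b4: "\<And>k i j x y. k \<in> Basis \<Longrightarrow> i \<in> Basis \<Longrightarrow> j \<in> Basis \<Longrightarrow> x \<in> cball x0 R \<Longrightarrow> y \<in> cball x0 R
      \<Longrightarrow> \<bar>dmetric c x k i j - dmetric c y k i j\<bar> \<le> b4 k i j * norm (x - y)"
    by blast
  define S2 where "S2 = (\<Sum>i\<in>Basis. \<Sum>j\<in>Basis. \<bar>b2 i j\<bar>)"
  define S3 where "S3 = (\<Sum>k\<in>Basis. \<Sum>i\<in>Basis. \<Sum>j\<in>Basis. \<bar>b3 k i j\<bar> + \<bar>b4 k i j\<bar>)"
  have S20: "0 \<le> S2" and S30: "0 \<le> S3" by (auto simp: S2_def S3_def intro!: sum_nonneg)
  have le2: "b2 i j \<le> S2" if "i \<in> Basis" "j \<in> Basis" for i j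
  proof -
    have "b2 i j \<le> \<bar>b2 i j\<bar>" by simp
    also have "\<dots> \<le> (\<Sum>j\<in>Basis. \<bar>b2 i j\<bar>)" using that by (intro member_le_sum) auto
    also have "\<dots> \<le> S2" unfolding S2_def using that
      by (intro member_le_sum[of i Basis "\<lambda>i. \<Sum>j\<in>Basis. \<bar>b2 i j\<bar>"]) (auto intro: sum_nonneg)
    finally show ?thesis .
  qed
  have le3: "\<bar>b3 k i j\<bar> + \<bar>b4 k i j\<bar> \<le> S3" if "k \<in> Basis" "i \<in> Basis" "j \<in> Basis" for k i j
  proof -
    have "\<bar>b3 k i j\<bar> + \<bar>b4 k i j\<bar> \<le> (\<Sum>j\<in>Basis. \<bar>b3 k i j\<bar> + \<bar>b4 k i j\<bar>)"
      using that by (intro member_le_sum) auto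
    also have "\<dots> \<le> (\<Sum>i\<in>Basis. \<Sum>j\<in>Basis. \<bar>b3 k i j\<bar> + \<bar>b4 k i j\<bar>)" using that
      by (intro member_le_sum[of i Basis "\<lambda>i. \<Sum>j\<in>Basis. \<bar>b3 k i j\<bar> + \<bar>b4 k i j\<bar>"]) (auto intro: sum_nonneg)
    also have "\<dots> \<le> S3" unfolding S3_def using that
      by (intro member_le_sum[of k Basis "\<lambda>k. \<Sum>i\<in>Basis. \<Sum>j\<in>Basis. \<bar>b3 k i j\<bar> + \<bar>b4 k i j\<bar>"])
        (auto intro!: sum_nonneg)
    finally show ?thesis .
  qed
  define K where "K = 1 + k1 + n^3 * (S2 + S3)"
  have n3: "0 \<le> n^3" "n\<^sup>2 \<le> n^3" using n1 power_increasing[of 2 3 n] by auto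
  have K: "1 \<le> K" "k1 \<le> K" "n\<^sup>2 * S2 \<le> K" "n^3 * S3 \<le> K"
  proof -
    have "0 \<le> n^3 * S2" "0 \<le> n^3 * S3" using n3 S20 S30 by auto
    moreover have "n\<^sup>2 * S2 \<le> n^3 * S2" using n3 S20 by (intro mult_right_mono) auto
    ultimately show "1 \<le> K" "k1 \<le> K" "n\<^sup>2 * S2 \<le> K" "n^3 * S3 \<le> K"
      using k1pos by (auto simp: K_def algebra_simps)
  qed
  have tri: "\<bar>\<Sum>k\<in>Basis. (h \<bullet> k) * T k\<bar> \<le> K * c * norm h * norm u * norm v"
    if T: "\<And>k. k \<in> Basis \<Longrightarrow> \<bar>T k\<bar> \<le> n\<^sup>2 * (S3 * c) * norm u * norm v" and "0 \<le> c"
    for T :: "'e \<Rightarrow> real" and h u v :: 'e and c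
  proof -
    have "\<bar>\<Sum>k\<in>Basis. (h \<bullet> k) * T k\<bar> \<le> n * (n\<^sup>2 * (S3 * c) * norm u * norm v) * norm h"
      unfolding n_def by (rule sum_mult_bound) (use T in \<open>simp add: n_def\<close>)
    also have "\<dots> = (n^3 * S3) * (c * norm h * norm u * norm v)"
      by (simp add: power2_eq_square power3_eq_cube mult_ac)
    also have "\<dots> \<le> K * (c * norm h * norm u * norm v)"
      using K(4) that(2) by (intro mult_right_mono) auto
    finally show ?thesis by (simp add: mult_ac)
  qed
  have "geodesic_domain x0 R K (g c) (dmetric c) (acc c)"
  proof
    fix x y h u v w
    assume x: "x \<in> ball x0 R"
    then have xc: "x \<in> cball x0 R" and xV: "x \<in> snd c ` fst c" using R by (auto simp: V_def)
    show "bilinear (g c x)" "g c x u v = g c x v u" using metric[OF c xV] by auto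
    show "(norm v)\<^sup>2 \<le> K * g c x v v"
      using k1[OF xc, of v] mult_right_mono[OF K(2) metric_nonneg[OF c xV, of v]] by simp
    have "\<bar>g c x u v\<bar> \<le> (n\<^sup>2 * S2) * (norm u * norm v)"
      using bilinear_bound[OF metric(1)[OF c xV], of S2 u v] b2[OF _ _ xc] le2
      unfolding n_def by (smt (verit, ccfv_threshold) mult.assoc)
    also have "\<dots> \<le> K * (norm u * norm v)" using K(3) by (intro mult_right_mono) auto
    finally show "\<bar>g c x u v\<bar> \<le> K * norm u * norm v" by (simp add: mult_ac)
    show "((\<lambda>y. g c y u v) has_derivative (\<lambda>h. dmetric c x h u v)) (at x)"
      by (rule metric_has_derivative[OF c xV])
    show "bilinear (dmetric c x h)" by (rule dmetric_bilinear[OF c xV])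
    show "g c x (acc c x v) w = dmetric c x w v v / 2 - dmetric c x v v w" by (rule acc_eq[OF c xV])
    have hsum: "dmetric c x h u v = (\<Sum>k\<in>Basis. (h \<bullet> k) * dmetric c x k u v)"
      using linear_basis_sum[OF dmetric_linear[OF c xV], of h u v] by simp
    have "\<bar>\<Sum>k\<in>Basis. (h \<bullet> k) * dmetric c x k u v\<bar> \<le> K * 1 * norm h * norm u * norm v"
    proof (rule tri)
      fix k :: 'e assume k: "k \<in> Basis"
      have "\<bar>dmetric c x k i j\<bar> \<le> S3" if "i \<in> Basis" "j \<in> Basis" for i j
        using b3[OF k that xc] le3[OF k that] by linarith
      then show "\<bar>dmetric c x k u v\<bar> \<le> n\<^sup>2 * (S3 * 1) * norm u * norm v"
        unfolding n_def using bilinear_bound[OF dmetric_bilinear[OF c xV, of k], of S3 u v] by simp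
    qed simp
    then show "\<bar>dmetric c x h u v\<bar> \<le> K * norm h * norm u * norm v" using hsum by simp
    assume y: "y \<in> ball x0 R"
    then have yc: "y \<in> cball x0 R" and yV: "y \<in> snd c ` fst c" using R by (auto simp: V_def)
    have hsum2: "dmetric c x h u v - dmetric c y h u v = (\<Sum>k\<in>Basis. (h \<bullet> k) * (dmetric c x k u v - dmetric c y k u v))"
      using hsum linear_basis_sum[OF dmetric_linear[OF c yV], of h u v]
      by (simp add: sum_subtractf right_diff_distrib)
    have "\<bar>\<Sum>k\<in>Basis. (h \<bullet> k) * (dmetric c x k u v - dmetric c y k u v)\<bar> \<le> K * norm (x - y) * norm h * norm u * norm v"
    proof (rule tri)
      fix k :: 'e assume k: "k \<in> Basis"
      have bil: "bilinear (\<lambda>u v. dmetric c x k u v - dmetric c y k u v)"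
        using dmetric_bilinear[OF c xV, of k] dmetric_bilinear[OF c yV, of k]
        by (auto simp: bilinear_def intro: linear_compose_sub)
      have "\<bar>dmetric c x k i j - dmetric c y k i j\<bar> \<le> S3 * norm (x - y)" if "i \<in> Basis" "j \<in> Basis" for i j
      proof -
        have "b4 k i j \<le> S3" using le3[OF k that] by linarith
        then have "b4 k i j * norm (x - y) \<le> S3 * norm (x - y)" by (intro mult_right_mono) auto
        then show ?thesis using b4[OF k that xc yc] by linarith
      qed
      then show "\<bar>dmetric c x k u v - dmetric c y k u v\<bar> \<le> n\<^sup>2 * (S3 * norm (x - y)) * norm u * norm v"
        unfolding n_def using bilinear_bound[OF bil, of "S3 * norm (x - y)" u v] by simp
    qed simp
    then show "\<bar>dmetric c x h u v - dmetric c y h u v\<bar> \<le> K * norm (x - y) * norm h * norm u * norm v"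
      using hsum2 by simp
  qed (use R K in auto)
  moreover have "ball x0 R \<subseteq> snd c ` fst c" using R by (auto simp: V_def)
  ultimately show ?thesis using that by (simp add: x0_def)
qed

end

section \<open>Piecewise differentiable curves\<close>

lemma C1_curve_continuous: "C1_curve A a b \<gamma> \<Longrightarrow> continuous_on {a..b} \<gamma>"
  unfolding C1_curve_def by (rule conjunct1)

lemma piecewise_C1_continuous: "piecewise_C1_curve A a b \<gamma> \<Longrightarrow> continuous_on {a..b} \<gamma>"
  unfolding piecewise_C1_curve_def by (rule conjunct1)

lemma piecewise_C1_curveE:
  assumes "piecewise_C1_curve A a b \<gamma>"
  obtains S where "finite S"
    "\<And>u v. a \<le> u \<Longrightarrow> u < v \<Longrightarrow> v \<le> b \<Longrightarrow> {u<..<v} \<inter> S = {} \<Longrightarrow> C1_curve A u v \<gamma>"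
  using assms unfolding piecewise_C1_curve_def by blast

lemma piecewise_C1_subinterval:
  assumes pw: "piecewise_C1_curve A a b \<gamma>" and uv: "a \<le> u" "v \<le> b"
  shows "piecewise_C1_curve A u v \<gamma>"
proof -
  obtain S where S: "finite S"
    "\<And>u v. a \<le> u \<Longrightarrow> u < v \<Longrightarrow> v \<le> b \<Longrightarrow> {u<..<v} \<inter> S = {} \<Longrightarrow> C1_curve A u v \<gamma>"
    using piecewise_C1_curveE[OF pw] by blast
  show ?thesis
    unfolding piecewise_C1_curve_def
  proof (intro conjI exI[of _ S] S(1) allI impI)
    show "continuous_on {u..v} \<gamma>"
      by (rule continuous_on_subset[OF piecewise_C1_continuous[OF pw]]) (use uv in auto)
    show "C1_curve A u' v' \<gamma>" if "u \<le> u' \<and> u' < v' \<and> v' \<le> v \<and> {u'<..<v'} \<inter> S = {}" for u' v'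
      using S(2)[of u' v'] that uv by simp
  qed
qed

lemma C1_curve_cong:
  assumes "C1_curve A a b \<gamma>" "\<And>t. t \<in> {a..b} \<Longrightarrow> h t = \<gamma> t"
  shows "C1_curve A a b h"
  unfolding C1_curve_def
proof (intro conjI ballI)
  show "continuous_on {a..b} h"
    using continuous_on_eq[OF C1_curve_continuous[OF assms(1)]] assms(2) by simp
  fix c assume "c \<in> A"
  then obtain \<gamma>' where g: "continuous_on {t\<in>{a..b}. \<gamma> t \<in> fst c} \<gamma>'"
      "\<And>t. t \<in> {a..b} \<Longrightarrow> \<gamma> t \<in> fst c \<Longrightarrow> ((snd c \<circ> \<gamma>) has_vector_derivative \<gamma>' t) (at t within {a..b})"
    using assms(1) unfolding C1_curve_def by blast
  have eq: "{t\<in>{a..b}. h t \<in> fst c} = {t\<in>{a..b}. \<gamma> t \<in> fst c}" using assms(2) by auto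
  show "\<exists>\<gamma>'. continuous_on {t\<in>{a..b}. h t \<in> fst c} \<gamma>' \<and>
    (\<forall>t\<in>{a..b}. h t \<in> fst c \<longrightarrow> ((snd c \<circ> h) has_vector_derivative \<gamma>' t) (at t within {a..b}))"
  proof (intro exI[of _ \<gamma>'] conjI ballI impI)
    show "continuous_on {t\<in>{a..b}. h t \<in> fst c} \<gamma>'" unfolding eq by (rule g)
    fix t assume t: "t \<in> {a..b}" "h t \<in> fst c"
    then have "((snd c \<circ> \<gamma>) has_vector_derivative \<gamma>' t) (at t within {a..b})" using g(2) assms(2) by simp
    then show "((snd c \<circ> h) has_vector_derivative \<gamma>' t) (at t within {a..b})"
      by (rule has_vector_derivative_transform[OF t(1), rotated]) (simp add: assms(2))
  qed
qed

text \<open>One statement for restriction, translation and, with negative \<open>m\<close>, reversal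
  of a curve.\<close>

lemma C1_curve_affine:
  assumes \<gamma>: "C1_curve A u v \<gamma>" and img: "(\<lambda>t. m * t + k) ` {u'..v'} \<subseteq> {u..v}"
  shows "C1_curve A u' v' (\<lambda>t. \<gamma> (m * t + k))"
  unfolding C1_curve_def
proof (intro conjI ballI)
  show "continuous_on {u'..v'} (\<lambda>t. \<gamma> (m * t + k))"
    by (intro continuous_on_compose2[OF C1_curve_continuous[OF \<gamma>]] continuous_intros img)
  fix c assume "c \<in> A"
  then obtain \<gamma>' where g: "continuous_on {t\<in>{u..v}. \<gamma> t \<in> fst c} \<gamma>'"
      "\<And>t. t \<in> {u..v} \<Longrightarrow> \<gamma> t \<in> fst c \<Longrightarrow> ((snd c \<circ> \<gamma>) has_vector_derivative \<gamma>' t) (at t within {u..v})"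
    using \<gamma> unfolding C1_curve_def by blast
  show "\<exists>\<gamma>'. continuous_on {t\<in>{u'..v'}. \<gamma> (m * t + k) \<in> fst c} \<gamma>' \<and>
    (\<forall>t\<in>{u'..v'}. \<gamma> (m * t + k) \<in> fst c \<longrightarrow>
      ((snd c \<circ> (\<lambda>t. \<gamma> (m * t + k))) has_vector_derivative \<gamma>' t) (at t within {u'..v'}))"
  proof (intro exI[of _ "\<lambda>t. m *\<^sub>R \<gamma>' (m * t + k)"] conjI ballI impI)
    show "continuous_on {t\<in>{u'..v'}. \<gamma> (m * t + k) \<in> fst c} (\<lambda>t. m *\<^sub>R \<gamma>' (m * t + k))"
    proof (intro continuous_intros continuous_on_compose2[OF g(1)])
      have mem: "m * t + k \<in> {u..v}" if "t \<in> {u'..v'}" for t using img that by blast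
      then show "(\<lambda>t. m * t + k) ` {t\<in>{u'..v'}. \<gamma> (m * t + k) \<in> fst c} \<subseteq> {t\<in>{u..v}. \<gamma> t \<in> fst c}"
        by blast
    qed
    fix t assume t: "t \<in> {u'..v'}" "\<gamma> (m * t + k) \<in> fst c"
    have aff: "((\<lambda>t. m * t + k) has_vector_derivative m) (at t within {u'..v'})"
      by (auto intro!: derivative_eq_intros simp flip: has_real_derivative_iff_has_vector_derivative)
    have "m * t + k \<in> {u..v}" using img t by blast
    then show "((snd c \<circ> (\<lambda>t. \<gamma> (m * t + k))) has_vector_derivative m *\<^sub>R \<gamma>' (m * t + k)) (at t within {u'..v'})"
      using vector_diff_chain_within[OF aff has_vector_derivative_within_subset[OF g(2)[OF _ t(2)] img]]
      by (simp add: o_def)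
  qed
qed

lemma C1_curve_subinterval:
  "C1_curve A u v \<gamma> \<Longrightarrow> u \<le> u' \<Longrightarrow> v' \<le> v \<Longrightarrow> C1_curve A u' v' \<gamma>"
  using C1_curve_affine[of A u v \<gamma> 1 0 u' v'] by auto

lemma piecewise_C1_shift:
  assumes "piecewise_C1_curve A a b \<gamma>"
  shows "piecewise_C1_curve A (a - k) (b - k) (\<lambda>t. \<gamma> (t + k))"
proof -
  obtain S where S: "finite S" "\<And>u v. a \<le> u \<Longrightarrow> u < v \<Longrightarrow> v \<le> b \<Longrightarrow> {u<..<v} \<inter> S = {} \<Longrightarrow> C1_curve A u v \<gamma>"
    using piecewise_C1_curveE[OF assms] by metis
  have "continuous_on {a - k..b - k} (\<lambda>t. \<gamma> (t + k))"
    by (intro continuous_on_compose2[OF piecewise_C1_continuous[OF assms]] continuous_intros) auto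
  moreover have "C1_curve A u v (\<lambda>t. \<gamma> (t + k))"
    if "a - k \<le> u" "u < v" "v \<le> b - k" "{u<..<v} \<inter> (\<lambda>s. s - k) ` S = {}" for u v
  proof -
    have "{u + k<..<v + k} \<inter> S = {}"
    proof (rule ccontr)
      assume "{u + k<..<v + k} \<inter> S \<noteq> {}"
      then obtain s where "s \<in> S" "u + k < s" "s < v + k" by auto
      then have "s - k \<in> {u<..<v} \<inter> (\<lambda>s. s - k) ` S" by auto
      then show False using that by auto
    qed
    then have "C1_curve A (u + k) (v + k) \<gamma>" using S(2) that by auto
    from C1_curve_affine[OF this, of 1 k u v] show ?thesis by auto
  qed
  ultimately show ?thesis
    unfolding piecewise_C1_curve_def using S(1) by (intro conjI exI[of _ "(\<lambda>s. s - k) ` S"]) auto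
qed

lemma piecewise_C1_reflect:
  assumes "piecewise_C1_curve A a b \<gamma>"
  shows "piecewise_C1_curve A (- b) (- a) (\<lambda>t. \<gamma> (- t))"
proof -
  obtain S where S: "finite S" "\<And>u v. a \<le> u \<Longrightarrow> u < v \<Longrightarrow> v \<le> b \<Longrightarrow> {u<..<v} \<inter> S = {} \<Longrightarrow> C1_curve A u v \<gamma>"
    using piecewise_C1_curveE[OF assms] by metis
  have "continuous_on {- b..- a} (\<lambda>t. \<gamma> (- t))"
    by (intro continuous_on_compose2[OF piecewise_C1_continuous[OF assms]] continuous_intros) auto
  moreover have "C1_curve A u v (\<lambda>t. \<gamma> (- t))"
    if "- b \<le> u" "u < v" "v \<le> - a" "{u<..<v} \<inter> uminus ` S = {}" for u v
  proof -
    have "{- v<..<- u} \<inter> S = {}"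
    proof (rule ccontr)
      assume "{- v<..<- u} \<inter> S \<noteq> {}"
      then obtain s where "s \<in> S" "- v < s" "s < - u" by auto
      then have "- s \<in> {u<..<v} \<inter> uminus ` S" by auto
      then show False using that by auto
    qed
    then have "C1_curve A (- v) (- u) \<gamma>" using S(2) that by auto
    from C1_curve_affine[OF this, of "-1" 0 u v] show ?thesis by auto
  qed
  ultimately show ?thesis
    unfolding piecewise_C1_curve_def using S(1) by (intro conjI exI[of _ "uminus ` S"]) auto
qed

lemma piecewise_C1_join:
  assumes 1: "piecewise_C1_curve A a b \<gamma>1" and 2: "piecewise_C1_curve A b c \<gamma>2"
    and "a \<le> b" "b \<le> c" and eq: "\<gamma>1 b = \<gamma>2 b"
  shows "piecewise_C1_curve A a c (\<lambda>t. if t \<le> b then \<gamma>1 t else \<gamma>2 t)" (is "piecewise_C1_curve A a c ?h")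
proof -
  obtain S1 where S1: "finite S1" "\<And>u v. a \<le> u \<Longrightarrow> u < v \<Longrightarrow> v \<le> b \<Longrightarrow> {u<..<v} \<inter> S1 = {} \<Longrightarrow> C1_curve A u v \<gamma>1"
    using piecewise_C1_curveE[OF 1] by metis
  obtain S2 where S2: "finite S2" "\<And>u v. b \<le> u \<Longrightarrow> u < v \<Longrightarrow> v \<le> c \<Longrightarrow> {u<..<v} \<inter> S2 = {} \<Longrightarrow> C1_curve A u v \<gamma>2"
    using piecewise_C1_curveE[OF 2] by metis
  have "continuous_on ({a..b} \<union> {b..c}) ?h"
    using piecewise_C1_continuous[OF 1] piecewise_C1_continuous[OF 2] eq
    by (intro continuous_on_If) (auto dest!: order_antisym)
  moreover have "{a..b} \<union> {b..c} = {a..c}" using assms by auto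
  moreover have "C1_curve A u v ?h"
    if "a \<le> u" "u < v" "v \<le> c" and S: "{u<..<v} \<inter> insert b (S1 \<union> S2) = {}" for u v
  proof -
    have "b \<notin> {u<..<v}" using S by auto
    then consider "v \<le> b" | "b \<le> u" using \<open>u < v\<close> by force
    then show ?thesis
    proof cases
      case 1
      have "{u<..<v} \<inter> S1 = {}" using S by auto
      from C1_curve_cong[OF S1(2)[OF that(1,2) 1 this]] 1 show ?thesis by auto
    next
      case 2
      have "{u<..<v} \<inter> S2 = {}" using S by auto
      from S2(2)[OF 2 that(2,3) this] show ?thesis
      proof (rule C1_curve_cong)
        fix t assume "t \<in> {u..v}"
        then show "?h t = \<gamma>2 t" using 2 eq by (cases "t = b") auto
      qed
    qed
  qed
  ultimately show ?thesis
    unfolding piecewise_C1_curve_def using S1(1) S2(1)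
    by (intro conjI exI[of _ "insert b (S1 \<union> S2)"]) auto
qed

lemma vector_derivative_cong_open:
  assumes "open T" "t \<in> T" "\<And>s. s \<in> T \<Longrightarrow> f s = h s"
  shows "vector_derivative f (at t) = vector_derivative h (at t)"
proof -
  have "(f has_vector_derivative d) (at t) \<longleftrightarrow> (h has_vector_derivative d) (at t)" for d
    using has_vector_derivative_transform_within_open[OF _ assms(1,2)] assms(3) by metis
  then show ?thesis by (simp add: vector_derivative_def)
qed

lemma has_vector_derivative_affine:
  fixes f :: "real \<Rightarrow> 'b::real_normed_vector"
  assumes "(f has_vector_derivative d) (at (m * t + k))"
  shows "((\<lambda>s. f (m * s + k)) has_vector_derivative m *\<^sub>R d) (at t)"
proof -
  have aff: "((\<lambda>t. m * t + k) has_vector_derivative m) (at t)"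
    by (auto intro!: derivative_eq_intros simp flip: has_real_derivative_iff_has_vector_derivative)
  from vector_diff_chain_at[OF aff assms] show ?thesis by (simp add: o_def)
qed

text \<open>Where \<open>f\<close> is not differentiable, both sides are the same arbitrary vector, which is why the
  result is a disjunction.\<close>

lemma vector_derivative_affine:
  fixes f :: "real \<Rightarrow> 'b::real_normed_vector" and m :: real
  assumes m: "m * m = 1"
  shows "vector_derivative (\<lambda>s. f (m * s + k)) (at t) = m *\<^sub>R vector_derivative f (at (m * t + k)) \<or>
    vector_derivative (\<lambda>s. f (m * s + k)) (at t) = vector_derivative f (at (m * t + k))"
proof (cases "\<exists>d. (f has_vector_derivative d) (at (m * t + k))")
  case True
  then obtain d where d: "(f has_vector_derivative d) (at (m * t + k))" by blast
  then show ?thesis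
    using vector_derivative_at[OF d] vector_derivative_at[OF has_vector_derivative_affine[OF d]] by simp
next
  case False
  have "\<nexists>d. ((\<lambda>s. f (m * s + k)) has_vector_derivative d) (at t)"
  proof
    assume "\<exists>d. ((\<lambda>s. f (m * s + k)) has_vector_derivative d) (at t)"
    then obtain d where "((\<lambda>s. f (m * s + k)) has_vector_derivative d) (at t)" by blast
    moreover have inv: "m * (m * s) = s" for s using m by (simp add: mult.assoc[symmetric])
    have "m * (m * t + k) + (- m * k) = t" using inv[of t] by (simp only: distrib_left mult_minus_left; simp)
    ultimately have "((\<lambda>s. f (m * s + k)) has_vector_derivative d) (at (m * (m * t + k) + (- m * k)))"
      by simp
    then have "((\<lambda>s. f (m * (m * s + - m * k) + k)) has_vector_derivative m *\<^sub>R d) (at (m * t + k))"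
      by (rule has_vector_derivative_affine)
    moreover have "m * (m * s + - m * k) + k = s" for s
      using inv[of s] inv[of k] by (simp only: distrib_left mult_minus_left mult_minus_right; simp)
    ultimately have "(f has_vector_derivative m *\<^sub>R d) (at (m * t + k))" by (simp only:)
    then show False using False by blast
  qed
  then show ?thesis using False by (simp add: vector_derivative_def)
qed

section \<open>Speed, length and concatenation of curves\<close>

context riemannian
begin

lemma speed_chart:
  obtains c where "c \<in> A" "\<gamma> t \<in> fst c" 
    "speed A g \<gamma> t = sqrt (g c (snd c (\<gamma> t)) (vector_derivative (snd c \<circ> \<gamma>) (at t)) (vector_derivative (snd c \<circ> \<gamma>) (at t)))"
    "c = (SOME c. c \<in> A \<and> \<gamma> t \<in> fst c)"
proof -
  define c where "c = (SOME c. c \<in> A \<and> \<gamma> t \<in> fst c)"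
  have "c \<in> A \<and> \<gamma> t \<in> fst c" unfolding c_def by (rule someI_ex) (use chart_cover in blast)
  then show ?thesis using that[of c] by (auto simp: speed_def c_def Let_def)
qed

lemma speed_nonneg: "0 \<le> speed A g \<gamma> t"
  by (rule speed_chart[of \<gamma> t]) (use metric_nonneg in auto)

lemma speed_cong_open:
  assumes T: "open T" "t \<in> T" "\<And>s. s \<in> T \<Longrightarrow> \<gamma> s = h s"
  shows "speed A g \<gamma> t = speed A g h t"
proof -
  have "vector_derivative (snd c \<circ> \<gamma>) (at t) = vector_derivative (snd c \<circ> h) (at t)" for c :: "('a, 'e) chart"
    by (rule vector_derivative_cong_open[OF T(1,2)]) (simp add: T(3))
  then show ?thesis using T by (simp add: speed_def)
qed

text \<open>The chart chosen in \<open>speed\<close> depends only on the point, so it is the same on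
  both sides, and the sign of the velocity disappears in the quadratic form. The equation also holds
  where the derivative does not exist, since the default vectors agree.\<close>

lemma speed_affine:
  assumes m: "m * m = 1"
  shows "speed A g (\<lambda>s. \<gamma> (m * s + k)) t = speed A g \<gamma> (m * t + k)"
proof (rule speed_chart[of \<gamma> "m * t + k"])
  fix c assume c: "c \<in> A" "\<gamma> (m * t + k) \<in> fst c"
    "speed A g \<gamma> (m * t + k) = sqrt (g c (snd c (\<gamma> (m * t + k))) (vector_derivative (snd c \<circ> \<gamma>) (at (m * t + k)))
       (vector_derivative (snd c \<circ> \<gamma>) (at (m * t + k))))"
    "c = (SOME c. c \<in> A \<and> \<gamma> (m * t + k) \<in> fst c)"
  have B: "bilinear (g c (snd c (\<gamma> (m * t + k))))" using metric(1) c by blast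
  have "g c (snd c (\<gamma> (m * t + k))) (m *\<^sub>R w) (m *\<^sub>R w) = g c (snd c (\<gamma> (m * t + k))) w w" for w
    using m by (simp add: bilinear_lmul[OF B] bilinear_rmul[OF B] mult.assoc[symmetric])
  then show ?thesis
    using vector_derivative_affine[OF m, of "snd c \<circ> \<gamma>" k t] c(3,4)
    by (auto simp: speed_def o_def Let_def)
qed

text \<open>The transformation law makes the speed independent of the chart selected by
  \<open>SOME\<close>. Continuity at \<open>t\<close> keeps the curve in the domain of
  \<open>c\<close> for nearby times, where the coordinates in the selected chart factor through the
  transition map.\<close>

lemma speed_eq:
  assumes c: "c \<in> A" "\<gamma> t \<in> fst c" and cont: "isCont \<gamma> t"
    and d: "((snd c \<circ> \<gamma>) has_vector_derivative v) (at t)"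
  shows "speed A g \<gamma> t = sqrt (g c (snd c (\<gamma> t)) v v)"
proof (rule speed_chart[of \<gamma> t])
  fix e assume e: "e \<in> A" "\<gamma> t \<in> fst e"
    "speed A g \<gamma> t = sqrt (g e (snd e (\<gamma> t)) (vector_derivative (snd e \<circ> \<gamma>) (at t)) (vector_derivative (snd e \<circ> \<gamma>) (at t)))"
  define F where "F = frechet_derivative (transition c e) (at (snd c (\<gamma> t)))"
  have F: "(transition c e has_derivative F) (at (snd c (\<gamma> t)))"
    unfolding F_def by (rule smooth_on_has_derivative[OF transition_smooth[OF c(1) e(1)]]) (use c e in auto)
  have "open (fst c)" using chart(1)[OF c(1)] .
  then have "\<exists>T. open T \<and> t \<in> T \<and> (\<forall>s\<in>T. \<gamma> s \<in> fst c)"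
    using cont[unfolded continuous_at_open, rule_format, of "fst c"] c(2) by blast
  then obtain T where T: "open T" "t \<in> T" "\<And>s. s \<in> T \<Longrightarrow> \<gamma> s \<in> fst c"
    by blast
  have "(transition c e \<circ> (snd c \<circ> \<gamma>) has_derivative F \<circ> (\<lambda>h. h *\<^sub>R v)) (at t)"
    using diff_chain_at[of "snd c \<circ> \<gamma>" "\<lambda>h. h *\<^sub>R v" t "transition c e" F] d F
    by (simp add: has_vector_derivative_def)
  then have "(transition c e \<circ> (snd c \<circ> \<gamma>) has_vector_derivative F v) (at t)"
    using linear_scale[OF has_derivative_linear[OF F]] by (simp add: has_vector_derivative_def o_def)
  then have "((snd e \<circ> \<gamma>) has_vector_derivative F v) (at t)"
    by (rule has_vector_derivative_transform_within_open[OF _ T(1,2)])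
      (use T(3) chart_inv_left[OF c(1)] in simp)
  then have "vector_derivative (snd e \<circ> \<gamma>) (at t) = F v" by (rule vector_derivative_at)
  then show ?thesis using e(3) metric_transform[OF c(1) e(1) c(2) e(2), of v v] by (simp add: F_def)
qed

text \<open>\<open>C1_curve\<close> refers to all charts. For a curve inside one chart domain the
  other coordinates are obtained by the chain rule with the transition maps.\<close>

lemma C1_curveI_chart:
  assumes c: "c \<in> A" and \<gamma>: "\<And>t. t \<in> {a..b} \<Longrightarrow> \<gamma> t \<in> fst c"
    and d: "\<And>t. t \<in> {a..b} \<Longrightarrow> ((snd c \<circ> \<gamma>) has_vector_derivative \<gamma>' t) (at t within {a..b})"
    and cont: "continuous_on {a..b} \<gamma>'"
  shows "C1_curve A a b \<gamma>"
  unfolding C1_curve_def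
proof (intro conjI ballI)
  have cx: "continuous_on {a..b} (snd c \<circ> \<gamma>)" by (rule continuous_on_vector_derivative[OF d])
  have "continuous_on {a..b} (\<lambda>t. chart_inv c ((snd c \<circ> \<gamma>) t))"
    by (rule continuous_on_compose2[OF homeomorphism_cont2[OF chart(3)[OF c]] cx]) (use \<gamma> in auto)
  then show "continuous_on {a..b} \<gamma>"
    by (rule continuous_on_cong[THEN iffD1, rotated -1]) (use \<gamma> chart_inv_left[OF c] in auto)
  fix e assume e: "e \<in> A"
  note sm = transition_smooth[OF c e]
  show "\<exists>\<gamma>'. continuous_on {t\<in>{a..b}. \<gamma> t \<in> fst e} \<gamma>' \<and>
    (\<forall>t\<in>{a..b}. \<gamma> t \<in> fst e \<longrightarrow> ((snd e \<circ> \<gamma>) has_vector_derivative \<gamma>' t) (at t within {a..b}))"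
  proof (intro exI[of _ "\<lambda>t. frechet_derivative (transition c e) (at ((snd c \<circ> \<gamma>) t)) (\<gamma>' t)"] conjI ballI impI)
    show "continuous_on {t\<in>{a..b}. \<gamma> t \<in> fst e} (\<lambda>t. frechet_derivative (transition c e) (at ((snd c \<circ> \<gamma>) t)) (\<gamma>' t))"
      by (rule continuous_on_frechet[OF sm continuous_on_subset[OF cx] _ continuous_on_subset[OF cont]])
        (use \<gamma> in auto)
    fix t assume t: "t \<in> {a..b}" "\<gamma> t \<in> fst e"
    define F where "F = frechet_derivative (transition c e) (at (snd c (\<gamma> t)))"
    have F: "(transition c e has_derivative F) (at (snd c (\<gamma> t)))"
      unfolding F_def by (rule smooth_on_has_derivative[OF sm]) (use t \<gamma> in auto)
    have "(transition c e \<circ> (snd c \<circ> \<gamma>) has_derivative F \<circ> (\<lambda>h. h *\<^sub>R \<gamma>' t)) (at t within {a..b})"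
      using d[OF t(1)] has_derivative_at_withinI[OF F]
      by (intro diff_chain_within) (auto simp: has_vector_derivative_def)
    then have "(transition c e \<circ> (snd c \<circ> \<gamma>) has_vector_derivative F (\<gamma>' t)) (at t within {a..b})"
      using linear_scale[OF has_derivative_linear[OF F]] by (simp add: has_vector_derivative_def o_def)
    then have "((snd e \<circ> \<gamma>) has_vector_derivative F (\<gamma>' t)) (at t within {a..b})"
      by (rule has_vector_derivative_transform[OF t(1), rotated]) (use \<gamma> chart_inv_left[OF c] in simp)
    then show "((snd e \<circ> \<gamma>) has_vector_derivative frechet_derivative (transition c e) (at ((snd c \<circ> \<gamma>) t)) (\<gamma>' t)) (at t within {a..b})"
      by (simp add: F_def)
  qed
qed

lemma speed_C1:
  assumes c: "c \<in> A" "\<And>t. t \<in> {a..b} \<Longrightarrow> \<gamma> t \<in> fst c" and cont: "continuous_on {a..b} \<gamma>"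
    and d: "\<And>t. t \<in> {a..b} \<Longrightarrow> ((snd c \<circ> \<gamma>) has_vector_derivative \<gamma>' t) (at t within {a..b})"
    and t: "t \<in> {a<..<b}"
  shows "speed A g \<gamma> t = sqrt (g c (snd c (\<gamma> t)) (\<gamma>' t) (\<gamma>' t))"
proof (rule speed_eq[OF c(1)])
  have t': "t \<in> {a..b}" using t by auto
  show "\<gamma> t \<in> fst c" using c(2) t' by auto
  show "isCont \<gamma> t" using cont t by (metis continuous_on_interior interior_atLeastAtMost_real)
  show "((snd c \<circ> \<gamma>) has_vector_derivative \<gamma>' t) (at t)"
    using d[OF t'] t by (metis at_within_interior interior_atLeastAtMost_real)
qed

text \<open>At the two end points \<open>speed\<close> uses a two-sided derivative and may have a
  different value; a finite set does not affect the integral.\<close>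

lemma has_integral_speed_C1:
  assumes c: "c \<in> A" "\<And>t. t \<in> {a..b} \<Longrightarrow> \<gamma> t \<in> fst c" and cont: "continuous_on {a..b} \<gamma>"
    and d: "\<And>t. t \<in> {a..b} \<Longrightarrow> ((snd c \<circ> \<gamma>) has_vector_derivative \<gamma>' t) (at t within {a..b})"
  shows "(speed A g \<gamma> has_integral l) {a..b} \<longleftrightarrow>
     ((\<lambda>t. sqrt (g c (snd c (\<gamma> t)) (\<gamma>' t) (\<gamma>' t))) has_integral l) {a..b}"
  by (rule has_integral_spike_finite_eq[of "{a, b}"]) (use speed_C1[OF c cont d] in auto)

lemma C1_curve_chartD:
  assumes "C1_curve A a b \<gamma>" "c \<in> A" "\<And>t. t \<in> {a..b} \<Longrightarrow> \<gamma> t \<in> fst c"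
  shows "\<exists>\<gamma>'. continuous_on {a..b} \<gamma>' \<and>
    (\<forall>t\<in>{a..b}. ((snd c \<circ> \<gamma>) has_vector_derivative \<gamma>' t) (at t within {a..b}))"
proof -
  have "{t\<in>{a..b}. \<gamma> t \<in> fst c} = {a..b}" using assms(3) by auto
  then show ?thesis using assms unfolding C1_curve_def by metis
qed

text \<open>Bisection of the parameter interval: an interval property that is additive and trivial
  on points need only be checked on short pieces which are continuously differentiable and lie in
  one chart domain.\<close>

lemma piecewise_C1_induct [consumes 2, case_names trans refl local]:
  assumes pw: "piecewise_C1_curve A a b \<gamma>" and ab: "a \<le> b"
    and trans: "\<And>u v w. P u v \<Longrightarrow> P v w \<Longrightarrow> a \<le> u \<Longrightarrow> u \<le> v \<Longrightarrow> v \<le> w \<Longrightarrow> w \<le> b \<Longrightarrow> P u w"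
    and refl: "\<And>u. P u u"
    and local: "\<And>c u v. c \<in> A \<Longrightarrow> a \<le> u \<Longrightarrow> u < v \<Longrightarrow> v \<le> b \<Longrightarrow> \<gamma> ` {u..v} \<subseteq> fst c \<Longrightarrow> C1_curve A u v \<gamma> \<Longrightarrow> P u v"
  shows "P a b"
proof -
  define P' where "P' = (\<lambda>u v. a \<le> u \<longrightarrow> v \<le> b \<longrightarrow> P u v)"
  obtain S where S: "finite S" "\<And>u v. a \<le> u \<Longrightarrow> u < v \<Longrightarrow> v \<le> b \<Longrightarrow> {u<..<v} \<inter> S = {} \<Longrightarrow> C1_curve A u v \<gamma>"
    using piecewise_C1_curveE[OF pw] by metis
  note cont = piecewise_C1_continuous[OF pw]
  have "P' a b"
    using ab
  proof (induction rule: Bolzano)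
    case (trans u v w)
    show ?case
      unfolding P'_def
    proof (intro impI)
      assume ab: "a \<le> u" "w \<le> b"
      then have "P u v" "P v w" using trans unfolding P'_def by simp_all
      then show "P u w" using assms(3)[of u v w] ab trans(3,4) by blast
    qed
  next
    case (local x)
    obtain c where c: "c \<in> A" "\<gamma> x \<in> fst c" using chart_cover by blast
    obtain T where T: "open T" "T \<inter> {a..b} = \<gamma> -` fst c \<inter> {a..b}"
      using cont[unfolded continuous_on_open_invariant, rule_format, OF chart(1)[OF c(1)]] by blast
    have "x \<in> \<gamma> -` fst c \<inter> {a..b}" using c local by simp
    then have "x \<in> T" using T(2) by blast
    \<comment> \<open>The point \<open>x\<close> may itself be a break point. Short intervals around
      it are split at \<open>x\<close>, so only the other break points have to be avoided.\<close>
    moreover have "open (- (S - {x}))" by (intro open_Compl finite_imp_closed finite_Diff S(1))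
    ultimately have "open (T \<inter> - (S - {x}))" "x \<in> T \<inter> - (S - {x})"
      using open_Int[OF T(1)] by blast+
    then obtain d where d: "d > 0" "\<And>y. dist y x < d \<Longrightarrow> y \<in> T \<inter> - (S - {x})"
      unfolding open_dist by metis
    have pw: "P u v" if uv: "a \<le> u" "u \<le> v" "v \<le> b" and x: "u = x \<or> v = x" and near: "v - u < d" for u v
    proof (cases "u = v")
      case True
      then show ?thesis using refl by simp
    next
      case False
      then have "u < v" using uv by simp
      have near': "y \<in> T \<inter> - (S - {x})" if "y \<in> {u..v}" for y
        using d(2)[of y] that x near uv by (auto simp: dist_real_def)
      have "{u<..<v} \<inter> S = {}"
      proof (rule equals0I)
        fix y assume y: "y \<in> {u<..<v} \<inter> S"
        then have "y \<in> {u..v}" "y \<noteq> x" using x by auto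
        then show False using near'[of y] y by blast
      qed
      then have "C1_curve A u v \<gamma>" using S(2) \<open>u < v\<close> uv by blast
      moreover have "\<gamma> ` {u..v} \<subseteq> fst c"
      proof (rule image_subsetI)
        fix y assume y: "y \<in> {u..v}"
        then have "y \<in> T \<inter> {a..b}" using near'[OF y] uv by simp
        then show "\<gamma> y \<in> fst c" using T(2) by blast
      qed
      ultimately show ?thesis using assms(5) c \<open>u < v\<close> uv by blast
    qed
    show ?case
    proof (intro exI[of _ d] conjI allI impI)
      fix u v assume uv: "u \<le> x \<and> x \<le> v \<and> v - u < d"
      show "P' u v"
        unfolding P'_def
      proof (intro impI)
        assume ab: "a \<le> u" "v \<le> b"
        have "P u x" "P x v" using pw[of u x] pw[of x v] uv ab by auto
        then show "P u v" using assms(3) uv ab by blast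
      qed
    qed (rule d)
  qed
  then show ?thesis by (simp add: P'_def)
qed

lemma speed_integrable:
  assumes "piecewise_C1_curve A a b \<gamma>" "a \<le> b"
  shows "speed A g \<gamma> integrable_on {a..b}"
  using assms
proof (induction rule: piecewise_C1_induct)
  case (trans u v w)
  show ?case by (rule Henstock_Kurzweil_Integration.integrable_combine[OF trans(4,5,1,2)])
next
  case (refl u)
  then show ?case using integrable_on_refl[of "speed A g \<gamma>" u] by simp
next
  case (local c u v)
  then have in_c: "\<And>t. t \<in> {u..v} \<Longrightarrow> \<gamma> t \<in> fst c" by auto
  obtain \<gamma>' where \<gamma>'_ex: "continuous_on {u..v} \<gamma>' \<and>
    (\<forall>t\<in>{u..v}. ((snd c \<circ> \<gamma>) has_vector_derivative \<gamma>' t) (at t within {u..v}))"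
    using C1_curve_chartD[OF local(6,1) in_c] by (rule exE)
  note \<gamma>' = conjunct1[OF \<gamma>'_ex] bspec[OF conjunct2[OF \<gamma>'_ex]]
  note cont = C1_curve_continuous[OF local(6)]
  have "continuous_on {u..v} (\<lambda>t. sqrt (g c ((snd c \<circ> \<gamma>) t) (\<gamma>' t) (\<gamma>' t)))"
    using in_c
    by (intro continuous_intros continuous_on_metric[OF local(1)] \<gamma>' continuous_on_vector_derivative[OF \<gamma>'(2)]) auto
  then have "(\<lambda>t. sqrt (g c (snd c (\<gamma> t)) (\<gamma>' t) (\<gamma>' t))) integrable_on {u..v}"
    using integrable_continuous_real by (simp add: o_def)
  then obtain y where "((\<lambda>t. sqrt (g c (snd c (\<gamma> t)) (\<gamma>' t) (\<gamma>' t))) has_integral y) {u..v}" by blast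
  then have "(speed A g \<gamma> has_integral y) {u..v}"
    using has_integral_speed_C1[OF local(1) in_c cont \<gamma>'(2), of y] by blast
  then show ?case by blast
qed

lemma curve_length_nonneg: "0 \<le> curve_length A g a b \<gamma>"
  unfolding curve_length_def
  by (cases "speed A g \<gamma> integrable_on {a..b}")
    (auto simp: not_integrable_integral speed_nonneg intro: integral_nonneg)

text \<open>The number \<open>l\<close> is the length of some curve from \<open>p\<close> to
  \<open>q\<close>; the distance is the infimum of these numbers. Reversal and concatenation are
  treated for lengths of curves before the infimum is taken.\<close>

definition linked :: "'a \<Rightarrow> 'a \<Rightarrow> real \<Rightarrow> bool" where
  "linked p q l \<longleftrightarrow> (\<exists>a b \<gamma>. a < b \<and> piecewise_C1_curve A a b \<gamma> \<and> \<gamma> a = p \<and> \<gamma> b = q \<and> l = curve_length A g a b \<gamma>)"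

lemma linked_sym:
  assumes "linked p q l"
  shows "linked q p l"
proof -
  obtain a b \<gamma> where *: "a < b" "piecewise_C1_curve A a b \<gamma>" "\<gamma> a = p" "\<gamma> b = q" "l = curve_length A g a b \<gamma>"
    using assms unfolding linked_def by blast
  have "(speed A g \<gamma> has_integral l) {a..b}"
    using speed_integrable[OF *(2)] * by (simp add: curve_length_def integrable_integral)
  then have "((\<lambda>t. speed A g \<gamma> (- t)) has_integral l) {- b..- a}" by simp
  moreover have "(\<lambda>t. speed A g \<gamma> (- t)) = speed A g (\<lambda>t. \<gamma> (- t))"
    using speed_affine[of "-1" \<gamma> 0] by (simp add: fun_eq_iff)
  ultimately have "curve_length A g (- b) (- a) (\<lambda>t. \<gamma> (- t)) = l"
    by (simp add: curve_length_def integral_unique)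
  then show ?thesis
    unfolding linked_def using piecewise_C1_reflect[OF *(2)] *
    by (intro exI[of _ "- b"] exI[of _ "- a"] exI[of _ "\<lambda>t. \<gamma> (- t)"]) auto
qed

lemma linked_trans:
  assumes "linked p q l" "linked q r k"
  shows "linked p r (l + k)"
proof -
  obtain a b \<gamma>1 where 1: "a < b" "piecewise_C1_curve A a b \<gamma>1" "\<gamma>1 a = p" "\<gamma>1 b = q" "l = curve_length A g a b \<gamma>1"
    using assms(1) unfolding linked_def by blast
  obtain c d \<gamma>2 where 2: "c < d" "piecewise_C1_curve A c d \<gamma>2" "\<gamma>2 c = q" "\<gamma>2 d = r" "k = curve_length A g c d \<gamma>2"
    using assms(2) unfolding linked_def by blast
  define s where "s = c - b"
  define h where "h = (\<lambda>t. \<gamma>2 (t + s))"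
  define j where "j = (\<lambda>t. if t \<le> b then \<gamma>1 t else h t)"
  have ph: "piecewise_C1_curve A b (d - s) h"
    using piecewise_C1_shift[OF 2(2), of s] by (simp add: s_def h_def)
  have bd: "b < d - s" using 2 by (simp add: s_def)
  have pj: "piecewise_C1_curve A a (d - s) j"
    unfolding j_def using 1 2 bd by (intro piecewise_C1_join ph) (auto simp: h_def s_def)
  have "(speed A g \<gamma>2 has_integral k) (cbox c d)"
    using speed_integrable[OF 2(2)] 2 by (simp add: curve_length_def integrable_integral)
  from has_integral_affinity'[OF this, of 1 s]
  have "((\<lambda>t. speed A g \<gamma>2 (t + s)) has_integral k) {b..d - s}" by (simp add: s_def)
  then have h2: "(speed A g h has_integral k) {b..d - s}"
  proof (rule has_integral_eq[rotated])
    show "speed A g \<gamma>2 (t + s) = speed A g h t" for t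
      using speed_affine[of 1 \<gamma>2 s t] by (simp add: h_def)
  qed
  have h1: "(speed A g \<gamma>1 has_integral l) {a..b}"
    using speed_integrable[OF 1(2)] 1 by (simp add: curve_length_def integrable_integral)
  \<comment> \<open>The speed is local, so it is unchanged off the joint; at the joint itself the
    two-sided derivative may fail to exist.\<close>
  have "(speed A g j has_integral l) {a..b}"
  proof (rule has_integral_spike_finite[OF _ _ h1])
    fix t assume "t \<in> {a..b} - {b}"
    then show "speed A g j t = speed A g \<gamma>1 t" by (intro speed_cong_open[of "{..<b}"]) (auto simp: j_def)
  qed simp
  moreover have "(speed A g j has_integral k) {b..d - s}"
  proof (rule has_integral_spike_finite[OF _ _ h2])
    fix t assume "t \<in> {b..d - s} - {b}"
    then show "speed A g j t = speed A g h t" by (intro speed_cong_open[of "{b<..}"]) (auto simp: j_def)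
  qed simp
  ultimately have "(speed A g j has_integral (l + k)) {a..d - s}"
    using has_integral_combine[of a b "d - s"] 1 bd by simp
  then have "curve_length A g a (d - s) j = l + k" by (simp add: curve_length_def integral_unique)
  then show ?thesis
    unfolding linked_def using pj 1 2 bd
    by (intro exI[of _ a] exI[of _ "d - s"] exI[of _ j]) (auto simp: j_def h_def s_def)
qed

lemma linked_chart:
  assumes c: "c \<in> A" and x: "\<And>t. t \<in> {0..1} \<Longrightarrow> x t \<in> snd c ` fst c"
    and dx: "\<And>t. t \<in> {0..1} \<Longrightarrow> (x has_vector_derivative v t) (at t within {0..1})"
    and cv: "continuous_on {0..1} v"
    and l: "\<And>t. t \<in> {0..1} \<Longrightarrow> sqrt (g c (x t) (v t) (v t)) = l"
  shows "linked (chart_inv c (x 0)) (chart_inv c (x 1)) l"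
proof -
  define \<gamma> where "\<gamma> = (\<lambda>t. chart_inv c (x t))"
  have \<gamma>: "\<gamma> t \<in> fst c" "(snd c \<circ> \<gamma>) t = x t" if "t \<in> {0..1}" for t
    using chart_inv_in[OF c x[OF that]] chart_inv_right[OF c x[OF that]] by (auto simp: \<gamma>_def)
  have d: "((snd c \<circ> \<gamma>) has_vector_derivative v t) (at t within {0..1})" if t: "t \<in> {0..1}" for t
    using has_vector_derivative_transform[OF t \<gamma>(2) dx[OF t]] .
  have C1: "C1_curve A 0 1 \<gamma>" by (rule C1_curveI_chart[OF c \<gamma>(1) d cv])
  then have cont: "continuous_on {0..1} \<gamma>" by (rule C1_curve_continuous)
  have "piecewise_C1_curve A 0 1 \<gamma>"
    unfolding piecewise_C1_curve_def using cont C1_curve_subinterval[OF C1] by blast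
  moreover have "((\<lambda>t. sqrt (g c (snd c (\<gamma> t)) (v t) (v t))) has_integral l) {0..1}"
  proof -
    have "((\<lambda>t::real. l) has_integral l) {0..1}" using has_integral_const_real[of l 0 1] by simp
    then show ?thesis
      by (rule has_integral_cong[THEN iffD1, rotated]) (use l \<gamma>(2) in auto)
  qed
  then have "curve_length A g 0 1 \<gamma> = l"
    using has_integral_speed_C1[OF c \<gamma>(1) cont d] by (simp add: curve_length_def integral_unique)
  ultimately show ?thesis
    unfolding linked_def by (intro exI[of _ 0] exI[of _ 1] exI[of _ \<gamma>]) (auto simp: \<gamma>_def)
qed

lemma linked_self: "linked p p 0"
proof -
  obtain c where c: "c \<in> A" "p \<in> fst c" using chart_cover by blast
  have "g c (snd c p) 0 0 = 0" using bilinear_lzero[OF metric(1)[OF c(1)]] c by blast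
  then show ?thesis
    using linked_chart[OF c(1), of "\<lambda>_. snd c p" "\<lambda>_. 0" 0] c chart_inv_left by auto
qed

end

section \<open>The Riemannian distance in a normal chart\<close>

context riemannian
begin

abbreviation "d \<equiv> riem_dist A g"

lemma linked_nonneg: "linked p q l \<Longrightarrow> 0 \<le> l"
  using curve_length_nonneg unfolding linked_def by blast

lemma riem_dist_linked: "riem_dist A g p q = Inf {l. linked p q l}"
proof -
  have "{curve_length A g a b \<gamma> |a b \<gamma>. a < b \<and> piecewise_C1_curve A a b \<gamma> \<and> \<gamma> a = p \<and> \<gamma> b = q} = {l. linked p q l}"
    unfolding linked_def by blast
  then show ?thesis unfolding riem_dist_def by (rule arg_cong)
qed

lemma riem_dist_le: "linked p q l \<Longrightarrow> riem_dist A g p q \<le> l"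
  unfolding riem_dist_linked by (rule cInf_lower) (auto intro!: bdd_belowI[of _ 0] linked_nonneg)

end

section \<open>Comparison of the lengths of arbitrary curves with \<open>\<rho>\<close>\<close>

locale riemannian_chart = riemannian A g +
    geodesic_domain "snd c p" R K "g c" "riemannian.dmetric g c" "riemannian.acc g c"
  for A :: "('a::{t2_space,second_countable_topology}, 'e::euclidean_space) chart set"
    and g :: "('a, 'e) metric_tensor" and c :: "('a, 'e) chart" and p :: 'a and R K :: real +
  assumes cA: "c \<in> A" and pc: "p \<in> fst c" and ball_chart: "ball (snd c p) R \<subseteq> snd c ` fst c"
begin

abbreviation "x0 \<equiv> snd c p"
abbreviation "iv \<equiv> chart_inv c"

lemma iv_x0: "iv x0 = p"
  using chart_inv_left[OF cA pc] .

lemma iv_in: "x \<in> ball x0 R \<Longrightarrow> iv x \<in> fst c" and iv_right: "x \<in> ball x0 R \<Longrightarrow> snd c (iv x) = x"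
  using chart_inv_in[OF cA] chart_inv_right[OF cA] ball_chart by blast+

lemma continuous_on_iv: "S \<subseteq> ball x0 R \<Longrightarrow> continuous_on S iv"
  by (rule continuous_on_subset[OF homeomorphism_cont2[OF chart(3)[OF cA]]]) (use ball_chart in blast)

lemma open_iv:
  assumes "open S" "S \<subseteq> ball x0 R"
  shows "open (iv ` S)"
proof -
  have "openin (top_of_set (fst c)) (iv ` S)"
  proof (rule homeomorphism_imp_open_map[OF homeomorphism_symD[OF chart(3)[OF cA]]])
    show "openin (top_of_set (snd c ` fst c)) S"
      using assms ball_chart by (intro open_subset) auto
  qed
  then show ?thesis using openin_open_trans chart(1)[OF cA] by blast
qed

lemma linked_rho:
  assumes "a \<in> N1" "b \<in> N1"
  shows "linked (iv a) (iv b) (\<rho> a b)"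
proof -
  note P = path_sol[OF assms]
  have "linked (iv (gpath a b 0)) (iv (gpath a b 1)) (\<rho> a b)"
  proof (rule linked_chart[OF cA, of _ "vel a b"])
    fix t :: real assume t: "t \<in> {0..1}"
    show "gpath a b t \<in> snd c ` fst c" using is_solD(1)[OF P(1) t] ball_chart by blast
    show "(gpath a b has_vector_derivative vel a b t) (at t within {0..1})" by (rule is_solD(3)[OF P(1) t])
    show "sqrt (g c (gpath a b t) (vel a b t) (vel a b t)) = \<rho> a b"
      using En_speed[OF assms t] by (simp add: \<rho>_def)
  next
    show "continuous_on {0..1} (vel a b)"
      by (rule continuous_on_vector_derivative[OF is_solD(4)[OF P(1)]])
  qed
  then show ?thesis using P by simp
qed

text \<open>\<open>rho_le_length\<close> applies to each piece that is continuously differentiable,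
  and both sides are additive. Integrability belongs to the induction predicate because additivity
  of the integral depends on it.\<close>

lemma length_ge_rho:
  assumes pw: "piecewise_C1_curve A \<alpha> \<beta> \<gamma>" and "\<alpha> \<le> \<beta>" and img: "\<gamma> ` {\<alpha>..\<beta>} \<subseteq> iv ` N1" and a: "a \<in> N1"
  shows "\<rho> a (snd c (\<gamma> \<beta>)) \<le> \<rho> a (snd c (\<gamma> \<alpha>)) + curve_length A g \<alpha> \<beta> \<gamma>"
proof -
  define P where "P = (\<lambda>u v. speed A g \<gamma> integrable_on {u..v} \<and>
    \<rho> a (snd c (\<gamma> v)) \<le> \<rho> a (snd c (\<gamma> u)) + integral {u..v} (speed A g \<gamma>))"
  have mem: "\<gamma> t \<in> fst c" "snd c (\<gamma> t) \<in> N1" if t: "t \<in> {\<alpha>..\<beta>}" for t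
  proof -
    have "\<gamma> t \<in> iv ` N1" using img t by (rule subsetD[OF _ imageI])
    then obtain x where "x \<in> N1" "\<gamma> t = iv x" by (rule imageE)
    then show "\<gamma> t \<in> fst c" "snd c (\<gamma> t) \<in> N1" using iv_in iv_right N1_B by simp_all
  qed
  have "P \<alpha> \<beta>"
    using pw \<open>\<alpha> \<le> \<beta>\<close>
  proof (induction rule: piecewise_C1_induct)
    case (trans u v w)
    have i: "speed A g \<gamma> integrable_on {u..v}" "speed A g \<gamma> integrable_on {v..w}"
      using trans(1,2) by (simp_all add: P_def)
    have int: "speed A g \<gamma> integrable_on {u..w}"
      by (rule Henstock_Kurzweil_Integration.integrable_combine[OF trans(4,5) i])
    have "integral {u..v} (speed A g \<gamma>) + integral {v..w} (speed A g \<gamma>) = integral {u..w} (speed A g \<gamma>)"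
      by (rule Henstock_Kurzweil_Integration.integral_combine[OF trans(4,5) int])
    then show ?case using trans(1,2) int by (simp add: P_def)
  next
    case (refl u)
    then show ?case using integrable_on_refl[of "speed A g \<gamma>" u] by (simp add: P_def)
  next
    case (local e u v)
    have sub: "t \<in> {\<alpha>..\<beta>}" if "t \<in> {u..v}" for t using that local by simp
    have in_c: "\<And>t. t \<in> {u..v} \<Longrightarrow> \<gamma> t \<in> fst c" using mem(1)[OF sub] .
    obtain \<gamma>' where \<gamma>'_ex: "continuous_on {u..v} \<gamma>' \<and>
      (\<forall>t\<in>{u..v}. ((snd c \<circ> \<gamma>) has_vector_derivative \<gamma>' t) (at t within {u..v}))"
      using C1_curve_chartD[OF local(6) cA in_c] by blast
    note \<gamma>' = conjunct1[OF \<gamma>'_ex] bspec[OF conjunct2[OF \<gamma>'_ex]]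
    note cont = C1_curve_continuous[OF local(6)]
    have int: "speed A g \<gamma> integrable_on {u..v}"
      using speed_integrable[OF pw \<open>\<alpha> \<le> \<beta>\<close>] local by (auto intro: integrable_on_subinterval)
    then have "(speed A g \<gamma> has_integral integral {u..v} (speed A g \<gamma>)) {u..v}"
      by (rule integrable_integral)
    then have "((\<lambda>t. sqrt (g c ((snd c \<circ> \<gamma>) t) (\<gamma>' t) (\<gamma>' t))) has_integral integral {u..v} (speed A g \<gamma>)) {u..v}"
      using has_integral_speed_C1[OF cA in_c cont \<gamma>'(2), of "integral {u..v} (speed A g \<gamma>)"] by (simp add: o_def)
    from rho_le_length[OF a _ _ \<gamma>'(2) this] have "\<rho> a ((snd c \<circ> \<gamma>) v) \<le> \<rho> a ((snd c \<circ> \<gamma>) u) + integral {u..v} (speed A g \<gamma>)"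
      using local(3) mem(2)[OF sub] by simp
    then show ?case using int by (simp add: P_def)
  qed
  then show ?thesis by (simp add: P_def curve_length_def)
qed

text \<open>A curve may leave the chart domain, where the coordinate map has no meaning. The exit
  time is therefore defined in the manifold, as the first time outside the image of the open
  ball.\<close>

lemma exit_or_stay:
  assumes cont: "continuous_on {\<alpha>..\<beta>::real} \<gamma>" and ab: "\<alpha> \<le> \<beta>" and r: "r < R"
    and start: "\<gamma> \<alpha> \<in> iv ` ball x0 r"
  obtains "\<gamma> ` {\<alpha>..\<beta>} \<subseteq> iv ` cball x0 r"
  | \<tau> where "\<tau> \<in> {\<alpha>..\<beta>}" "\<gamma> ` {\<alpha>..\<tau>} \<subseteq> iv ` cball x0 r" "norm (snd c (\<gamma> \<tau>) - x0) = r"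
proof -
  define W where "W = iv ` ball x0 r"
  have sub: "ball x0 r \<subseteq> ball x0 R" "cball x0 r \<subseteq> ball x0 R" using r by auto
  have oW: "open W" unfolding W_def by (rule open_iv[OF open_ball sub(1)])
  have WZ: "W \<subseteq> iv ` cball x0 r" unfolding W_def by (rule image_mono) auto
  define T where "T = {\<alpha>..\<beta>} \<inter> \<gamma> -` (- W)"
  have clT: "closed T" unfolding T_def
    by (rule continuous_closed_preimage[OF cont]) (use oW in auto)
  show ?thesis
  proof (cases "T = {}")
    case True
    then have "\<gamma> ` {\<alpha>..\<beta>} \<subseteq> W" by (auto simp: T_def)
    then show ?thesis using that(1) WZ by blast
  next
    case False
    define \<tau> where "\<tau> = Inf T"
    have bdd: "bdd_below T" by (rule bdd_belowI[of _ \<alpha>]) (auto simp: T_def)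
    have \<tau>T: "\<tau> \<in> T" unfolding \<tau>_def by (rule closed_contains_Inf[OF False bdd clT])
    then have \<tau>: "\<tau> \<in> {\<alpha>..\<beta>}" "\<gamma> \<tau> \<notin> W" by (auto simp: T_def)
    have "\<tau> \<noteq> \<alpha>" using \<tau>(2) start by (auto simp: W_def)
    then have lt: "\<alpha> < \<tau>" using \<tau>(1) by simp
    have before: "\<gamma> t \<in> W" if "t \<in> {\<alpha>..<\<tau>}" for t
    proof (rule ccontr)
      assume "\<gamma> t \<notin> W"
      then have "t \<in> T" using that \<tau>(1) by (auto simp: T_def)
      then have "\<tau> \<le> t" unfolding \<tau>_def by (rule cInf_lower[OF _ bdd])
      then show False using that by simp
    qed
    \<comment> \<open>Compact in a Hausdorff space, hence closed in the whole manifold. The curve is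
      thus still in the chart domain at time \<open>\<tau>\<close>.\<close>
    have "closed (iv ` cball x0 r)"
      by (intro compact_imp_closed compact_continuous_image compact_cball continuous_on_iv sub(2))
    then have clZ: "closed ({\<alpha>..\<beta>} \<inter> \<gamma> -` (iv ` cball x0 r))"
      by (intro continuous_closed_preimage[OF cont]) auto
    have "{\<alpha>..<\<tau>} \<subseteq> {\<alpha>..\<beta>} \<inter> \<gamma> -` (iv ` cball x0 r)"
      using before WZ \<tau>(1) by fastforce
    then have "closure {\<alpha>..<\<tau>} \<subseteq> {\<alpha>..\<beta>} \<inter> \<gamma> -` (iv ` cball x0 r)"
      using clZ closure_minimal by blast
    then have img: "\<gamma> ` {\<alpha>..\<tau>} \<subseteq> iv ` cball x0 r"
      using lt closure_atLeastLessThan[OF lt] by blast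
    have "\<gamma> \<tau> \<in> iv ` cball x0 r" by (rule subsetD[OF img imageI]) (use lt in simp)
    then obtain y where y: "\<gamma> \<tau> = iv y" "y \<in> cball x0 r" by (rule imageE)
    then have "snd c (\<gamma> \<tau>) = y" using iv_right sub by auto
    moreover have "y \<notin> ball x0 r" using \<tau>(2) y by (auto simp: W_def)
    ultimately have "norm (snd c (\<gamma> \<tau>) - x0) = r" using y by (auto simp: dist_norm norm_minus_commute)
    then show ?thesis using that(2) \<tau>(1) img by blast
  qed
qed

text \<open>Half the radius of \<open>N1\<close>, so that the closed ball is contained in
  \<open>N1\<close>.\<close>

definition "rad = \<epsilon> / 8"

lemma rad: "0 < rad" "rad < \<epsilon> / 4" "rad < R" "cball x0 rad \<subseteq> N1"
proof -
  show "0 < rad" "rad < \<epsilon> / 4" using eps_pos by (auto simp: rad_def)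
  then show "cball x0 rad \<subseteq> N1" by (auto simp: N1_def)
  show "rad < R" using eps_R eps_pos R_pos by (simp add: rad_def)
qed

text \<open>Either the curve stays in the chart and \<open>length_ge_rho\<close> applies to all of
  it, or its initial part reaches the sphere of radius \<open>rad\<close>; the length of that part
  is then at least the coordinate distance to the sphere divided by \<open>2 * K\<close>.\<close>

lemma linked_lower:
  assumes l: "linked (iv a) q l" and a: "a \<in> ball x0 rad"
  shows "(\<exists>b\<in>cball x0 rad. q = iv b \<and> \<rho> a b \<le> l) \<or> rad - norm (a - x0) \<le> 2 * K * l"
proof -
  obtain \<alpha> \<beta> \<gamma> where \<gamma>: "\<alpha> < \<beta>" "piecewise_C1_curve A \<alpha> \<beta> \<gamma>" "\<gamma> \<alpha> = iv a" "\<gamma> \<beta> = q" "l = curve_length A g \<alpha> \<beta> \<gamma>"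
    using l unfolding linked_def by blast
  have aN: "a \<in> N1" using a rad(4) by auto
  have aB: "snd c (iv a) = a" using iv_right[OF N1_B[OF aN]] .
  have Z: "iv ` cball x0 rad \<subseteq> iv ` N1" by (rule image_mono[OF rad(4)])
  have raa: "\<rho> a a = 0" using rho_eq0[OF aN aN] by simp
  show ?thesis
  proof (rule exit_or_stay[OF piecewise_C1_continuous[OF \<gamma>(2)] less_imp_le[OF \<gamma>(1)] rad(3)])
    show "\<gamma> \<alpha> \<in> iv ` ball x0 rad" using a \<gamma>(3) by simp
  next
    assume stay: "\<gamma> ` {\<alpha>..\<beta>} \<subseteq> iv ` cball x0 rad"
    then have "\<gamma> ` {\<alpha>..\<beta>} \<subseteq> iv ` N1" using Z by (rule subset_trans)
    from length_ge_rho[OF \<gamma>(2) less_imp_le[OF \<gamma>(1)] this aN]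
    have len: "\<rho> a (snd c q) \<le> l" using \<gamma>(3,4,5) aB raa by simp
    have "q \<in> iv ` cball x0 rad" using stay \<gamma>(1,4) by force
    then obtain b where b: "b \<in> cball x0 rad" "q = iv b" by (rule imageE)
    then have "snd c q = b" using iv_right N1_B rad(4) by blast
    then show ?thesis using b len by blast
  next
    fix \<tau> assume \<tau>: "\<tau> \<in> {\<alpha>..\<beta>}" and img: "\<gamma> ` {\<alpha>..\<tau>} \<subseteq> iv ` cball x0 rad"
      and n: "norm (snd c (\<gamma> \<tau>) - x0) = rad"
    define y where "y = snd c (\<gamma> \<tau>)"
    have y: "y \<in> N1" using n rad(4) by (auto simp: y_def dist_norm norm_minus_commute)
    have pw: "piecewise_C1_curve A \<alpha> \<tau> \<gamma>"
      by (rule piecewise_C1_subinterval[OF \<gamma>(2)]) (use \<tau> in auto)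
    have \<alpha>\<tau>: "\<alpha> \<le> \<tau>" using \<tau> by simp
    have "\<gamma> ` {\<alpha>..\<tau>} \<subseteq> iv ` N1" using img Z by (rule subset_trans)
    from length_ge_rho[OF pw \<alpha>\<tau> this aN]
    have "\<rho> a y \<le> curve_length A g \<alpha> \<tau> \<gamma>" using \<gamma>(3) aB raa by (simp add: y_def)
    also have "\<dots> \<le> l"
    proof -
      have int: "speed A g \<gamma> integrable_on {\<alpha>..\<beta>}" by (rule speed_integrable[OF \<gamma>(2) less_imp_le[OF \<gamma>(1)]])
      have "curve_length A g \<alpha> \<tau> \<gamma> + curve_length A g \<tau> \<beta> \<gamma> = l"
        unfolding \<gamma>(5) curve_length_def
        by (rule Henstock_Kurzweil_Integration.integral_combine[OF _ _ int]) (use \<tau> in auto)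
      then show ?thesis using curve_length_nonneg[of \<tau> \<beta> \<gamma>] by linarith
    qed
    finally have "2 * K * \<rho> a y \<le> 2 * K * l" using K_ge1 by simp
    then have "norm (y - a) \<le> 2 * K * l" using rho_lower[OF aN y] by simp
    moreover have "rad \<le> norm (y - a) + norm (a - x0)"
      using norm_triangle_ineq[of "y - a" "a - x0"] n by (simp add: y_def)
    ultimately show ?thesis by linarith
  qed
qed

text \<open>With this radius, the length \<open>\<rho> a b \<le> 4 K r3\<close> between two points of \<open>N3\<close> is less than the length
  of any curve from \<open>N3\<close> to the sphere of radius \<open>rad\<close>.\<close>

definition "r3 = rad / (2 + 8 * K\<^sup>2)"
definition "N3 = ball x0 r3"

lemma r3: "0 < r3" "r3 < rad" "r3 + 8 * K\<^sup>2 * r3 < rad" "r3 \<le> \<epsilon> / 20"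
proof -
  have K2: "1 \<le> K\<^sup>2" using K_ge1 by simp
  then have p: "0 < 2 + 8 * K\<^sup>2" by simp
  show r0: "0 < r3" using p rad(1) by (simp add: r3_def)
  have "r3 * (2 + 8 * K\<^sup>2) = rad" using p by (simp add: r3_def)
  then have e: "2 * r3 + 8 * K\<^sup>2 * r3 = rad" by (simp add: algebra_simps)
  then show "r3 + 8 * K\<^sup>2 * r3 < rad" using r0 by simp
  have k: "1 * r3 \<le> K\<^sup>2 * r3" using K2 r0 by (intro mult_right_mono) auto
  then show "r3 < rad" using e r0 by linarith
  have "10 * r3 \<le> rad" using e k by linarith
  then show "r3 \<le> \<epsilon> / 20" using eps_pos by (simp add: rad_def)
qed

lemma N3_N2: "a \<in> N3 \<Longrightarrow> a \<in> N2" and N3_rad: "a \<in> N3 \<Longrightarrow> a \<in> ball x0 rad" and x0_N3: "x0 \<in> N3"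
  and open_N3: "open N3" and N3_norm: "a \<in> N3 \<longleftrightarrow> norm (a - x0) < r3"
  using r3 by (auto simp: N3_def N2_def dist_norm norm_minus_commute)

lemma N3_N1: "a \<in> N3 \<Longrightarrow> a \<in> N1"
  using N3_N2 N2_N1 by blast

lemma N3_B: "a \<in> N3 \<Longrightarrow> a \<in> ball x0 R"
  using N3_N1 N1_B by blast

lemma iv_inj: "a \<in> ball x0 R \<Longrightarrow> b \<in> ball x0 R \<Longrightarrow> iv a = iv b \<Longrightarrow> a = b"
  using iv_right by metis

end

section \<open>The distance on a connected manifold\<close>

locale riemannian_connected = riemannian A g
  for A :: "('a::{t2_space,second_countable_topology}, 'e::euclidean_space) chart set"
    and g :: "('a, 'e) metric_tensor" +
  assumes conn: "connected (UNIV :: 'a set)"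
begin

lemma riemannian_chart_exists:
  assumes "c \<in> A" "p \<in> fst c"
  obtains R K where "riemannian_chart A g c p R K"
proof -
  obtain R K where RK: "geodesic_domain (snd c p) R K (g c) (dmetric c) (acc c)" "ball (snd c p) R \<subseteq> snd c ` fst c"
    by (rule geodesic_domain_exists[OF assms])
  have "riemannian_chart A g c p R K"
    by (intro riemannian_chart.intro riemannian_chart_axioms.intro riemannian_axioms RK assms)
  then show ?thesis using that by blast
qed

lemma linked_near: "\<exists>T. open T \<and> p \<in> T \<and> (\<forall>q\<in>T. \<exists>l. linked p q l)"
proof -
  obtain c where c: "c \<in> A" "p \<in> fst c" using chart_cover by blast
  obtain R K where "riemannian_chart A g c p R K" by (rule riemannian_chart_exists[OF c])
  then interpret N: riemannian_chart A g c p R K .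
  show ?thesis
  proof (intro exI[of _ "N.iv ` N.N3"] conjI ballI)
    show "open (N.iv ` N.N3)" by (rule N.open_iv[OF N.open_N3]) (use N.N3_B in blast)
    show "p \<in> N.iv ` N.N3" using imageI[OF N.x0_N3, of N.iv] N.iv_x0 by simp
    fix q assume "q \<in> N.iv ` N.N3"
    then obtain b where "b \<in> N.N3" "q = N.iv b" by (rule imageE)
    then show "\<exists>l. linked p q l" using N.linked_rho[OF N.x0_N1 N.N3_N1, of b] N.iv_x0 by auto
  qed
qed

text \<open>Being linked is an equivalence relation with open classes. The infimum defining the
  distance is thus taken over a nonempty set, without which lower bounds for it could not be
  derived.\<close>

lemma linked_ex: "\<exists>l. linked p q l"
proof (rule connected_equivalence_relation[OF conn, of p q "\<lambda>p q. \<exists>l. linked p q l"])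
  show "\<exists>T. openin (top_of_set UNIV) T \<and> a \<in> T \<and> (\<forall>x\<in>T. \<exists>l. linked a x l)" for a
    using linked_near[of a] by simp
  show "\<exists>l. linked y x l" if "\<exists>l. linked x y l" for x y
    using that by (elim exE) (rule exI, rule linked_sym)
  show "\<exists>l. linked x z l" if "\<exists>l. linked x y l" "\<exists>l. linked y z l" for x y z
    using that by (elim exE) (rule exI, rule linked_trans)
qed simp_all

lemma d_greatest: "(\<And>l. linked p q l \<Longrightarrow> m \<le> l) \<Longrightarrow> m \<le> d p q"
  unfolding riem_dist_linked by (rule cInf_greatest) (use linked_ex in auto)

lemma d_approx:
  assumes "d p q < e"
  shows "\<exists>l. linked p q l \<and> l < e"
proof (rule ccontr)
  assume "\<not> (\<exists>l. linked p q l \<and> l < e)"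
  then have "\<And>l. linked p q l \<Longrightarrow> e \<le> l" by (meson not_le)
  then have "e \<le> d p q" by (rule d_greatest)
  then show False using assms by simp
qed

lemma d_nonneg: "0 \<le> d p q"
  by (rule d_greatest) (rule linked_nonneg)

lemma d_self: "d p p = 0"
  using riem_dist_le[OF linked_self, of p] d_nonneg[of p p] by simp

lemma d_sym: "d p q = d q p"
proof -
  have "d p q \<le> d q p" for p q
    by (rule d_greatest) (erule riem_dist_le[OF linked_sym])
  then show ?thesis by (intro order_antisym)
qed

lemma d_triangle: "d p r \<le> d p q + d q r"
proof (rule field_le_epsilon)
  fix e :: real assume e: "0 < e"
  obtain l where l: "linked p q l" "l < d p q + e / 2" using d_approx[of p q "d p q + e / 2"] e by auto
  obtain k where k: "linked q r k" "k < d q r + e / 2" using d_approx[of q r "d q r + e / 2"] e by auto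
  show "d p r \<le> d p q + d q r + e" using riem_dist_le[OF linked_trans[OF l(1) k(1)]] l k by simp
qed

end

section \<open>The distance near the centre of a chart ball\<close>

locale normal_chart = riemannian_chart A g c p R K + riemannian_connected A g
  for A :: "('a::{t2_space,second_countable_topology}, 'e::euclidean_space) chart set"
    and g :: "('a, 'e) metric_tensor" and c :: "('a, 'e) chart" and p :: 'a and R K :: real
begin

text \<open>The solution itself is a competitor for the infimum. Conversely, a curve that leaves the
  chart ball satisfies \<open>2 * K * \<rho> a b \<le> 8 * K^2 * r3 \<le> 2 * K * l\<close>, so it
  is no shorter than the solution.\<close>

lemma d_eq_rho:
  assumes a: "a \<in> N3" and b: "b \<in> N3"
  shows "riem_dist A g (iv a) (iv b) = \<rho> a b"
proof (rule order_antisym)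
  show "riem_dist A g (iv a) (iv b) \<le> \<rho> a b" by (rule riem_dist_le[OF linked_rho[OF N3_N1[OF a] N3_N1[OF b]]])
  show "\<rho> a b \<le> riem_dist A g (iv a) (iv b)"
  proof (rule d_greatest)
    fix l assume l: "linked (iv a) (iv b) l"
    from linked_lower[OF l N3_rad[OF a]] show "\<rho> a b \<le> l"
    proof
      assume "\<exists>b'\<in>cball x0 rad. iv b = iv b' \<and> \<rho> a b' \<le> l"
      then obtain b' where b': "b' \<in> cball x0 rad" "iv b = iv b'" "\<rho> a b' \<le> l" by blast
      have "b = b'" by (rule iv_inj[OF N3_B[OF b] N1_B b'(2)]) (use b' rad(4) in blast)
      then show ?thesis using b' by simp
    next
      assume far: "rad - norm (a - x0) \<le> 2 * K * l"
      have na: "norm (a - x0) < r3" "norm (b - x0) < r3" using a b N3_norm by auto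
      have "norm (b - a) \<le> norm (b - x0) + norm (a - x0)"
        using norm_triangle_ineq4[of "b - x0" "a - x0"] by simp
      then have "norm (b - a) \<le> 2 * r3" using na by simp
      then have "2 * K * \<rho> a b \<le> 2 * K * (2 * K * (2 * r3))"
        using rho_upper[OF N3_N1[OF a] N3_N1[OF b]] K_ge1
        by (intro mult_left_mono) (auto intro: order_trans mult_left_mono)
      also have "\<dots> = 8 * K\<^sup>2 * r3" by (simp add: power2_eq_square)
      also have "\<dots> \<le> 2 * K * l" using far na r3(3) by linarith
      finally show ?thesis using K_ge1 by simp
    qed
  qed
qed

definition "s3 = r3 / (2 * K)"

lemma s3_pos: "0 < s3"
  using r3 K_ge1 by (simp add: s3_def)

text \<open>By the choice of \<open>s3\<close>, a curve of length \<open>l < s3\<close> satisfies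
  \<open>2 * K * l < r3 < rad\<close>. It cannot reach the sphere of radius \<open>rad\<close>, and
  its end point has coordinates within \<open>r3\<close> of the centre.\<close>

lemma near_N3:
  assumes "riem_dist A g p q < s3"
  obtains b where "b \<in> N3" "q = iv b" "\<rho> x0 b = riem_dist A g p q"
proof -
  obtain l where l: "linked p q l" "l < s3" using d_approx[OF assms] by blast
  have Kl: "2 * K * l < r3" using l(2) K_ge1 by (simp add: s3_def field_simps)
  have "linked (iv x0) q l" using l iv_x0 by simp
  then have "(\<exists>b\<in>cball x0 rad. q = iv b \<and> \<rho> x0 b \<le> l) \<or> rad - norm (x0 - x0) \<le> 2 * K * l"
    by (rule linked_lower) (use rad in simp)
  then obtain b where b: "b \<in> cball x0 rad" "q = iv b" "\<rho> x0 b \<le> l" using Kl r3(2) by auto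
  have bN1: "b \<in> N1" using b rad(4) by blast
  have "norm (b - x0) \<le> 2 * K * \<rho> x0 b" by (rule rho_lower[OF x0_N1 bN1])
  also have "\<dots> \<le> 2 * K * l" using b K_ge1 by simp
  finally have "b \<in> N3" using Kl by (simp add: N3_norm)
  then show ?thesis using that[of b] b d_eq_rho[OF x0_N3] iv_x0 by simp
qed

lemma near_norm: "b \<in> N3 \<Longrightarrow> norm (b - x0) \<le> 2 * K * riem_dist A g p (iv b)"
  using rho_lower[OF x0_N1 N3_N1] d_eq_rho[OF x0_N3] iv_x0 by simp

end

section \<open>Agreement of the distance with the manifold topology\<close>

context riemannian_connected
begin

lemma normal_chart_exists:
  assumes "c \<in> A" "p \<in> fst c"
  obtains R K where "normal_chart A g c p R K"
proof -
  obtain R K where "riemannian_chart A g c p R K" by (rule riemannian_chart_exists[OF assms])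
  then have "normal_chart A g c p R K" by (intro normal_chart.intro riemannian_connected_axioms)
  then show ?thesis using that by blast
qed

text \<open>Near the centre of a chart the distance to the centre and the coordinate norm are
  equivalent with the factor \<open>2 * K\<close>; both implications shrink a ball of one kind into
  one of the other.\<close>

lemma open_iff_d: "open U \<longleftrightarrow> (\<forall>p\<in>U. \<exists>e>0. \<forall>q. d p q < e \<longrightarrow> q \<in> U)"
proof (intro iffI ballI)
  fix p assume U: "open U" "p \<in> U"
  obtain c where c: "c \<in> A" "p \<in> fst c" using chart_cover by blast
  obtain R K where "normal_chart A g c p R K" by (rule normal_chart_exists[OF c])
  then interpret N: normal_chart A g c p R K .
  have cont: "continuous_on N.N3 N.iv" by (rule N.continuous_on_iv) (use N.N3_B in blast)
  have "open (N.N3 \<inter> N.iv -` U)" by (rule continuous_open_preimage[OF cont N.open_N3 U(1)])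
  moreover have "N.x0 \<in> N.N3 \<inter> N.iv -` U" using N.x0_N3 N.iv_x0 U(2) by simp
  ultimately obtain \<delta> where \<delta>: "0 < \<delta>" "ball N.x0 \<delta> \<subseteq> N.N3 \<inter> N.iv -` U"
    by (rule openE)
  have K1: "1 \<le> K" by (rule N.K_ge1)
  show "\<exists>e>0. \<forall>q. d p q < e \<longrightarrow> q \<in> U"
  proof (intro exI[of _ "min N.s3 (\<delta> / (2 * K))"] conjI allI impI)
    show "0 < min N.s3 (\<delta> / (2 * K))" using N.s3_pos \<delta> K1 by simp
    fix q assume q: "d p q < min N.s3 (\<delta> / (2 * K))"
    obtain b where b: "b \<in> N.N3" "q = N.iv b" using N.near_N3[of q] q by auto
    have "norm (b - N.x0) \<le> 2 * K * d p q" using N.near_norm[OF b(1)] b(2) by simp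
    also have "\<dots> < \<delta>" using q K1 by (simp add: field_simps)
    finally have "b \<in> ball N.x0 \<delta>" by (simp add: dist_norm norm_minus_commute)
    then show "q \<in> U" using \<delta> b by blast
  qed
next
  assume U: "\<forall>p\<in>U. \<exists>e>0. \<forall>q. d p q < e \<longrightarrow> q \<in> U"
  show "open U"
  proof (subst open_subopen, rule ballI)
    fix p assume p: "p \<in> U"
    obtain e where e: "0 < e" "\<And>q. d p q < e \<Longrightarrow> q \<in> U" using U p by blast
    obtain c where c: "c \<in> A" "p \<in> fst c" using chart_cover by blast
    obtain R K where "normal_chart A g c p R K" by (rule normal_chart_exists[OF c])
    then interpret N: normal_chart A g c p R K .
    have K1: "1 \<le> K" by (rule N.K_ge1)
    define \<delta> where "\<delta> = min N.r3 (e / (2 * K))"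
    have \<delta>: "0 < \<delta>" "\<delta> \<le> N.r3" "2 * K * \<delta> \<le> e" using N.r3(1) e K1 by (auto simp: \<delta>_def field_simps min_def)
    have sub: "ball N.x0 \<delta> \<subseteq> N.N3" using \<delta> by (auto simp: N.N3_def)
    show "\<exists>T. open T \<and> p \<in> T \<and> T \<subseteq> U"
    proof (intro exI[of _ "N.iv ` ball N.x0 \<delta>"] conjI subsetI)
      show "open (N.iv ` ball N.x0 \<delta>)" by (rule N.open_iv[OF open_ball]) (use sub N.N3_B in blast)
      show "p \<in> N.iv ` ball N.x0 \<delta>" using imageI[of N.x0 "ball N.x0 \<delta>" N.iv] \<delta> N.iv_x0 by simp
      fix q assume "q \<in> N.iv ` ball N.x0 \<delta>"
      then obtain b where b: "b \<in> ball N.x0 \<delta>" "q = N.iv b" by (rule imageE)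
      then have bN: "b \<in> N.N3" using sub by blast
      have "d p q = N.\<rho> N.x0 b" using N.d_eq_rho[OF N.x0_N3 bN] b N.iv_x0 by simp
      also have "\<dots> \<le> 2 * K * norm (b - N.x0)" by (rule N.rho_upper[OF N.x0_N1 N.N3_N1[OF bN]])
      also have "\<dots> < 2 * K * \<delta>" using b K1 by (simp add: dist_norm norm_minus_commute)
      finally show "q \<in> U" using e(2) \<delta>(3) by simp
    qed
  qed
qed

text \<open>The complement of a point is open and hence, by \<open>open_iff_d\<close>, contains a
  metric ball about each of its points.\<close>

lemma d_eq0: "d p q = 0 \<longleftrightarrow> p = q"
proof
  assume 0: "d p q = 0"
  show "p = q"
  proof (rule ccontr)
    assume "p \<noteq> q"
    then have "p \<in> - {q}" by simp
    moreover have "open (- {q})" by (rule open_Compl[OF closed_singleton])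
    ultimately obtain e where e: "0 < e" "\<And>y. d p y < e \<Longrightarrow> y \<in> - {q}" unfolding open_iff_d by blast
    then show False using e(2)[of q] 0 by simp
  qed
qed (simp add: d_self)

end

section \<open>Proper geodesic spaces\<close>

text \<open>Shortest paths are isometric embeddings of \<open>[0, D]\<close>. This combines
  minimality and parametrisation by arc length in a form that makes sense in every metric space and
  passes to subintervals; values outside \<open>[0, D]\<close> are arbitrary.\<close>

definition shortest :: "('a \<Rightarrow> 'a \<Rightarrow> real) \<Rightarrow> (real \<Rightarrow> 'a) \<Rightarrow> real \<Rightarrow> bool" where
  "shortest d \<sigma> D \<longleftrightarrow> (\<forall>s\<in>{0..D}. \<forall>t\<in>{0..D}. d (\<sigma> s) (\<sigma> t) = \<bar>s - t\<bar>)"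

definition joined :: "('a \<Rightarrow> 'a \<Rightarrow> real) \<Rightarrow> 'a \<Rightarrow> 'a \<Rightarrow> bool" where
  "joined d x y \<longleftrightarrow> (\<exists>\<sigma>. shortest d \<sigma> (d x y) \<and> \<sigma> 0 = x \<and> \<sigma> (d x y) = y)"

text \<open>The properties of the distance from which the theorem follows without further reference
  to charts. The last four are local at \<open>p\<close>: compactness, existence of shortest paths,
  absence of branching, and the consequence of Brouwer's theorem.\<close>

locale geodesic_space =
  fixes d :: "'a::{t2_space,second_countable_topology} \<Rightarrow> 'a \<Rightarrow> real"
  assumes d_nonneg: "0 \<le> d x y"
    and d_eq0: "d x y = 0 \<longleftrightarrow> x = y"
    and d_sym: "d x y = d y x"
    and d_triangle: "d x z \<le> d x y + d y z"
    and open_iff_d: "open U \<longleftrightarrow> (\<forall>p\<in>U. \<exists>e>0. \<forall>q. d p q < e \<longrightarrow> q \<in> U)"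
    and complete: "Metric_space.mcomplete UNIV d"
    and almost_between: "0 \<le> s \<Longrightarrow> s \<le> d x y \<Longrightarrow> 0 < e \<Longrightarrow> \<exists>m. d x m = s \<and> d m y < d x y - s + e"
    and locally_compact: "\<exists>s>0. \<exists>Z. compact Z \<and> {q. d p q < s} \<subseteq> Z"
    and locally_joined: "\<exists>s>0. \<forall>x y. d p x < s \<longrightarrow> d p y < s \<longrightarrow> joined d x y"
    and extension_unique: "\<exists>s>0. \<forall>x y y'. d p x < s \<longrightarrow> d p y < s \<longrightarrow> d p y' < s \<longrightarrow> x \<noteq> p \<longrightarrow>
        d x y = d x p + d p y \<longrightarrow> d x y' = d x p + d p y' \<longrightarrow> d p y = d p y' \<longrightarrow> y = y'"
    and extension_exists: "\<exists>s>0. \<exists>\<delta>0>0. \<forall>\<delta> z. 0 < \<delta> \<longrightarrow> \<delta> \<le> \<delta>0 \<longrightarrow> continuous_on {q. d p q \<le> \<delta>} z \<longrightarrow>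
        (\<forall>q. d p q \<le> \<delta> \<longrightarrow> d p (z q) < s \<and> z q \<noteq> p) \<longrightarrow> (\<exists>q. d p q = \<delta> \<and> d (z q) q = d (z q) p + \<delta>)"
begin

lemma d_self [simp]: "d x x = 0"
  by (rule iffD2[OF d_eq0 refl])

lemma d_pos: "x \<noteq> y \<Longrightarrow> 0 < d x y"
  using d_nonneg[of x y] d_eq0[of x y] by (simp add: less_le)

sublocale M: Metric_space UNIV d
  by (intro Metric_space.intro d_nonneg d_sym d_eq0 d_triangle)

text \<open>As rewrite rules these would delete the facts \<open>0 \<le> d x y\<close> needed by linear arithmetic.\<close>

declare M.nonneg [simp del] M.zero [simp del] M.mdist_zero [simp del] M.mdist_pos_eq [simp del]

lemma mtopology_eq: "M.mtopology = euclidean"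
proof -
  have "openin M.mtopology U \<longleftrightarrow> open U" for U
    unfolding M.openin_mtopology open_iff_d[of U] by (simp add: subset_eq Ball_def)
  then show ?thesis by (simp add: topology_eq open_openin[symmetric])
qed

lemma tendsto_iff_d: "(x \<longlonglongrightarrow> l) \<longleftrightarrow> (\<forall>e>0. \<forall>\<^sub>F n in sequentially. d (x n) l < e)"
  using M.limitin_metric[of x l sequentially] by (simp add: mtopology_eq)

lemma tendsto_d0: "x \<longlonglongrightarrow> l \<longleftrightarrow> (\<lambda>n. d (x n) l) \<longlonglongrightarrow> 0"
  unfolding tendsto_iff_d by (simp add: tendsto_iff dist_real_def d_nonneg)

lemma d_lipschitz: "\<bar>d x y - d x' y\<bar> \<le> d x x'" "\<bar>d y x - d y x'\<bar> \<le> d x x'"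
  using d_triangle[of x y x'] d_triangle[of x' y x] d_sym[of x x'] d_sym[of y x] d_sym[of y x']
  by (simp_all only: abs_le_iff) linarith+

lemma tendsto_d:
  assumes "x \<longlonglongrightarrow> l"
  shows "(\<lambda>n. d (x n) y) \<longlonglongrightarrow> d l y" "(\<lambda>n. d y (x n)) \<longlonglongrightarrow> d y l"
proof -
  have "(\<lambda>n. d (x n) y - d l y) \<longlonglongrightarrow> 0"
    by (rule Lim_null_comparison[of _ "\<lambda>n. d (x n) l"])
      (use d_lipschitz assms tendsto_d0 in \<open>auto intro!: always_eventually\<close>)
  then show "(\<lambda>n. d (x n) y) \<longlonglongrightarrow> d l y" by (rule LIM_zero_cancel)
  then show "(\<lambda>n. d y (x n)) \<longlonglongrightarrow> d y l" by (simp add: d_sym[of y])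
qed

abbreviation cb :: "'a \<Rightarrow> real \<Rightarrow> 'a set" where "cb p r \<equiv> {q. d p q \<le> r}"

lemma cb_mcball: "cb p r = M.mcball p r"
  by auto

lemma closed_cb: "closed (cb p r)"
  using M.closedin_mcball[of p r] by (simp add: cb_mcball mtopology_eq)

lemma open_ob: "open {q. d p q < r}"
proof -
  have "{q. d p q < r} = M.mball p r" by auto
  then show ?thesis using M.openin_mball[of p r] by (simp add: mtopology_eq open_openin[symmetric])
qed

text \<open>Total boundedness and completeness yield sequential compactness, which second
  countability turns into compactness.\<close>

lemma compact_cb_if:
  assumes tb: "\<And>e. 0 < e \<Longrightarrow> \<exists>F. finite F \<and> F \<subseteq> cb p r \<and> cb p r \<subseteq> (\<Union>x\<in>F. {y. d x y < e})"
  shows "compact (cb p r)"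
proof -
  have b: "M.mball x e = {y. d x y < e}" for x e by auto
  have mt: "M.mtotally_bounded (cb p r)" unfolding M.mtotally_bounded_def b using tb by blast
  have "seq_compact (cb p r)"
    unfolding seq_compact_def
  proof (intro allI impI)
    fix f :: "nat \<Rightarrow> 'a" assume f: "\<forall>n. f n \<in> cb p r"
    have "\<exists>r. strict_mono r \<and> M.MCauchy (f \<circ> r)"
      using mt[unfolded M.mtotally_bounded_sequentially] f by blast
    then obtain k where k: "strict_mono k" "M.MCauchy (f \<circ> k)" by blast
    then obtain l where "limitin M.mtopology (f \<circ> k) l sequentially"
      using complete M.mcomplete_def by blast
    then have l: "(f \<circ> k) \<longlonglongrightarrow> l" by (simp add: mtopology_eq)
    have "l \<in> cb p r"
      by (rule closed_sequentially[OF closed_cb _ l]) (use f in simp)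
    then show "\<exists>l\<in>cb p r. \<exists>r. strict_mono r \<and> (f \<circ> r) \<longlonglongrightarrow> l" using k l by blast
  qed
  then show ?thesis by (simp add: seq_compact_eq_compact)
qed

text \<open>An almost shortest connection from \<open>p\<close> to \<open>y\<close> is followed up
  to distance \<open>r\<close>, or to its end if \<open>y\<close> already lies in the ball.\<close>

lemma between_cb:
  assumes "d p y \<le> r + e" "0 \<le> r" "0 < e"
  obtains m where "d p m \<le> r" "d m y < 2 * e"
proof -
  define s where "s = min r (d p y)"
  obtain m where m: "d p m = s" "d m y < d p y - s + e"
    using almost_between[of s p y e] assms d_nonneg[of p y] by (auto simp: s_def)
  have "d m y < 2 * e" using m assms by (auto simp: s_def min_def split: if_splits)
  then show ?thesis using that[of m] m by (auto simp: s_def)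
qed

lemma compact_cover:
  assumes C: "compact C" and pos: "\<And>p. 0 < s p"
  obtains F where "finite F" "F \<subseteq> C" "C \<subseteq> (\<Union>x\<in>F. {y. d x y < s x})"
proof -
  have "C \<subseteq> (\<Union>x\<in>C. {y. d x y < s x})" using pos by auto
  then obtain F where "F \<subseteq> C" "finite F" "C \<subseteq> (\<Union>x\<in>F. {y. d x y < s x})"
    by (rule compactE_image[OF C, rotated]) (use open_ob in auto)
  then show ?thesis using that by blast
qed

lemma compact_cb_mono:
  assumes "compact (cb p r)" "r' \<le> r"
  shows "compact (cb p r')"
proof -
  have "cb p r' = cb p r \<inter> cb p r'" using assms(2) by auto
  then show ?thesis using compact_Int_closed[OF assms(1) closed_cb[of p r']] by simp
qed

text \<open>Hopf and Rinow: the supremum of the radii of compact balls about \<open>p\<close> can neither be finite and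
  attained (local compactness) nor finite and not attained (total boundedness).\<close>

lemma compact_cb: "compact (cb p r)"
proof (rule ccontr)
  assume nc: "\<not> compact (cb p r)"
  define S where "S = {r. 0 \<le> r \<and> compact (cb p r)}"
  have ub: "x \<le> r" if "x \<in> S" for x
    using compact_cb_mono[of p x r] nc that by (force simp: S_def)
  have "d p x \<le> 0 \<longleftrightarrow> x = p" for x
    using d_pos[of p x] by (cases "p = x") auto
  then have "cb p 0 = {p}" by simp
  then have S0: "0 \<in> S" by (simp add: S_def)
  have bdd: "bdd_above S" using ub by (rule bdd_aboveI)
  define \<rho> where "\<rho> = Sup S"
  have \<rho>0: "0 \<le> \<rho>" unfolding \<rho>_def by (rule cSup_upper[OF S0 bdd])
  have below: "compact (cb p x)" if "x < \<rho>" for x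
  proof -
    have "\<exists>y\<in>S. x < y" by (rule less_cSupD) (use that S0 in \<open>auto simp: \<rho>_def\<close>)
    then obtain y where "y \<in> S" "x < y" by blast
    then show ?thesis using compact_cb_mono[of p y x] by (simp add: S_def)
  qed
  have c\<rho>: "compact (cb p \<rho>)"
  proof (cases "\<rho> = 0")
    case True
    then show ?thesis using S0 by (simp add: S_def)
  next
    case False
    then have \<rho>pos: "0 < \<rho>" using \<rho>0 by simp
    show ?thesis
    proof (rule compact_cb_if)
      fix e :: real assume e: "0 < e"
      \<comment> \<open>A net of mesh \<open>e / 2\<close> of the ball of radius
        \<open>\<rho> - h\<close> serves for the whole ball, because
        \<open>2 * h \<le> e / 2\<close>. The bound \<open>\<rho> / 2\<close> keeps the smaller
        radius nonnegative.\<close>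
      define h where "h = min (e / 4) (\<rho> / 2)"
      have h: "0 < h" "h \<le> e / 4" "h \<le> \<rho> / 2" using e \<rho>pos by (auto simp: h_def)
      obtain F where F: "finite F" "F \<subseteq> cb p (\<rho> - h)" "cb p (\<rho> - h) \<subseteq> (\<Union>x\<in>F. {y. d x y < e / 2})"
        by (rule compact_cover[OF below, of "\<rho> - h" "\<lambda>_. e / 2"]) (use h e in auto)
      have "F \<subseteq> cb p \<rho>" using F(2) h by force
      moreover have "y \<in> (\<Union>x\<in>F. {y. d x y < e})" if y: "y \<in> cb p \<rho>" for y
      proof -
        obtain m where m: "d p m \<le> \<rho> - h" "d m y < 2 * h"
          by (rule between_cb[of p y "\<rho> - h" h]) (use y h in auto)
        then obtain x where x: "x \<in> F" "d x m < e / 2" using F(3) by blast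
        then have "d x y < e" using d_triangle[of x y m] m h by linarith
        then show ?thesis using x by blast
      qed
      ultimately show "\<exists>F. finite F \<and> F \<subseteq> cb p \<rho> \<and> cb p \<rho> \<subseteq> (\<Union>x\<in>F. {y. d x y < e})"
        using F(1) by blast
    qed
  qed
  obtain s Z where sZ: "\<And>q. 0 < s q" "\<And>q. compact (Z q)" "\<And>q. {y. d q y < s q} \<subseteq> Z q"
    using locally_compact by metis
  obtain F where F: "finite F" "F \<subseteq> cb p \<rho>" "cb p \<rho> \<subseteq> (\<Union>x\<in>F. {y. d x y < s x / 2})"
    by (rule compact_cover[OF c\<rho>, of "\<lambda>x. s x / 2"]) (use sZ(1) in auto)
  have "p \<in> cb p \<rho>" using \<rho>0 by simp
  then have Fne: "F \<noteq> {}" using F(3) by blast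
  \<comment> \<open>Points in the larger ball are within \<open>2 * e\<close> of the compact one,
    and \<open>2 * e \<le> s x / 2\<close> for every centre \<open>x\<close> of the finite
    cover.\<close>
  define e where "e = Min (s ` F) / 4"
  have e: "0 < e" "\<And>x. x \<in> F \<Longrightarrow> 4 * e \<le> s x"
    using F(1) Fne sZ(1) by (auto simp: e_def)
  have "cb p (\<rho> + e) \<subseteq> (\<Union>x\<in>F. Z x)"
  proof
    fix y assume y: "y \<in> cb p (\<rho> + e)"
    obtain m where m: "d p m \<le> \<rho>" "d m y < 2 * e"
      by (rule between_cb[of p y \<rho> e]) (use y \<rho>0 e in auto)
    then obtain x where x: "x \<in> F" "d x m < s x / 2" using F(3) by blast
    then have "d x y < s x" using d_triangle[of x y m] m e(2)[of x] by linarith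
    then show "y \<in> (\<Union>x\<in>F. Z x)" using sZ(3) x by blast
  qed
  moreover have "compact (\<Union>x\<in>F. Z x)" using F(1) sZ(2) by (intro compact_UN) auto
  ultimately have "compact (cb p (\<rho> + e))"
    using compact_Int_closed[OF _ closed_cb[of p "\<rho> + e"], of "\<Union>x\<in>F. Z x"] by (simp add: Int_absorb1)
  then have "\<rho> + e \<in> S" using \<rho>0 e by (simp add: S_def)
  then have "\<rho> + e \<le> \<rho>" unfolding \<rho>_def by (rule cSup_upper[OF _ bdd])
  then show False using e by simp
qed

lemma bounded_subseq:
  assumes "\<And>n. d p (x n) \<le> r"
  obtains l k where "strict_mono (k :: nat \<Rightarrow> nat)" "(x \<circ> k) \<longlonglongrightarrow> l"
proof -
  have "seq_compact (cb p r)" using compact_cb[of p r] by (rule compact_imp_seq_compact)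
  then have "\<exists>l\<in>cb p r. \<exists>k. strict_mono k \<and> (x \<circ> k) \<longlonglongrightarrow> l"
    unfolding seq_compact_def using assms by blast
  then show ?thesis using that by blast
qed

text \<open>Limit of the approximate intermediate points, all of which lie in one compact ball about
  \<open>x\<close>.\<close>

lemma between:
  assumes "0 \<le> s" "s \<le> d x y"
  obtains m where "d x m = s" "d m y = d x y - s"
proof -
  have "\<exists>m. d x m = s \<and> d m y < d x y - s + 1 / real (Suc n)" for n
    by (rule almost_between[OF assms]) simp
  then obtain m where m: "\<And>n. d x (m n) = s" "\<And>n. d (m n) y < d x y - s + 1 / real (Suc n)" by metis
  obtain l k where lk: "strict_mono k" "(m \<circ> k) \<longlonglongrightarrow> l"
    by (rule bounded_subseq[of x m s]) (use m in auto)
  have 1: "d x l = s"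
    using LIMSEQ_unique[OF tendsto_d(2)[OF lk(2), of x]] m(1) by simp
  have "(\<lambda>n. d x y - s + 1 / real (Suc n)) \<longlonglongrightarrow> d x y - s + 0"
    using LIMSEQ_inverse_real_of_nat by (intro tendsto_intros) (simp add: inverse_eq_divide)
  then have "(\<lambda>n. d x y - s + 1 / real (Suc (k n))) \<longlonglongrightarrow> d x y - s"
    using LIMSEQ_subseq_LIMSEQ[OF _ lk(1), of "\<lambda>n. d x y - s + 1 / real (Suc n)"] by (simp add: o_def)
  then have "d l y \<le> d x y - s"
    by (rule LIMSEQ_le[OF tendsto_d(1)[OF lk(2)]]) (use m(2) less_imp_le in \<open>auto simp: o_def\<close>)
  then have "d l y = d x y - s" using d_triangle[of x y l] 1 by linarith
  then show ?thesis using 1 that by blast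
qed

text \<open>Since the total length equals the distance of the end points, no pair of intermediate
  points can be closer than its distance along the concatenation.\<close>

lemma shortest_append:
  assumes 1: "shortest d \<sigma> D" and 2: "shortest d \<tau> E" and DE: "0 \<le> D" "0 \<le> E"
    and eq: "\<sigma> D = \<tau> 0" and len: "d (\<sigma> 0) (\<tau> E) = D + E"
  shows "shortest d (\<lambda>t. if t \<le> D then \<sigma> t else \<tau> (t - D)) (D + E)" (is "shortest d ?h _")
proof -
  have cross: "d (\<sigma> s) (\<tau> (t - D)) = t - s" if st: "0 \<le> s" "s \<le> D" "D < t" "t \<le> D + E" for s t
  proof -
    have a: "d (\<sigma> s) (\<sigma> D) = D - s" "d (\<sigma> 0) (\<sigma> s) = s" "d (\<tau> 0) (\<tau> (t - D)) = t - D" "d (\<tau> (t - D)) (\<tau> E) = D + E - t"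
      using 1 2 st DE by (auto simp: shortest_def)
    have "d (\<sigma> s) (\<tau> (t - D)) \<le> t - s"
      using d_triangle[of "\<sigma> s" "\<tau> (t - D)" "\<tau> 0"] a eq by simp
    moreover have "D + E \<le> s + d (\<sigma> s) (\<tau> (t - D)) + (D + E - t)"
      using d_triangle[of "\<sigma> 0" "\<tau> E" "\<sigma> s"] d_triangle[of "\<sigma> s" "\<tau> E" "\<tau> (t - D)"] a len by simp
    ultimately show ?thesis by simp
  qed
  show ?thesis
    unfolding shortest_def
  proof (intro ballI)
    fix s t assume s: "s \<in> {0..D + E}" and t: "t \<in> {0..D + E}"
    consider "s \<le> D" "t \<le> D" | "s \<le> D" "D < t" | "D < s" "t \<le> D" | "D < s" "D < t" by linarith
    then show "d (?h s) (?h t) = \<bar>s - t\<bar>"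
    proof cases
      case 1
      then show ?thesis using assms(1) s t by (auto simp: shortest_def)
    next
      case 2
      then show ?thesis using cross[of s t] s t by simp
    next
      case 3
      then show ?thesis using cross[of t s] s t d_sym[of "\<sigma> t"] by simp
    next
      case 4
      then show ?thesis using assms(2) s t by (auto simp: shortest_def)
    qed
  qed
qed

lemma joined_trans:
  assumes "joined d x m" "joined d m y" "d x y = d x m + d m y"
  shows "joined d x y"
proof -
  obtain \<sigma> where s: "shortest d \<sigma> (d x m)" "\<sigma> 0 = x" "\<sigma> (d x m) = m" using assms(1) unfolding joined_def by blast
  obtain \<tau> where t: "shortest d \<tau> (d m y)" "\<tau> 0 = m" "\<tau> (d m y) = y" using assms(2) unfolding joined_def by blast
  define h where "h = (\<lambda>t. if t \<le> d x m then \<sigma> t else \<tau> (t - d x m))"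
  have "shortest d h (d x y)"
    unfolding h_def assms(3) by (rule shortest_append[OF s(1) t(1)]) (use s t assms d_nonneg in auto)
  moreover have "h 0 = x" using s d_nonneg[of x m] by (simp add: h_def)
  moreover have "h (d x y) = y"
  proof (cases "m = y")
    case True
    show ?thesis unfolding h_def True[symmetric] using s(3) by simp
  next
    case False
    have "0 < d m y" by (rule d_pos[OF False])
    then show ?thesis using t(3) assms(3) by (simp add: h_def)
  qed
  ultimately show ?thesis unfolding joined_def by blast
qed

text \<open>A Lebesgue number \<open>e\<close> of a finite cover makes all points of the compact
  ball \<open>C\<close> uniformly joinable to points closer than \<open>e\<close>. Steps of size
  \<open>e / 2\<close> through points between \<open>x\<close> and \<open>y\<close> never leave
  \<open>C\<close>, and the number of remaining steps is the induction variable.\<close>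

lemma joined_all: "joined d x y"
proof -
  define C where "C = cb x (d x y)"
  obtain s where s: "\<And>q. 0 < s q" "\<And>q u v. d q u < s q \<Longrightarrow> d q v < s q \<Longrightarrow> joined d u v"
    using locally_joined by metis
  obtain F where F: "finite F" "F \<subseteq> C" "C \<subseteq> (\<Union>q\<in>F. {u. d q u < s q / 2})"
    by (rule compact_cover[of C "\<lambda>q. s q / 2"]) (use s(1) compact_cb in \<open>auto simp: C_def\<close>)
  have "y \<in> C" by (simp add: C_def)
  then have Fne: "F \<noteq> {}" using F(3) by blast
  define e where "e = Min (s ` F) / 2"
  have e: "0 < e" "\<And>q. q \<in> F \<Longrightarrow> 2 * e \<le> s q" using F(1) Fne s(1) by (auto simp: e_def)
  have short: "joined d u v" if u: "u \<in> C" and uv: "d u v < e" for u v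
  proof -
    obtain q where q: "q \<in> F" "d q u < s q / 2" using F(3) u by blast
    have "d q v < s q" using d_triangle[of q v u] q(2) e(2)[OF q(1)] uv by linarith
    then show ?thesis using s(2)[of q u v] q(2) s(1)[of q] by simp
  qed
  have key: "joined d m y" if "d x m + d m y = d x y" "d m y \<le> real n * (e / 2)" for n m
    using that
  proof (induction n arbitrary: m)
    case 0
    then have "m \<in> C" "d m y < e" using d_nonneg[of m y] e by (auto simp: C_def)
    then show ?case by (rule short)
  next
    case (Suc n)
    have mC: "m \<in> C" using Suc.prems d_nonneg[of m y] by (simp add: C_def)
    show ?case
    proof (cases "d m y < e")
      case True
      then show ?thesis using short mC by blast
    next
      case False
      then obtain m' where m': "d m m' = e / 2" "d m' y = d m y - e / 2"
        using between[of "e / 2" m y] e(1) by auto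
      have sum: "d x m' + d m' y = d x y"
        using d_triangle[of x m' m] d_triangle[of x y m'] m' Suc.prems(1) by linarith
      have "d m' y \<le> real n * (e / 2)" using m' Suc.prems(2) by (simp add: algebra_simps)
      then have "joined d m' y" using Suc.IH sum by blast
      moreover have "joined d m m'" using short[OF mC] m' e(1) by simp
      ultimately show ?thesis using joined_trans[of m m' y] m' by simp
    qed
  qed
  obtain n :: nat where "d x y / (e / 2) \<le> real n" using real_arch_simple by blast
  then have "d x y \<le> real n * (e / 2)" using e(1) by (simp add: field_simps)
  then show ?thesis using key[of x n] by simp
qed

end

section \<open>Shortest paths from a closed set\<close>

context geodesic_space
begin

definition dd :: "'a set \<Rightarrow> 'a \<Rightarrow> real" where
  "dd Y p = Inf (d p ` Y)"

text \<open>The metric counterpart of membership in the medial axis. Paths run from \<open>Y\<close>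
  to \<open>p\<close>, and distinctness is tested on \<open>[0, dd Y p]\<close> because other values
  are arbitrary.\<close>

definition two_seg :: "'a set \<Rightarrow> 'a \<Rightarrow> bool" where
  "two_seg Y p \<longleftrightarrow> (\<exists>\<sigma> \<tau>. shortest d \<sigma> (dd Y p) \<and> shortest d \<tau> (dd Y p) \<and> \<sigma> 0 \<in> Y \<and> \<tau> 0 \<in> Y \<and>
     \<sigma> (dd Y p) = p \<and> \<tau> (dd Y p) = p \<and> (\<exists>t\<in>{0..dd Y p}. \<sigma> t \<noteq> \<tau> t))"

lemma dd_le: "y \<in> Y \<Longrightarrow> dd Y p \<le> d p y"
  unfolding dd_def by (rule cInf_lower) (auto intro!: bdd_belowI[of _ 0] d_nonneg)

lemma dd_attained:
  assumes Y: "closed Y" "Y \<noteq> {}"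
  obtains y where "y \<in> Y" "d p y = dd Y p"
proof -
  have "\<exists>y\<in>Y. d p y < dd Y p + 1 / real (Suc n)" for n
  proof (rule ccontr)
    assume "\<not> (\<exists>y\<in>Y. d p y < dd Y p + 1 / real (Suc n))"
    then have ge: "\<And>y. y \<in> Y \<Longrightarrow> dd Y p + 1 / real (Suc n) \<le> d p y" by (meson not_le)
    have "dd Y p + 1 / real (Suc n) \<le> dd Y p"
      by (subst (2) dd_def, rule cInf_greatest) (use Y(2) ge in auto)
    then show False by (simp add: field_simps)
  qed
  then obtain y where y: "\<And>n. y n \<in> Y" "\<And>n. d p (y n) < dd Y p + 1 / real (Suc n)" by metis
  have "d p (y n) \<le> dd Y p + 1" for n
  proof -
    have "1 / real (Suc n) \<le> 1" by simp
    then show ?thesis using y(2)[of n] by linarith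
  qed
  then obtain l k where lk: "strict_mono k" "(y \<circ> k) \<longlonglongrightarrow> l" by (rule bounded_subseq)
  have lY: "l \<in> Y" by (rule closed_sequentially[OF Y(1) _ lk(2)]) (use y in simp)
  have "(\<lambda>n. dd Y p + 1 / real (Suc n)) \<longlonglongrightarrow> dd Y p + 0"
    using LIMSEQ_inverse_real_of_nat by (intro tendsto_intros) (simp add: inverse_eq_divide)
  then have "(\<lambda>n. dd Y p + 1 / real (Suc (k n))) \<longlonglongrightarrow> dd Y p"
    using LIMSEQ_subseq_LIMSEQ[OF _ lk(1), of "\<lambda>n. dd Y p + 1 / real (Suc n)"] by (simp add: o_def)
  then have "d p l \<le> dd Y p"
    by (rule LIMSEQ_le[OF tendsto_d(2)[OF lk(2)]]) (use y(2) less_imp_le in \<open>auto simp: o_def\<close>)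
  then show ?thesis using that[OF lY] dd_le[OF lY, of p] by linarith
qed

lemma dd_nonneg: "Y \<noteq> {} \<Longrightarrow> 0 \<le> dd Y p"
  unfolding dd_def by (rule cInf_greatest) (auto simp: d_nonneg)

lemma dd_lipschitz:
  assumes Y: "closed Y" "Y \<noteq> {}"
  shows "dd Y q \<le> d q p + dd Y p"
proof -
  obtain y where y: "y \<in> Y" "d p y = dd Y p" by (rule dd_attained[OF Y])
  then show ?thesis using dd_le[OF y(1), of q] d_triangle[of q y p] by linarith
qed

lemma tendsto_dd:
  assumes Y: "closed Y" "Y \<noteq> {}" and x: "x \<longlonglongrightarrow> l"
  shows "(\<lambda>n. dd Y (x n)) \<longlonglongrightarrow> dd Y l"
proof (rule LIM_zero_cancel)
  show "(\<lambda>n. dd Y (x n) - dd Y l) \<longlonglongrightarrow> 0"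
  proof (rule Lim_null_comparison)
    show "\<forall>\<^sub>F n in sequentially. norm (dd Y (x n) - dd Y l) \<le> d (x n) l"
    proof (intro always_eventually allI)
      fix n
      have "dd Y (x n) \<le> d (x n) l + dd Y l" "dd Y l \<le> d (x n) l + dd Y (x n)"
        using dd_lipschitz[OF Y, of "x n" l] dd_lipschitz[OF Y, of l "x n"] d_sym[of l "x n"] by simp_all
      then show "norm (dd Y (x n) - dd Y l) \<le> d (x n) l" by (simp add: abs_le_iff)
    qed
    show "(\<lambda>n. d (x n) l) \<longlonglongrightarrow> 0" using x by (simp add: tendsto_d0[symmetric])
  qed
qed

lemma back_point:
  assumes Y: "closed Y" "Y \<noteq> {}" and h: "0 \<le> h" "h \<le> dd Y q"
  obtains z where "d q z = h" "dd Y z = dd Y q - h"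
proof -
  obtain y where y: "y \<in> Y" "d q y = dd Y q" by (rule dd_attained[OF Y])
  obtain m where m: "d q m = h" "d m y = d q y - h" by (rule between[of h q y]) (use h y in auto)
  have "dd Y m \<le> dd Y q - h" using dd_le[OF y(1), of m] m y by simp
  moreover have "dd Y q \<le> h + dd Y m" using dd_lipschitz[OF Y, of q m] m by simp
  ultimately show ?thesis using that[of m] m by simp
qed

text \<open>The hypothesis says that \<open>z\<close> realises equality in the Lipschitz estimate
  for \<open>dd Y\<close>. A shortest path from \<open>Y\<close> to \<open>z\<close> followed by one
  from \<open>z\<close> to \<open>q\<close> is then itself shortest. Points are easier to pass to
  limits with than paths.\<close>

lemma back_on_segment:
  assumes Y: "closed Y" "Y \<noteq> {}" and z: "dd Y z = dd Y q - d q z"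
  obtains \<sigma> where "shortest d \<sigma> (dd Y q)" "\<sigma> 0 \<in> Y" "\<sigma> (dd Y q) = q" "\<sigma> (dd Y q - d q z) = z"
proof -
  obtain y where y: "y \<in> Y" "d z y = dd Y z" by (rule dd_attained[OF Y])
  define a where "a = d y z"
  define b where "b = d z q"
  have "0 \<le> a" "0 \<le> b" unfolding a_def b_def by (rule d_nonneg)+
  moreover have "a = dd Y z" "b = d q z" using y d_sym[of z y] d_sym[of z q] by (simp_all add: a_def b_def)
  ultimately have ab: "0 \<le> a" "0 \<le> b" "a = dd Y z" "b = d q z" "dd Y q = a + b"
    using z by simp_all
  have yq: "d y q = a + b"
  proof -
    have "d y q \<le> a + b" unfolding a_def b_def by (rule d_triangle)
    moreover have "a + b \<le> d q y" using dd_le[OF y(1), of q] ab by simp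
    ultimately show ?thesis using d_sym[of y q] by simp
  qed
  obtain \<sigma> where s: "shortest d \<sigma> a" "\<sigma> 0 = y" "\<sigma> a = z" using joined_all[of y z] unfolding joined_def a_def by blast
  obtain \<tau> where t: "shortest d \<tau> b" "\<tau> 0 = z" "\<tau> b = q" using joined_all[of z q] unfolding joined_def b_def by blast
  define h where "h = (\<lambda>t. if t \<le> a then \<sigma> t else \<tau> (t - a))"
  have "shortest d h (a + b)"
    unfolding h_def by (rule shortest_append[OF s(1) t(1) ab(1,2)]) (simp_all add: s t yq)
  moreover have "h 0 = y" "h a = z" using s ab(1) by (simp_all add: h_def)
  moreover have "h (a + b) = q"
  proof (cases "b = 0")
    case True
    then have "z = q" using d_eq0[of z q] by (simp add: b_def)
    then show ?thesis using s True by (simp add: h_def)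
  next
    case False
    then have "0 < b" using ab(2) by simp
    then show ?thesis using t by (simp add: h_def)
  qed
  ultimately show ?thesis using that[of h] y(1) ab by simp
qed

lemma back_unique:
  assumes Y: "closed Y" "Y \<noteq> {}" and no: "\<not> two_seg Y q"
    and z: "d q z = h" "dd Y z = dd Y q - h" and z': "d q z' = h" "dd Y z' = dd Y q - h"
  shows "z = z'"
proof (rule ccontr)
  assume ne: "z \<noteq> z'"
  obtain \<sigma> where s: "shortest d \<sigma> (dd Y q)" "\<sigma> 0 \<in> Y" "\<sigma> (dd Y q) = q" "\<sigma> (dd Y q - h) = z"
    using back_on_segment[OF Y, of z q] z by metis
  obtain \<tau> where t: "shortest d \<tau> (dd Y q)" "\<tau> 0 \<in> Y" "\<tau> (dd Y q) = q" "\<tau> (dd Y q - h) = z'"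
    using back_on_segment[OF Y, of z' q] z' by metis
  have "0 \<le> h" using d_nonneg[of q z] z(1) by simp
  moreover have "0 \<le> dd Y q - h" using dd_nonneg[OF Y(2), of z] z(2) by simp
  ultimately have "dd Y q - h \<in> {0..dd Y q}" by simp
  then have "\<exists>t\<in>{0..dd Y q}. \<sigma> t \<noteq> \<tau> t" using s(4) t(4) ne by (intro bexI[of _ "dd Y q - h"]) simp_all
  then have "two_seg Y q" unfolding two_seg_def using s t by blast
  then show False using no by simp
qed

text \<open>Compactness and uniqueness: both equations that characterise \<open>z\<close> are closed
  conditions, so every accumulation point of \<open>z (u n)\<close> satisfies them at
  \<open>q\<close> and equals \<open>z q\<close>.\<close>

lemma back_continuous:
  assumes Y: "closed Y" "Y \<noteq> {}" and no: "\<And>q. q \<in> S \<Longrightarrow> \<not> two_seg Y q"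
    and z: "\<And>q. q \<in> S \<Longrightarrow> d q (z q) = h" "\<And>q. q \<in> S \<Longrightarrow> dd Y (z q) = dd Y q - h"
  shows "continuous_on S z"
proof (rule continuous_on_sequentiallyI)
  fix u q assume u: "\<forall>n. u n \<in> S" and q: "q \<in> S" and lim: "u \<longlonglongrightarrow> q"
  show "(\<lambda>n. z (u n)) \<longlonglongrightarrow> z q"
  proof (rule ccontr)
    assume "\<not> (\<lambda>n. z (u n)) \<longlonglongrightarrow> z q"
    then obtain e where e: "0 < e" "\<not> (\<forall>\<^sub>F n in sequentially. d (z (u n)) (z q) < e)"
      unfolding tendsto_iff_d by blast
    then have "\<exists>\<^sub>F n in sequentially. e \<le> d (z (u n)) (z q)"
      by (simp add: frequently_def not_le)
    then have "infinite {n. e \<le> d (z (u n)) (z q)}"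
      unfolding frequently_cofinite[symmetric] cofinite_eq_sequentially .
    then obtain k :: "nat \<Rightarrow> nat" where k: "strict_mono k" "\<And>n. k n \<in> {n. e \<le> d (z (u n)) (z q)}"
      using infinite_enumerate by blast
    have uk: "(u \<circ> k) \<longlonglongrightarrow> q" by (rule LIMSEQ_subseq_LIMSEQ[OF lim k(1)])
    have "Bseq (\<lambda>n. d ((u \<circ> k) n) q)"
      using tendsto_d(1)[OF uk, of q] convergent_imp_Bseq convergentI by blast
    then obtain B where B: "\<And>n. norm (d ((u \<circ> k) n) q) \<le> B" by (metis BseqE)
    have "d q (z (u (k n))) \<le> B + h" for n
      using d_triangle[of q "z (u (k n))" "u (k n)"] z(1)[of "u (k n)"] u B[of n] d_sym[of q "u (k n)"] by simp
    then obtain l j where lj: "strict_mono j" "((\<lambda>n. z (u (k n))) \<circ> j) \<longlonglongrightarrow> l" by (rule bounded_subseq)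
    have ukj: "(u \<circ> k \<circ> j) \<longlonglongrightarrow> q" by (rule LIMSEQ_subseq_LIMSEQ[OF uk lj(1)])
    have "d q l = h"
    proof -
      have "(\<lambda>n. d ((u \<circ> k \<circ> j) n) (((\<lambda>n. z (u (k n))) \<circ> j) n) - d q (((\<lambda>n. z (u (k n))) \<circ> j) n)) \<longlonglongrightarrow> 0"
        by (rule Lim_null_comparison[of _ "\<lambda>n. d ((u \<circ> k \<circ> j) n) q"])
          (use d_lipschitz(1) ukj tendsto_d0 in \<open>auto intro!: always_eventually\<close>)
      from tendsto_add[OF this tendsto_d(2)[OF lj(2), of q]]
      have "(\<lambda>n. h) \<longlonglongrightarrow> d q l" using z(1) u by (simp add: o_def)
      then show ?thesis by (simp add: LIMSEQ_const_iff)
    qed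
    moreover have "dd Y l = dd Y q - h"
    proof -
      have "(\<lambda>n. dd Y (((\<lambda>n. z (u (k n))) \<circ> j) n)) \<longlonglongrightarrow> dd Y l" by (rule tendsto_dd[OF Y lj(2)])
      moreover have "(\<lambda>n. dd Y ((u \<circ> k \<circ> j) n) - h) \<longlonglongrightarrow> dd Y q - h"
        by (intro tendsto_intros tendsto_dd[OF Y ukj])
      ultimately show ?thesis using z(2) u by (simp add: o_def LIMSEQ_unique)
    qed
    ultimately have "l = z q" using back_unique[OF Y no[OF q]] z[OF q] by blast
    then have "(\<lambda>n. d (((\<lambda>n. z (u (k n))) \<circ> j) n) (z q)) \<longlonglongrightarrow> 0" using lj(2) tendsto_d0 by blast
    then have "e \<le> 0"
      by (rule LIMSEQ_le_const) (use k(2) in \<open>auto\<close>)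
    then show False using e(1) by simp
  qed
qed

text \<open>If every point near \<open>p\<close> has a unique shortest path from \<open>Y\<close>, then the one ending in \<open>p\<close> can be
  prolonged: a fixed point argument produces a point whose own shortest path runs through \<open>p\<close>.\<close>

lemma prolongation:
  obtains \<delta>1 where "0 < \<delta>1"
    "\<And>Y \<delta>. closed Y \<Longrightarrow> Y \<noteq> {} \<Longrightarrow> 0 < \<delta> \<Longrightarrow> \<delta> \<le> \<delta>1 \<Longrightarrow> 3 * \<delta> \<le> dd Y p \<Longrightarrow>
       (\<And>q. d p q \<le> \<delta> \<Longrightarrow> \<not> two_seg Y q) \<Longrightarrow> \<exists>q. d p q = \<delta> \<and> dd Y p + \<delta> \<le> dd Y q"
proof -
  obtain s \<delta>0 where s: "0 < s" "0 < \<delta>0" and ext: "\<And>\<delta> z. 0 < \<delta> \<Longrightarrow> \<delta> \<le> \<delta>0 \<Longrightarrow> continuous_on (cb p \<delta>) z \<Longrightarrow>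
        (\<forall>q. d p q \<le> \<delta> \<longrightarrow> d p (z q) < s \<and> z q \<noteq> p) \<Longrightarrow> \<exists>q. d p q = \<delta> \<and> d (z q) q = d (z q) p + \<delta>"
    using extension_exists[of p] by blast
  show ?thesis
  \<comment> \<open>The point \<open>z q\<close> is within \<open>\<delta> + 2 * \<delta>\<close> of
    \<open>p\<close>, which is less than \<open>s\<close> for \<open>\<delta> \<le> s / 4\<close>.
    The bound depends on \<open>p\<close> alone, not on \<open>Y\<close>.\<close>
  proof (rule that[of "min \<delta>0 (s / 4)"])
    show "0 < min \<delta>0 (s / 4)" using s by simp
    fix Y \<delta> assume Y: "closed Y" "Y \<noteq> {}" and \<delta>: "0 < \<delta>" "\<delta> \<le> min \<delta>0 (s / 4)" and far: "3 * \<delta> \<le> dd Y p"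
      and no: "\<And>q. d p q \<le> \<delta> \<Longrightarrow> \<not> two_seg Y q"
    have "\<exists>z. d q z = 2 * \<delta> \<and> dd Y z = dd Y q - 2 * \<delta>" if "d p q \<le> \<delta>" for q
    proof -
      have "dd Y p \<le> d p q + dd Y q" by (rule dd_lipschitz[OF Y])
      then have "2 * \<delta> \<le> dd Y q" using far that by linarith
      then obtain z where "d q z = 2 * \<delta>" "dd Y z = dd Y q - 2 * \<delta>"
        using back_point[OF Y, of "2 * \<delta>" q] \<delta>(1) by auto
      then show ?thesis by blast
    qed
    then obtain z where z: "\<And>q. d p q \<le> \<delta> \<Longrightarrow> d q (z q) = 2 * \<delta>" "\<And>q. d p q \<le> \<delta> \<Longrightarrow> dd Y (z q) = dd Y q - 2 * \<delta>"
      by metis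
    have "continuous_on (cb p \<delta>) z"
      by (rule back_continuous[OF Y, of _ _ "2 * \<delta>"]) (use no z in auto)
    moreover have "d p (z q) < s \<and> z q \<noteq> p" if q: "d p q \<le> \<delta>" for q
    proof
      show "d p (z q) < s" using d_triangle[of p "z q" q] z(1)[OF q] q \<delta> s by simp
      show "z q \<noteq> p" using z(1)[OF q] q \<delta>(1) d_sym[of p q] by auto
    qed
    ultimately obtain q where q: "d p q = \<delta>" "d (z q) q = d (z q) p + \<delta>"
      using ext[of \<delta> z] \<delta> by auto
    \<comment> \<open>The fixed point gives \<open>2 * \<delta> = d (z q) p + \<delta>\<close>, so
      \<open>z q\<close> is at distance \<open>\<delta>\<close> from \<open>p\<close>. As
      \<open>dd Y\<close> decreases by \<open>2 * \<delta>\<close> from \<open>q\<close> to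
      \<open>z q\<close> and changes by at most \<open>\<delta>\<close> from there to
      \<open>p\<close>, the claim follows.\<close>
    have "d q (z q) = 2 * \<delta>" "dd Y (z q) = dd Y q - 2 * \<delta>" using z[of q] q(1) by auto
    moreover have "dd Y p \<le> d p (z q) + dd Y (z q)" by (rule dd_lipschitz[OF Y])
    moreover have "d (z q) q = d q (z q)" "d (z q) p = d p (z q)" by (rule d_sym)+
    ultimately have "dd Y p + \<delta> \<le> dd Y q" using q by linarith
    then show "\<exists>q. d p q = \<delta> \<and> dd Y p + \<delta> \<le> dd Y q" using q(1) by blast
  qed
qed

definition uniq :: "real \<Rightarrow> 'a \<Rightarrow> bool" where
  "uniq s p \<longleftrightarrow> (\<forall>x y y'. d p x < s \<longrightarrow> d p y < s \<longrightarrow> d p y' < s \<longrightarrow> x \<noteq> p \<longrightarrow>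
        d x y = d x p + d p y \<longrightarrow> d x y' = d x p + d p y' \<longrightarrow> d p y = d p y' \<longrightarrow> y = y')"

lemma shortestD: "shortest d \<sigma> D \<Longrightarrow> 0 \<le> s \<Longrightarrow> s \<le> D \<Longrightarrow> 0 \<le> t \<Longrightarrow> t \<le> D \<Longrightarrow> d (\<sigma> s) (\<sigma> t) = \<bar>s - t\<bar>"
  by (simp add: shortest_def)

text \<open>The third condition on each path places \<open>p\<close> between \<open>q\<close> and
  its initial point, hence between \<open>q\<close> and every point of the path. Seen from
  \<open>q\<close>, the two paths are continuations beyond \<open>p\<close> of the same segment, and
  branching at \<open>p\<close> is excluded.\<close>

lemma agree_near:
  assumes u: "uniq s p" and q: "d p q < s" "q \<noteq> p" 
    and \<sigma>: "shortest d \<sigma> D" "\<sigma> D = p" "d q p + D \<le> d q (\<sigma> 0)"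
    and \<tau>: "shortest d \<tau> D" "\<tau> D = p" "d q p + D \<le> d q (\<tau> 0)"
    and t: "0 \<le> t" "t \<le> D" "D - t < s"
  shows "\<sigma> t = \<tau> t"
proof -
  have *: "d p (\<mu> t) = D - t \<and> d q (\<mu> t) = d q p + (D - t)"
    if \<mu>: "shortest d \<mu> D" "\<mu> D = p" "d q p + D \<le> d q (\<mu> 0)" for \<mu>
  proof -
    have 1: "d p (\<mu> t) = D - t" using shortestD[OF \<mu>(1), of D t] \<mu>(2) t by simp
    have 2: "d (\<mu> t) (\<mu> 0) = t" using shortestD[OF \<mu>(1), of t 0] t by simp
    have "d q (\<mu> t) \<le> d q p + (D - t)" using d_triangle[of q "\<mu> t" p] 1 by simp
    moreover have "d q p + D \<le> d q (\<mu> t) + t" using d_triangle[of q "\<mu> 0" "\<mu> t"] 2 \<mu>(3) by simp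
    ultimately show ?thesis using 1 by linarith
  qed
  show ?thesis
    using u[unfolded uniq_def, rule_format, of q "\<sigma> t" "\<tau> t"] q t(3) *[OF \<sigma>] *[OF \<tau>] by simp
qed

text \<open>Let \<open>r\<close> be the infimum of the times from which the paths agree up to
  \<open>D\<close>. They agree at \<open>r\<close> because both move with unit speed. If
  \<open>r\<close> were positive, a point of the common part beyond \<open>r\<close> could replace
  \<open>q\<close>, and agreement would extend below \<open>r\<close>.\<close>

lemma agree_all:
  assumes u: "uniq s p" "0 < s" and q: "d p q < s" "q \<noteq> p" and D: "0 < D"
    and \<sigma>: "shortest d \<sigma> D" "\<sigma> D = p" "d q p + D \<le> d q (\<sigma> 0)"
    and \<tau>: "shortest d \<tau> D" "\<tau> D = p" "d q p + D \<le> d q (\<tau> 0)"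
    and t: "0 \<le> t" "t \<le> D"
  shows "\<sigma> t = \<tau> t"
proof -
  define E where "E = {t\<in>{0..D}. \<forall>u\<in>{t..D}. \<sigma> u = \<tau> u}"
  define r where "r = Inf E"
  have bdd: "bdd_below E" by (rule bdd_belowI[of _ 0]) (simp add: E_def)
  define a where "a = max 0 (D - s / 2)"
  have a: "0 \<le> a" "a < D" "D - a < s" using u(2) D by (auto simp: a_def)
  have "a \<in> E"
    unfolding E_def using a agree_near[OF u(1) q \<sigma> \<tau>] by auto
  then have rD: "r < D" using cInf_lower[OF _ bdd, of a] a by (simp add: r_def)
  have Ene: "E \<noteq> {}" using \<open>a \<in> E\<close> by blast
  have r0: "0 \<le> r" unfolding r_def by (rule cInf_greatest[OF Ene]) (simp add: E_def)
  have above: "\<sigma> u = \<tau> u" if ru: "r < u" "u \<le> D" for u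
  proof -
    obtain v where "v \<in> E" "v < u" using cInf_lessD[OF Ene, of u] ru(1) by (auto simp: r_def)
    then show ?thesis using ru(2) by (simp add: E_def)
  qed
  have at_r: "\<sigma> r = \<tau> r"
  proof (rule ccontr)
    assume "\<sigma> r \<noteq> \<tau> r"
    then have pos: "0 < d (\<sigma> r) (\<tau> r)" by (rule d_pos)
    define v where "v = min D (r + d (\<sigma> r) (\<tau> r) / 4)"
    have v: "r < v" "v \<le> D" "v - r \<le> d (\<sigma> r) (\<tau> r) / 4" using rD pos
      by (auto simp: v_def min_def)
    have "d (\<sigma> r) (\<sigma> v) = v - r" "d (\<tau> r) (\<tau> v) = v - r"
      using shortestD[OF \<sigma>(1), of r v] shortestD[OF \<tau>(1), of r v] r0 rD v by auto
    moreover have "d (\<sigma> r) (\<tau> r) \<le> d (\<sigma> r) (\<sigma> v) + d (\<sigma> v) (\<tau> r)" by (rule d_triangle)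
    moreover have "d (\<sigma> v) (\<tau> r) = d (\<tau> r) (\<tau> v)" using above[OF v(1,2)] d_sym by simp
    ultimately show False using v pos by linarith
  qed
  have "r = 0"
  proof (rule ccontr)
    assume "r \<noteq> 0"
    then have rpos: "0 < r" using r0 by simp
    obtain s' where s': "0 < s'" "uniq s' (\<sigma> r)" using extension_unique[of "\<sigma> r"] unfolding uniq_def by blast
    define h where "h = min (D - r) (s' / 2)"
    have h: "0 < h" "r + h \<le> D" "h < s'" using rD s' by (auto simp: h_def)
    \<comment> \<open>A common point of both paths slightly after time \<open>r\<close>; with
      respect to \<open>\<sigma> r\<close> it plays the role that \<open>q\<close> has with respect
      to \<open>p\<close>.\<close>
    define q' where "q' = \<sigma> (r + h)"
    have q'\<tau>: "q' = \<tau> (r + h)" using above[of "r + h"] h by (simp add: q'_def)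
    have d1: "d q' (\<sigma> r) = h" "d q' (\<sigma> 0) = r + h" "d q' (\<tau> 0) = r + h"
      using shortestD[OF \<sigma>(1), of "r + h" r] shortestD[OF \<sigma>(1), of "r + h" 0]
        shortestD[OF \<tau>(1), of "r + h" 0] h r0 rD q'\<tau> by (auto simp: q'_def)
    have sub: "shortest d \<sigma> r" "shortest d \<tau> r"
      using \<sigma>(1) \<tau>(1) rD by (auto simp: shortest_def)
    have q's: "d (\<sigma> r) q' < s'" "q' \<noteq> \<sigma> r" using d1(1) h d_sym[of q' "\<sigma> r"] by auto
    define b where "b = max 0 (r - s' / 2)"
    have b: "0 \<le> b" "b < r" "r - b < s'" using s'(1) rpos by (auto simp: b_def)
    have "b \<in> E"
      unfolding E_def
    proof (intro CollectI conjI ballI)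
      show "b \<in> {0..D}" using b rD by simp
      fix v assume v: "v \<in> {b..D}"
      show "\<sigma> v = \<tau> v"
      proof (cases "r < v")
        case True
        then show ?thesis using above v by simp
      next
        case False
        show ?thesis
          by (rule agree_near[OF s'(2) q's sub(1) refl _ sub(2) at_r[symmetric]])
            (use d1 b v False in auto)
      qed
    qed
    then have "r \<le> b" unfolding r_def by (rule cInf_lower[OF _ bdd])
    then show False using b by simp
  qed
  then show ?thesis using above[of t] at_r t by (cases "t = 0") auto
qed

text \<open>\<open>upper\<close> and \<open>lower\<close> are the sequential forms of the two
  Kuratowski inclusions. The former prevents the distance from \<open>X n\<close> to
  \<open>p\<close> from dropping below \<open>D\<close> in the limit; the latter approximates each
  point of \<open>X0\<close> by points of \<open>X n\<close>, so that the prolongation inequality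
  passes to the limit.\<close>

theorem not_two_seg_limit:
  fixes X :: "nat \<Rightarrow> 'a set" and X0 :: "'a set"
  assumes X: "\<And>n. closed (X n)" "\<And>n. X n \<noteq> {}" and X0: "closed X0"
    and lower: "\<And>x e. x \<in> X0 \<Longrightarrow> 0 < e \<Longrightarrow> \<forall>\<^sub>F n in sequentially. \<exists>y\<in>X n. d y x < e"
    and upper: "\<And>k y l. strict_mono k \<Longrightarrow> (\<And>n. y n \<in> X (k n)) \<Longrightarrow> y \<longlonglongrightarrow> l \<Longrightarrow> l \<in> X0"
    and U: "open U" "p \<in> U" and no: "\<And>n q. q \<in> U \<Longrightarrow> \<not> two_seg (X n) q"
  shows "\<not> two_seg X0 p"
proof
  assume "two_seg X0 p"
  define D where "D = dd X0 p"
  obtain \<sigma> \<tau> t where \<sigma>: "shortest d \<sigma> D" "\<sigma> 0 \<in> X0" "\<sigma> D = p" and \<tau>: "shortest d \<tau> D" "\<tau> 0 \<in> X0" "\<tau> D = p"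
    and t: "0 \<le> t" "t \<le> D" "\<sigma> t \<noteq> \<tau> t"
    using \<open>two_seg X0 p\<close> unfolding two_seg_def D_def by fastforce
  have X0ne: "X0 \<noteq> {}" using \<sigma>(2) by blast
  have Dpos: "0 < D"
  proof (rule ccontr)
    assume "\<not> 0 < D"
    then have "t = D" using t by simp
    then show False using t(3) \<sigma>(3) \<tau>(3) by simp
  qed
  obtain s where s: "0 < s" "uniq s p" using extension_unique[of p] unfolding uniq_def by blast
  obtain e where e: "0 < e" "\<And>q. d p q < e \<Longrightarrow> q \<in> U" using U unfolding open_iff_d[of U] by blast
  obtain \<delta>1 where \<delta>1: "0 < \<delta>1"
    "\<And>Y \<delta>. closed Y \<Longrightarrow> Y \<noteq> {} \<Longrightarrow> 0 < \<delta> \<Longrightarrow> \<delta> \<le> \<delta>1 \<Longrightarrow> 3 * \<delta> \<le> dd Y p \<Longrightarrow>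
       (\<And>q. d p q \<le> \<delta> \<Longrightarrow> \<not> two_seg Y q) \<Longrightarrow> \<exists>q. d p q = \<delta> \<and> dd Y p + \<delta> \<le> dd Y q"
    using prolongation[of p] by metis
  \<comment> \<open>The four bounds serve the prolongation lemma, the range in which branching is
    excluded, the neighbourhood \<open>U\<close>, and the condition
    \<open>3 * \<delta> \<le> dd (X n) p\<close>, which holds as soon as the right-hand side exceeds
    \<open>D / 2\<close>.\<close>
  define \<delta> where "\<delta> = min (min \<delta>1 (s / 2)) (min (e / 2) (D / 6))"
  have \<delta>: "0 < \<delta>" "\<delta> \<le> \<delta>1" "\<delta> < s" "\<delta> < e" "6 * \<delta> \<le> D"
    using \<delta>1(1) s(1) e(1) Dpos by (auto simp: \<delta>_def)
  have liminf: "\<forall>\<^sub>F n in sequentially. D - \<eta> < dd (X n) p" if \<eta>: "0 < \<eta>" for \<eta>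
  proof (rule ccontr)
    assume "\<not> (\<forall>\<^sub>F n in sequentially. D - \<eta> < dd (X n) p)"
    then have "\<exists>\<^sub>F n in sequentially. dd (X n) p \<le> D - \<eta>"
      by (simp add: frequently_def not_le)
    then have "infinite {n. dd (X n) p \<le> D - \<eta>}"
      unfolding frequently_cofinite[symmetric] cofinite_eq_sequentially .
    then obtain k :: "nat \<Rightarrow> nat" where k: "strict_mono k" "\<And>n. k n \<in> {n. dd (X n) p \<le> D - \<eta>}"
      using infinite_enumerate by blast
    have "\<exists>y\<in>X (k n). d p y \<le> D - \<eta>" for n
    proof -
      obtain y where "y \<in> X (k n)" "d p y = dd (X (k n)) p" by (rule dd_attained[OF X])
      then show ?thesis using k(2)[of n] by (intro bexI[of _ y]) auto
    qed
    then obtain y where y: "\<And>n. y n \<in> X (k n)" "\<And>n. d p (y n) \<le> D - \<eta>" by metis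
    obtain l j where lj: "strict_mono j" "(y \<circ> j) \<longlonglongrightarrow> l" by (rule bounded_subseq[OF y(2)])
    have "l \<in> X0"
      by (rule upper[OF strict_mono_o[OF k(1) lj(1)] _ lj(2)]) (use y(1) in simp)
    then have "D \<le> d p l" unfolding D_def by (rule dd_le)
    moreover have "d p l \<le> D - \<eta>"
      by (rule LIMSEQ_le_const2[OF tendsto_d(2)[OF lj(2), of p]]) (use y(2) in auto)
    ultimately show False using \<eta> by simp
  qed
  have "\<forall>\<^sub>F n in sequentially. \<exists>q. d p q = \<delta> \<and> dd (X n) p + \<delta> \<le> dd (X n) q"
    using liminf[OF half_gt_zero[OF Dpos]]
  proof eventually_elim
    case (elim n)
    show ?case
      by (rule \<delta>1(2)[OF X \<delta>(1,2)]) (use elim Dpos \<delta> e(2) no in auto)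
  qed
  then obtain N where N: "\<And>n. N \<le> n \<Longrightarrow> \<exists>q. d p q = \<delta> \<and> dd (X n) p + \<delta> \<le> dd (X n) q"
    unfolding eventually_sequentially by blast
  then have "\<exists>q. d p q = \<delta> \<and> dd (X (n + N)) p + \<delta> \<le> dd (X (n + N)) q" for n
    by simp
  then obtain q where q: "\<And>n. d p (q n) = \<delta>" "\<And>n. dd (X (n + N)) p + \<delta> \<le> dd (X (n + N)) (q n)"
    by metis
  obtain l k where lk: "strict_mono k" "(q \<circ> k) \<longlonglongrightarrow> l"
    by (rule bounded_subseq[of p q \<delta>]) (use q(1) in auto)
  have pl: "d p l = \<delta>"
    using LIMSEQ_unique[OF tendsto_d(2)[OF lk(2), of p]] q(1) by simp
  have far: "d l p + D \<le> d l x" if x: "x \<in> X0" for x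
  proof (rule field_le_epsilon)
    fix \<eta> :: real assume \<eta>: "0 < \<eta>"
    \<comment> \<open>The point \<open>q n\<close> was obtained for the set with index
      \<open>n + N\<close>.\<close>
    define m where "m = (\<lambda>n. k n + N)"
    have m: "filterlim m sequentially sequentially"
      unfolding m_def
      by (rule filterlim_compose[OF filterlim_add_const_nat_at_top filterlim_subseq[OF lk(1)]])
    have 1: "\<forall>\<^sub>F n in sequentially. D - \<eta> / 3 < dd (X (m n)) p"
      using eventually_compose_filterlim[OF liminf[of "\<eta> / 3"] m] \<eta> by simp
    have 2: "\<forall>\<^sub>F n in sequentially. \<exists>y\<in>X (m n). d y x < \<eta> / 3"
      using eventually_compose_filterlim[OF lower[OF x, of "\<eta> / 3"] m] \<eta> by simp
    have 3: "\<forall>\<^sub>F n in sequentially. d ((q \<circ> k) n) l < \<eta> / 3"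
      using lk(2)[unfolded tendsto_iff_d, rule_format, of "\<eta> / 3"] \<eta> by simp
    have "\<forall>\<^sub>F n in sequentially. d l p + D \<le> d l x + \<eta>"
      using 1 2 3
    proof eventually_elim
      case (elim n)
      then obtain y where y: "y \<in> X (m n)" "d y x < \<eta> / 3" by blast
      have "dd (X (m n)) p + \<delta> \<le> dd (X (m n)) (q (k n))" using q(2)[of "k n"] by (simp add: m_def)
      also have "\<dots> \<le> d (q (k n)) y" by (rule dd_le[OF y(1)])
      also have "\<dots> \<le> d (q (k n)) l + d l x + d y x"
        using d_triangle[of "q (k n)" y l] d_triangle[of l y x] d_sym[of x y] by linarith
      finally show ?case using elim y pl d_sym[of l p] by (simp add: o_def)
    qed
    then show "d l p + D \<le> d l x + \<eta>" by simp
  qed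
  have "\<sigma> t = \<tau> t"
    by (rule agree_all[OF s(2,1) _ _ Dpos \<sigma>(1,3) far[OF \<sigma>(2)] \<tau>(1,3) far[OF \<tau>(2)] t(1,2)])
      (use pl \<delta> in auto)
  then show False using t(3) by simp
qed

end

section \<open>Shortest paths and geodesics\<close>

context normal_chart
begin

text \<open>Interior points of the solution are known to lie in \<open>N1\<close> but not in
  \<open>N3\<close>, so there \<open>\<rho>\<close> is only an upper bound for the distance. The
  lower bound follows from the distance of the end points by the triangle inequality.\<close>

lemma near_joined:
  assumes "d p x < s3" "d p y < s3"
  shows "joined d x y"
proof -
  obtain a where a: "a \<in> N3" "x = iv a" by (rule near_N3[OF assms(1)])
  obtain b where b: "b \<in> N3" "y = iv b" by (rule near_N3[OF assms(2)])
  note N2 = N3_N2[OF a(1)] N3_N2[OF b(1)] and N1 = N3_N1[OF a(1)] N3_N1[OF b(1)]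
  define D where "D = d x y"
  have D: "D = \<rho> a b" using d_eq_rho[OF a(1) b(1)] a b by (simp add: D_def)
  have D0: "0 \<le> D" unfolding D_def by (rule d_nonneg)
  define \<sigma> where "\<sigma> = (\<lambda>t. iv (gpath a b (t / D)))"
  note P = path_sol[OF N1]
  have ends: "\<sigma> 0 = x" "\<sigma> D = y"
  proof -
    show "\<sigma> 0 = x" using P a by (simp add: \<sigma>_def)
    show "\<sigma> D = y"
    proof (cases "D = 0")
      case True
      then have "a = b" using D rho_eq0[OF N1] by simp
      then show ?thesis using True P a b by (simp add: \<sigma>_def)
    next
      case False
      then show ?thesis using P b by (simp add: \<sigma>_def)
    qed
  qed
  have upper: "d (\<sigma> s) (\<sigma> t) \<le> \<bar>s - t\<bar>" if st: "s \<in> {0..D}" "t \<in> {0..D}" for s t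
  proof (cases "D = 0")
    case True
    then have "s = t" using st by simp
    then show ?thesis using d_self by simp
  next
    case False
    then have Dpos: "0 < D" using D0 by simp
    have st': "s / D \<in> {0..1}" "t / D \<in> {0..1}" using st Dpos by (simp_all add: field_simps)
    have "d (\<sigma> s) (\<sigma> t) \<le> \<rho> (gpath a b (s / D)) (gpath a b (t / D))"
      unfolding \<sigma>_def by (intro riem_dist_le linked_rho path_in_N1[OF N2] st')
    also have "\<dots> = \<bar>t / D - s / D\<bar> * D" using rho_along_path[OF N2 st'] D by simp
    also have "\<dots> = \<bar>(t - s) / D\<bar> * D" by (simp add: diff_divide_distrib)
    also have "\<dots> = \<bar>s - t\<bar>" using Dpos by (simp add: abs_minus_commute)
    finally show ?thesis .
  qed
  have lower: "t - s \<le> d (\<sigma> s) (\<sigma> t)" if st: "s \<in> {0..D}" "t \<in> {0..D}" for s t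
  proof -
    have "D \<le> d (\<sigma> 0) (\<sigma> s) + (d (\<sigma> s) (\<sigma> t) + d (\<sigma> t) (\<sigma> D))"
      using d_triangle[of "\<sigma> 0" "\<sigma> D" "\<sigma> s"] d_triangle[of "\<sigma> s" "\<sigma> D" "\<sigma> t"] ends by (simp add: D_def)
    then show ?thesis using upper[of 0 s] upper[of t D] st D0 by simp
  qed
  have "shortest d \<sigma> D"
    unfolding shortest_def
  proof (intro ballI)
    fix s t assume st: "s \<in> {0..D}" "t \<in> {0..D}"
    show "d (\<sigma> s) (\<sigma> t) = \<bar>s - t\<bar>"
      using upper[OF st] lower[OF st] lower[OF st(2,1)] d_sym[of "\<sigma> s" "\<sigma> t"] by linarith
  qed
  then show ?thesis unfolding joined_def using ends D_def by blast
qed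

lemma near_extension_unique:
  assumes near: "d p x < s3" "d p y < s3" "d p y' < s3" and ne: "x \<noteq> p"
    and eq: "d x y = d x p + d p y" "d x y' = d x p + d p y'" "d p y = d p y'"
  shows "y = y'"
proof -
  obtain a where a: "a \<in> N3" "x = iv a" by (rule near_N3[OF near(1)])
  obtain b where b: "b \<in> N3" "y = iv b" by (rule near_N3[OF near(2)])
  obtain b' where b': "b' \<in> N3" "y' = iv b'" by (rule near_N3[OF near(3)])
  have ax: "a \<noteq> x0" using ne a iv_x0 by auto
  have r: "d x y = \<rho> a b" "d x y' = \<rho> a b'" "d x p = \<rho> a x0" "d p y = \<rho> x0 b" "d p y' = \<rho> x0 b'"
    using d_eq_rho[OF a(1) b(1)] d_eq_rho[OF a(1) b'(1)] d_eq_rho[OF a(1) x0_N3]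
      d_eq_rho[OF x0_N3 b(1)] d_eq_rho[OF x0_N3 b'(1)] iv_x0 a b b' by simp_all
  have "b = b'"
    using extension_unique[OF N3_N2[OF a(1)] x0_N2 N3_N2[OF b(1)] N3_N2[OF b'(1)] ax] eq unfolding r by blast
  then show ?thesis using b b' by simp
qed

lemma near_extension_exists:
  "\<exists>\<delta>0>0. \<forall>\<delta> z. 0 < \<delta> \<longrightarrow> \<delta> \<le> \<delta>0 \<longrightarrow> continuous_on {q. d p q \<le> \<delta>} z \<longrightarrow>
        (\<forall>q. d p q \<le> \<delta> \<longrightarrow> d p (z q) < s3 \<and> z q \<noteq> p) \<longrightarrow> (\<exists>q. d p q = \<delta> \<and> d (z q) q = d (z q) p + \<delta>)"
proof (rule extension_exists)
  fix \<delta>0 assume \<delta>0: "0 < \<delta>0"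
    "\<And>\<delta> z. 0 < \<delta> \<Longrightarrow> \<delta> \<le> \<delta>0 \<Longrightarrow> continuous_on {b\<in>N2. \<rho> x0 b \<le> \<delta>} z \<Longrightarrow>
      (\<And>b. b \<in> N2 \<Longrightarrow> \<rho> x0 b \<le> \<delta> \<Longrightarrow> z b \<in> N2 \<and> z b \<noteq> x0) \<Longrightarrow>
      \<exists>q\<in>N2. \<rho> x0 q = \<delta> \<and> \<rho> (z q) q = \<rho> (z q) x0 + \<delta>"
  show ?thesis
  proof (intro exI[of _ "min \<delta>0 (s3 / 2)"] conjI allI impI)
    show "0 < min \<delta>0 (s3 / 2)" using \<delta>0(1) s3_pos by simp
    fix \<delta> z assume \<delta>: "0 < \<delta>" "\<delta> \<le> min \<delta>0 (s3 / 2)" and z: "continuous_on {q. d p q \<le> \<delta>} z"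
      and zq: "\<forall>q. d p q \<le> \<delta> \<longrightarrow> d p (z q) < s3 \<and> z q \<noteq> p"
    \<comment> \<open>The bound \<open>\<delta> \<le> s3 / 2\<close> confines the points in question
      to \<open>N3\<close>, where \<open>\<rho>\<close> is the distance.\<close>
    have bN3: "b \<in> N3" if b: "b \<in> N2" "\<rho> x0 b \<le> \<delta>" for b
    proof -
      have "norm (b - x0) \<le> 2 * K * \<rho> x0 b" by (rule rho_lower[OF x0_N1 N2_N1[OF b(1)]])
      also have "\<dots> \<le> 2 * K * (s3 / 2)" using b(2) \<delta>(2) K_ge1 by (intro mult_left_mono) auto
      also have "\<dots> = r3 / 2" using K_ge1 by (simp add: s3_def)
      also have "\<dots> < r3" using r3(1) by simp
      finally show ?thesis by (simp add: N3_norm)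
    qed
    have dp: "d p (iv b) = \<rho> x0 b" if "b \<in> N3" for b
      using d_eq_rho[OF x0_N3 that] iv_x0 by simp
    define z' where "z' = (\<lambda>b. snd c (z (iv b)))"
    have z': "z' b \<in> N3 \<and> iv (z' b) = z (iv b)" if b: "b \<in> N2" "\<rho> x0 b \<le> \<delta>" for b
    proof -
      have "d p (z (iv b)) < s3" using zq dp[OF bN3[OF b]] b(2) by simp
      then obtain w where w: "w \<in> N3" "z (iv b) = iv w" by (rule near_N3)
      then have "z' b = w" using iv_right[OF N3_B[OF w(1)]] by (simp add: z'_def)
      then show ?thesis using w by simp
    qed
    define S where "S = {b\<in>N2. \<rho> x0 b \<le> \<delta>}"
    have "continuous_on S z'"
      unfolding z'_def
    proof (rule continuous_on_compose2[OF homeomorphism_cont1[OF chart(3)[OF cA]]])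
      have "continuous_on S iv" by (rule continuous_on_iv) (use bN3 N3_B in \<open>auto simp: S_def\<close>)
      then show "continuous_on S (\<lambda>b. z (iv b))"
        by (rule continuous_on_compose2[OF z]) (use dp bN3 in \<open>auto simp: S_def\<close>)
      show "(\<lambda>b. z (iv b)) ` S \<subseteq> fst c"
      proof (rule image_subsetI)
        fix b assume "b \<in> S"
        then have "z' b \<in> N3" "z (iv b) = iv (z' b)" using z'[of b] by (simp_all add: S_def)
        then show "z (iv b) \<in> fst c" using iv_in[OF N3_B] by simp
      qed
    qed
    moreover have "z' b \<in> N2 \<and> z' b \<noteq> x0" if b: "b \<in> N2" "\<rho> x0 b \<le> \<delta>" for b
    proof -
      have "z (iv b) \<noteq> p" using zq dp[OF bN3[OF b]] b(2) by simp
      then have "z' b \<noteq> x0" using z'[OF b] iv_x0 by auto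
      then show ?thesis using z'[OF b] N3_N2 by blast
    qed
    ultimately obtain q where q: "q \<in> N2" "\<rho> x0 q = \<delta>" "\<rho> (z' q) q = \<rho> (z' q) x0 + \<delta>"
      using \<delta>0(2)[of \<delta> z'] \<delta> unfolding S_def by auto
    have qN: "q \<in> N3" by (rule bN3[OF q(1)]) (simp add: q(2))
    have zN: "z' q \<in> N3" "iv (z' q) = z (iv q)" using z'[OF q(1)] q(2) by simp_all
    have "d p (iv q) = \<delta>" using dp[OF qN] q(2) by simp
    moreover have "d (z (iv q)) (iv q) = d (z (iv q)) p + \<delta>"
      using d_eq_rho[OF zN(1) qN] d_eq_rho[OF zN(1) x0_N3] q(3) zN(2) iv_x0 by simp
    ultimately show "\<exists>q. d p q = \<delta> \<and> d (z q) q = d (z q) p + \<delta>" by blast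
  qed
qed

lemma near_compact: "compact (iv ` cball x0 rad) \<and> {q. d p q < s3} \<subseteq> iv ` cball x0 rad"
proof (intro conjI subsetI)
  show "compact (iv ` cball x0 rad)"
    by (intro compact_continuous_image continuous_on_iv compact_cball) (use rad(3) in auto)
  fix q assume "q \<in> {q. d p q < s3}"
  then have "d p q < s3" by simp
  then obtain b where "b \<in> N3" "q = iv b" by (rule near_N3)
  then show "q \<in> iv ` cball x0 rad" using N3_rad ball_subset_cball by blast
qed

text \<open>On a short interval about \<open>t\<close> every point of the curve lies between the two
  extreme ones, so by \<open>between_on_path\<close> the curve is an affine reparametrisation of a
  solution and inherits its equation. The interval is clipped to \<open>[0, D]\<close>, which covers
  the end points.\<close>

lemma near_regular:
  assumes \<gamma>: "shortest d \<gamma> D" "0 < D" and t: "t \<in> {0..D}" "\<gamma> t = p"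
  shows "\<exists>e x' x''. 0 < e \<and> (\<forall>s\<in>{0..D}. \<bar>s - t\<bar> < e \<longrightarrow>
    ((snd c \<circ> \<gamma>) has_vector_derivative x' s) (at s within {0..D}) \<and>
    (x' has_vector_derivative x'' s) (at s within {0..D}) \<and>
    x'' s = acc c (snd c (\<gamma> s)) (x' s) \<and> g c (snd c (\<gamma> s)) (x' s) (x' s) = 1)"
proof -
  define e where "e = s3 / 2"
  have e: "0 < e" "e < s3" using s3_pos by (simp_all add: e_def)
  define s1 where "s1 = max 0 (t - e)"
  define s2 where "s2 = min D (t + e)"
  have s12: "0 \<le> s1" "s1 \<le> t" "t \<le> s2" "s2 \<le> D" "s1 < s2" "t - e \<le> s1" "s2 \<le> t + e"
    using t \<gamma>(2) e(1) by (auto simp: s1_def s2_def)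
  define l where "l = s2 - s1"
  have l: "0 < l" using s12 by (simp add: l_def)
  have dg: "d (\<gamma> u) (\<gamma> v) = \<bar>u - v\<bar>" if "u \<in> {0..D}" "v \<in> {0..D}" for u v
    using \<gamma>(1) that by (simp add: shortest_def)
  define x where "x = (\<lambda>s. snd c (\<gamma> s))"
  have sub: "s \<in> {0..D}" if "s \<in> {s1..s2}" for s using that s12 by simp
  have N3x: "x s \<in> N3 \<and> iv (x s) = \<gamma> s" if s: "s \<in> {s1..s2}" for s
  proof -
    have "d p (\<gamma> s) = \<bar>t - s\<bar>" using dg[OF t(1) sub[OF s]] t(2) by simp
    also have "\<dots> \<le> e" using s s12 by auto
    finally have "d p (\<gamma> s) < s3" using e(2) by simp
    then obtain w where w: "w \<in> N3" "\<gamma> s = iv w" by (rule near_N3)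
    then have "x s = w" using iv_right[OF N3_B[OF w(1)]] by (simp add: x_def)
    then show ?thesis using w by simp
  qed
  have rx: "\<rho> (x u) (x v) = \<bar>u - v\<bar>" if "u \<in> {s1..s2}" "v \<in> {s1..s2}" for u v
    using d_eq_rho[of "x u" "x v"] N3x[OF that(1)] N3x[OF that(2)] dg[OF sub[OF that(1)] sub[OF that(2)]] by simp
  define a where "a = x s1"
  define b where "b = x s2"
  have ends: "s1 \<in> {s1..s2}" "s2 \<in> {s1..s2}" using s12 by auto
  have ab: "a \<in> N3" "b \<in> N3" using N3x ends by (simp_all add: a_def b_def)
  note N1 = N3_N1[OF ab(1)] N3_N1[OF ab(2)]
  have rab: "\<rho> a b = l" using rx[OF ends] s12 by (simp add: a_def b_def l_def)
  have aneb: "a \<noteq> b" using rho_eq0[OF N1] rab l by auto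
  define f where "f = (\<lambda>s. (s - s1) / l)"
  have f01: "f s \<in> {0..1}" if "s \<in> {s1..s2}" for s using that l by (auto simp: f_def l_def field_simps)
  have xp: "x s = gpath a b (f s)" if s: "s \<in> {s1..s2}" for s
  proof -
    have ra: "\<rho> a (x s) = s - s1" and rb: "\<rho> (x s) b = s2 - s"
      using rx[OF ends(1) s] rx[OF s ends(2)] s by (auto simp: a_def b_def)
    have "\<rho> a b = \<rho> a (x s) + \<rho> (x s) b" using ra rb rab by (simp add: l_def)
    then have "x s = gpath a b (\<rho> a (x s) / \<rho> a b)"
      using between_on_path[OF N3_N2[OF ab(1)] N3_N2 N3_N2[OF ab(2)] aneb] N3x[OF s] by blast
    then show ?thesis by (simp add: ra rab f_def)
  qed
  define x' where "x' = (\<lambda>s. (1 / l) *\<^sub>R vel a b (f s))"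
  define x'' where "x'' = (\<lambda>s. (1 / l) *\<^sub>R ((1 / l) *\<^sub>R acc c (gpath a b (f s)) (vel a b (f s))))"
  note P = path_sol[OF N1]
  have df: "(f has_vector_derivative 1 / l) (at s within {s1..s2})" for s
    unfolding f_def using l by (auto intro!: derivative_eq_intros simp flip: has_real_derivative_iff_has_vector_derivative)
  have fsub: "f ` {s1..s2} \<subseteq> {0..1}" using f01 by blast
  have dx: "(x has_vector_derivative x' s) (at s within {s1..s2})" if s: "s \<in> {s1..s2}" for s
  proof (rule has_vector_derivative_transform[OF s xp])
    show "((\<lambda>s. gpath a b (f s)) has_vector_derivative x' s) (at s within {s1..s2})"
      using vector_diff_chain_within[OF df has_vector_derivative_within_subset[OF is_solD(3)[OF P(1) f01[OF s]] fsub]]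
      by (simp add: o_def x'_def)
  qed
  have dx': "(x' has_vector_derivative x'' s) (at s within {s1..s2})" if s: "s \<in> {s1..s2}" for s
  proof -
    have "((\<lambda>s. vel a b (f s)) has_vector_derivative (1 / l) *\<^sub>R acc c (gpath a b (f s)) (vel a b (f s))) (at s within {s1..s2})"
      using vector_diff_chain_within[OF df has_vector_derivative_within_subset[OF is_solD(4)[OF P(1) f01[OF s]] fsub]]
      by (simp add: o_def)
    from has_vector_derivative_scaleR[OF DERIV_const[of "1 / l"] this]
    show ?thesis by (simp add: x'_def x''_def)
  qed
  have within: "s \<in> {s1..s2} \<and> at s within {s1..s2} = at s within {0..D}"
    if s: "s \<in> {0..D}" "\<bar>s - t\<bar> < e" for s
  proof
    show "s \<in> {s1..s2}" using s by (auto simp: s1_def s2_def)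
    show "at s within {s1..s2} = at s within {0..D}"
    proof (rule at_within_nhd[of s "{t - e<..<t + e}"])
      show "s \<in> {t - e<..<t + e}" using s(2) by auto
      show "{s1..s2} \<inter> {t - e<..<t + e} - {s} = {0..D} \<inter> {t - e<..<t + e} - {s}"
        by (auto simp: s1_def s2_def)
    qed simp
  qed
  show ?thesis
  proof (rule exI[of _ e], rule exI[of _ x'], rule exI[of _ x''], intro conjI e(1) ballI impI)
    fix s assume s: "s \<in> {0..D}" "\<bar>s - t\<bar> < e"
    have s': "s \<in> {s1..s2}" and w: "at s within {s1..s2} = at s within {0..D}" using within[OF s] by blast+
    have gB: "gpath a b (f s) \<in> ball x0 R" by (rule is_solD(1)[OF P(1) f01[OF s']])
    show "((snd c \<circ> \<gamma>) has_vector_derivative x' s) (at s within {0..D})"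
      using dx[OF s'] unfolding w x_def by (simp add: o_def)
    show "(x' has_vector_derivative x'' s) (at s within {0..D})"
      using dx'[OF s'] unfolding w .
    have xs: "snd c (\<gamma> s) = gpath a b (f s)" using xp[OF s'] by (simp add: x_def)
    show "x'' s = acc c (snd c (\<gamma> s)) (x' s)"
      unfolding xs x'_def x''_def by (simp add: Q_scale[OF gB] power2_eq_square)
    have "g c (gpath a b (f s)) (vel a b (f s)) (vel a b (f s)) = l\<^sup>2"
      using En_speed[OF N1 f01[OF s']] rho_sq[OF N1(1), of b] rab by simp
    then show "g c (snd c (\<gamma> s)) (x' s) (x' s) = 1"
      unfolding xs x'_def using l by (simp add: G_simps[OF gB] power2_eq_square)
  qed
qed

end

section \<open>Shortest paths in the metric sense are the minimal geodesics\<close>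

context riemannian_connected
begin

lemma linked_curve:
  assumes "piecewise_C1_curve A a b \<gamma>" "a \<le> u" "u < v" "v \<le> b"
  shows "linked (\<gamma> u) (\<gamma> v) (curve_length A g u v \<gamma>)"
  unfolding linked_def using piecewise_C1_subinterval[OF assms(1,2,4)] assms(3) by blast

lemma curve_length_split:
  assumes "piecewise_C1_curve A a b \<gamma>" "a \<le> u" "u \<le> v" "v \<le> w" "w \<le> b"
  shows "curve_length A g u v \<gamma> + curve_length A g v w \<gamma> = curve_length A g u w \<gamma>"
proof -
  have "speed A g \<gamma> integrable_on {u..w}"
    using speed_integrable[OF piecewise_C1_subinterval[OF assms(1,2,5)]] assms by simp
  then show ?thesis
    unfolding curve_length_def
    by (rule Henstock_Kurzweil_Integration.integral_combine[OF assms(3,4)])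
qed

lemma continuous_on_d: "continuous_on UNIV (d x)"
proof -
  have "(d x \<longlongrightarrow> d x q) (at q)" for q
    unfolding tendsto_iff
  proof (intro allI impI)
    fix e :: real assume e: "0 < e"
    have o: "open {y. d q y < e}"
      unfolding open_iff_d
    proof
      fix y assume y: "y \<in> {y. d q y < e}"
      show "\<exists>r>0. \<forall>w. d y w < r \<longrightarrow> w \<in> {y. d q y < e}"
      proof (intro exI[of _ "e - d q y"] conjI allI impI)
        show "0 < e - d q y" using y by simp
        show "w \<in> {y. d q y < e}" if "d y w < e - d q y" for w
          using that d_triangle[of q w y] by simp
      qed
    qed
    have "dist (d x y) (d x q) < e" if "y \<in> {y. d q y < e}" for y
      using that d_triangle[of x y q] d_triangle[of x q y] d_sym[of y q] by (auto simp: dist_real_def)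
    moreover have "q \<in> {y. d q y < e}" using e d_self by simp
    ultimately show "\<forall>\<^sub>F y in at q. dist (d x y) (d x q) < e"
      unfolding eventually_at_topological using o by blast
  qed
  then show ?thesis by (simp add: continuous_on_def)
qed

text \<open>On an almost shortest curve the intermediate value theorem gives a point at distance
  \<open>s\<close> from \<open>x\<close>. The part before it has length at least \<open>s\<close>,
  which bounds the length of the rest.\<close>

lemma almost_between:
  assumes s: "0 \<le> s" "s \<le> d x y" and e: "0 < e"
  shows "\<exists>m. d x m = s \<and> d m y < d x y - s + e"
proof -
  obtain l where l: "linked x y l" "l < d x y + e" using d_approx[of x y "d x y + e"] e by auto
  obtain a b \<gamma> where \<gamma>: "a < b" "piecewise_C1_curve A a b \<gamma>" "\<gamma> a = x" "\<gamma> b = y" "l = curve_length A g a b \<gamma>"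
    using l(1) unfolding linked_def by blast
  have "continuous_on {a..b} (\<lambda>t. d x (\<gamma> t))"
    by (rule continuous_on_compose2[OF continuous_on_d piecewise_C1_continuous[OF \<gamma>(2)]]) simp
  then obtain \<tau> where \<tau>: "a \<le> \<tau>" "\<tau> \<le> b" "d x (\<gamma> \<tau>) = s"
    using IVT'[of "\<lambda>t. d x (\<gamma> t)" a s b] s \<gamma>(1,3,4) d_self by auto
  \<comment> \<open>The extreme cases are separate because \<open>linked\<close> asks for a
    nondegenerate parameter interval.\<close>
  have "d (\<gamma> \<tau>) y < d x y - s + e"
  proof (cases "\<tau> = a \<or> \<tau> = b")
    case True
    then show ?thesis using \<tau>(3) \<gamma>(3,4) e d_self by auto
  next
    case False
    then have ab: "a < \<tau>" "\<tau> < b" using \<tau> by auto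
    have "s \<le> curve_length A g a \<tau> \<gamma>"
      using riem_dist_le[OF linked_curve[OF \<gamma>(2) order_refl ab(1) \<tau>(2)]] \<gamma>(3) \<tau>(3) by simp
    moreover have "d (\<gamma> \<tau>) y \<le> curve_length A g \<tau> b \<gamma>"
      using riem_dist_le[OF linked_curve[OF \<gamma>(2) \<tau>(1) ab(2) order_refl]] \<gamma>(4) by simp
    moreover have "curve_length A g a \<tau> \<gamma> + curve_length A g \<tau> b \<gamma> = l"
      using curve_length_split[OF \<gamma>(2) order_refl \<tau>(1,2) order_refl] \<gamma>(5) by simp
    ultimately show ?thesis using l(2) by linarith
  qed
  then show ?thesis using \<tau>(3) by blast
qed

lemma geodesic_space:
  assumes "riem_complete A g"
  shows "geodesic_space (riem_dist A g)"
proof (rule geodesic_space.intro)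
  show "0 \<le> d x y" for x y by (rule d_nonneg)
  show "(d x y = 0) = (x = y)" for x y by (rule d_eq0)
  show "d x y = d y x" for x y by (rule d_sym)
  show "d x z \<le> d x y + d y z" for x y z by (rule d_triangle)
  show "open U = (\<forall>p\<in>U. \<exists>e>0. \<forall>q. d p q < e \<longrightarrow> q \<in> U)" for U by (rule open_iff_d)
  show "Metric_space.mcomplete UNIV d" using assms by (simp add: riem_complete_def)
  show "\<exists>m. d x m = s \<and> d m y < d x y - s + e" if "0 \<le> s" "s \<le> d x y" "0 < e" for s x y e
    by (rule almost_between[OF that])
next
  fix p
  obtain c where c: "c \<in> A" "p \<in> fst c" using chart_cover by blast
  obtain R K where "normal_chart A g c p R K" by (rule normal_chart_exists[OF c])
  then interpret N: normal_chart A g c p R K .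
  show "\<exists>s>0. \<exists>Z. compact Z \<and> {q. d p q < s} \<subseteq> Z"
    using N.s3_pos N.near_compact by blast
  show "\<exists>s>0. \<forall>x y. d p x < s \<longrightarrow> d p y < s \<longrightarrow> joined d x y"
    using N.s3_pos N.near_joined by blast
  show "\<exists>s>0. \<forall>x y y'. d p x < s \<longrightarrow> d p y < s \<longrightarrow> d p y' < s \<longrightarrow> x \<noteq> p \<longrightarrow>
        d x y = d x p + d p y \<longrightarrow> d x y' = d x p + d p y' \<longrightarrow> d p y = d p y' \<longrightarrow> y = y'"
    using N.near_extension_unique by (intro exI[of _ N.s3] conjI N.s3_pos allI impI) 
  show "\<exists>s>0. \<exists>\<delta>0>0. \<forall>\<delta> z. 0 < \<delta> \<longrightarrow> \<delta> \<le> \<delta>0 \<longrightarrow> continuous_on {q. d p q \<le> \<delta>} z \<longrightarrow>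
        (\<forall>q. d p q \<le> \<delta> \<longrightarrow> d p (z q) < s \<and> z q \<noteq> p) \<longrightarrow> (\<exists>q. d p q = \<delta> \<and> d (z q) q = d (z q) p + \<delta>)"
    using N.near_extension_exists N.s3_pos by blast
qed

lemma shortest_continuous: 
  assumes "shortest d \<gamma> D"
  shows "continuous_on {0..D} \<gamma>"
  unfolding continuous_on_topological
proof (intro ballI allI impI)
  fix t B assume t: "t \<in> {0..D}" and B: "open B" "\<gamma> t \<in> B"
  obtain e where e: "0 < e" "\<And>q. d (\<gamma> t) q < e \<Longrightarrow> q \<in> B" using B unfolding open_iff_d[of B] by blast
  show "\<exists>S. open S \<and> t \<in> S \<and> (\<forall>s\<in>{0..D}. s \<in> S \<longrightarrow> \<gamma> s \<in> B)"
  proof (intro exI[of _ "ball t e"] conjI ballI impI)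
    fix s assume "s \<in> {0..D}" "s \<in> ball t e"
    then show "\<gamma> s \<in> B" using e(2)[of "\<gamma> s"] assms t by (simp add: shortest_def dist_real_def)
  qed (use e in auto)
qed

text \<open>Each time has a neighbourhood on which \<open>near_regular\<close> applies in any given
  chart around the corresponding point. Uniqueness of derivatives combines these local statements
  into the single velocity function required by \<open>geodesic\<close>.\<close>

lemma shortest_geodesic:
  assumes \<gamma>: "shortest d \<gamma> D" and D: "0 < D"
  shows "geodesic A g 0 D \<gamma>" "\<And>t. t \<in> {0<..<D} \<Longrightarrow> speed A g \<gamma> t = 1"
proof -
  have nt: "at t within {0..D} \<noteq> bot" if "t \<in> {0..D}" for t
    using that D by (simp add: trivial_limit_within islimpt_Icc)
  \<comment> \<open>A velocity defined for all times at once, one-sided at \<open>0\<close> and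
    \<open>D\<close>; by \<open>nt\<close> it agrees with the locally obtained derivatives.\<close>
  define v where "v = (\<lambda>(c :: ('a, 'e) chart) t. vector_derivative (snd c \<circ> \<gamma>) (at t within {0..D}))"
  have reg: "((snd c \<circ> \<gamma>) has_vector_derivative v c t) (at t within {0..D}) \<and>
     (v c has_vector_derivative acc c (snd c (\<gamma> t)) (v c t)) (at t within {0..D}) \<and>
     g c (snd c (\<gamma> t)) (v c t) (v c t) = 1"
    if c: "c \<in> A" "\<gamma> t \<in> fst c" and t: "t \<in> {0..D}" for c t
  proof -
    obtain R K where "normal_chart A g c (\<gamma> t) R K" by (rule normal_chart_exists[OF c])
    then interpret N: normal_chart A g c "\<gamma> t" R K .
    obtain e x' x'' where e0: "0 < e" and ex: "\<forall>s\<in>{0..D}. \<bar>s - t\<bar> < e \<longrightarrow>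
      ((snd c \<circ> \<gamma>) has_vector_derivative x' s) (at s within {0..D}) \<and>
      (x' has_vector_derivative x'' s) (at s within {0..D}) \<and>
      x'' s = acc c (snd c (\<gamma> s)) (x' s) \<and> g c (snd c (\<gamma> s)) (x' s) (x' s) = 1"
      using N.near_regular[OF \<gamma> D t refl] by blast
    have e: "0 < e"
      "\<And>s. s \<in> {0..D} \<Longrightarrow> \<bar>s - t\<bar> < e \<Longrightarrow> ((snd c \<circ> \<gamma>) has_vector_derivative x' s) (at s within {0..D})"
      "\<And>s. s \<in> {0..D} \<Longrightarrow> \<bar>s - t\<bar> < e \<Longrightarrow> (x' has_vector_derivative x'' s) (at s within {0..D})"
      "\<And>s. s \<in> {0..D} \<Longrightarrow> \<bar>s - t\<bar> < e \<Longrightarrow> x'' s = acc c (snd c (\<gamma> s)) (x' s)"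
      "\<And>s. s \<in> {0..D} \<Longrightarrow> \<bar>s - t\<bar> < e \<Longrightarrow> g c (snd c (\<gamma> s)) (x' s) (x' s) = 1"
      using e0 ex by blast+
    have vx: "v c s = x' s" if "s \<in> {0..D}" "\<bar>s - t\<bar> < e" for s
      unfolding v_def by (rule vector_derivative_within[OF nt[OF that(1)] e(2)[OF that]])
    have t0: "\<bar>t - t\<bar> < e" using e(1) by simp
    have "(v c has_vector_derivative x'' t) (at t within {0..D})"
      by (rule has_vector_derivative_transform_within[OF e(3)[OF t t0] e(1) t])
        (use vx in \<open>simp add: dist_real_def\<close>)
    then show ?thesis using e(2,4,5)[OF t t0] vx[OF t t0] by simp
  qed
  have cont: "continuous_on {0..D} \<gamma>" by (rule shortest_continuous[OF \<gamma>])
  show "geodesic A g 0 D \<gamma>"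
    unfolding geodesic_def
  proof (intro conjI cont ballI)
    fix c assume c: "c \<in> A"
    show "\<exists>\<gamma>' \<gamma>''. \<forall>t\<in>{0..D}. \<gamma> t \<in> fst c \<longrightarrow>
        ((snd c \<circ> \<gamma>) has_vector_derivative \<gamma>' t) (at t within {0..D}) \<and>
        (\<gamma>' has_vector_derivative \<gamma>'' t) (at t within {0..D}) \<and>
        \<gamma>'' t + christoffel g c (snd c (\<gamma> t)) (\<gamma>' t) (\<gamma>' t) = 0"
    proof (rule exI[of _ "v c"], rule exI[of _ "\<lambda>t. acc c (snd c (\<gamma> t)) (v c t)"], intro ballI impI)
      fix t assume "t \<in> {0..D}" "\<gamma> t \<in> fst c"
      then show "((snd c \<circ> \<gamma>) has_vector_derivative v c t) (at t within {0..D}) \<and>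
        (v c has_vector_derivative acc c (snd c (\<gamma> t)) (v c t)) (at t within {0..D}) \<and>
        acc c (snd c (\<gamma> t)) (v c t) + christoffel g c (snd c (\<gamma> t)) (v c t) (v c t) = 0"
        using reg[OF c] by (simp add: acc_def)
    qed
  qed
  show "speed A g \<gamma> t = 1" if t: "t \<in> {0<..<D}" for t
  proof -
    obtain c where c: "c \<in> A" "\<gamma> t \<in> fst c" using chart_cover by blast
    have t': "t \<in> {0..D}" and ti: "t \<in> interior {0..D}" using t by auto
    note r = reg[OF c t']
    have "isCont \<gamma> t" using cont ti by (rule continuous_on_interior)
    moreover have "((snd c \<circ> \<gamma>) has_vector_derivative v c t) (at t)"
      using r at_within_interior[OF ti] by simp
    ultimately have "speed A g \<gamma> t = sqrt (g c (snd c (\<gamma> t)) (v c t) (v c t))"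
      by (rule speed_eq[where \<gamma> = \<gamma> and t = t, OF c])
    then show ?thesis using r by simp
  qed
qed

text \<open>The speed is \<open>1\<close> in the interior, and the end points do not matter for the
  length.\<close>

lemma minimal_geodesicI:
  assumes \<gamma>: "shortest d \<gamma> (d x p)" "\<gamma> 0 = x" "\<gamma> (d x p) = p" and D: "0 < d x p" and ext: "\<gamma> \<in> extensional {0..d x p}"
  shows "minimal_geodesic A g x p \<gamma>"
  unfolding minimal_geodesic_def
proof (intro conjI ballI ext \<gamma>(2,3) shortest_geodesic(1)[OF \<gamma>(1) D])
  fix s assume s: "s \<in> {0..d x p}"
  have "((\<lambda>t. 1) has_integral s) {0..s}" using has_integral_const_real[of "1::real" 0 s] s by simp
  then have "(speed A g \<gamma> has_integral s) {0..s}"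
    by (rule has_integral_spike_finite[of "{0, s}", rotated -1])
      (use shortest_geodesic(2)[OF \<gamma>(1) D] s in auto)
  then show "curve_length A g 0 s \<gamma> = s" by (simp add: curve_length_def integral_unique)
qed

lemma geodesic_piecewise_C1:
  assumes "geodesic A g a b \<gamma>"
  shows "piecewise_C1_curve A a b \<gamma>"
proof -
  have cont: "continuous_on {a..b} \<gamma>" using assms unfolding geodesic_def by (rule conjunct1)
  have C1: "C1_curve A a b \<gamma>"
    unfolding C1_curve_def
  proof (intro conjI cont ballI)
    fix c assume "c \<in> A"
    then have "\<exists>\<gamma>' \<gamma>''. \<forall>t\<in>{a..b}. \<gamma> t \<in> fst c \<longrightarrow>
        ((snd c \<circ> \<gamma>) has_vector_derivative \<gamma>' t) (at t within {a..b}) \<and>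
        (\<gamma>' has_vector_derivative \<gamma>'' t) (at t within {a..b}) \<and>
        \<gamma>'' t + christoffel g c (snd c (\<gamma> t)) (\<gamma>' t) (\<gamma>' t) = 0"
      using assms unfolding geodesic_def by (elim conjE) (erule bspec)
    then obtain \<gamma>' \<gamma>'' where *: "\<forall>t\<in>{a..b}. \<gamma> t \<in> fst c \<longrightarrow>
        ((snd c \<circ> \<gamma>) has_vector_derivative \<gamma>' t) (at t within {a..b}) \<and>
        (\<gamma>' has_vector_derivative \<gamma>'' t) (at t within {a..b}) \<and>
        \<gamma>'' t + christoffel g c (snd c (\<gamma> t)) (\<gamma>' t) (\<gamma>' t) = 0"
      by (elim exE)
    have "continuous_on {t\<in>{a..b}. \<gamma> t \<in> fst c} \<gamma>'"
      unfolding continuous_on_eq_continuous_within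
    proof
      fix t assume "t \<in> {t\<in>{a..b}. \<gamma> t \<in> fst c}"
      then have "(\<gamma>' has_vector_derivative \<gamma>'' t) (at t within {a..b})" using * by simp
      then have "continuous (at t within {a..b}) \<gamma>'" by (rule has_vector_derivative_continuous)
      then show "continuous (at t within {t\<in>{a..b}. \<gamma> t \<in> fst c}) \<gamma>'"
        by (rule continuous_within_subset) auto
    qed
    then show "\<exists>\<gamma>'. continuous_on {t\<in>{a..b}. \<gamma> t \<in> fst c} \<gamma>' \<and>
        (\<forall>t\<in>{a..b}. \<gamma> t \<in> fst c \<longrightarrow> ((snd c \<circ> \<gamma>) has_vector_derivative \<gamma>' t) (at t within {a..b}))"
      using * by (intro exI[of _ \<gamma>'] conjI ballI impI) simp_all
  qed
  show ?thesis
    unfolding piecewise_C1_curve_def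
  proof (intro conjI cont exI[of _ "{}"] allI impI)
    show "C1_curve A u v \<gamma>" if "a \<le> u \<and> u < v \<and> v \<le> b \<and> {u<..<v} \<inter> {} = {}" for u v
      using C1_curve_subinterval[OF C1] that by simp
  qed simp
qed

text \<open>Arc length bounds distances from above. As the end points are at distance equal to the
  total length, the triangle inequality forces equality for every pair of times.\<close>

lemma minimal_geodesicD:
  assumes "minimal_geodesic A g x p \<gamma>"
  shows "shortest d \<gamma> (d x p)" "\<gamma> 0 = x" "\<gamma> (d x p) = p" "\<gamma> \<in> extensional {0..d x p}"
proof -
  define D where "D = d x p"
  have geo: "geodesic A g 0 D \<gamma>" and len: "\<And>s. s \<in> {0..D} \<Longrightarrow> curve_length A g 0 s \<gamma> = s"
    and ends: "\<gamma> 0 = x" "\<gamma> D = p" and ext: "\<gamma> \<in> extensional {0..D}"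
    using assms by (simp_all add: minimal_geodesic_def D_def)
  note pw = geodesic_piecewise_C1[OF geo]
  have D0: "0 \<le> D" unfolding D_def by (rule d_nonneg)
  have upper: "d (\<gamma> s) (\<gamma> t) \<le> t - s" if st: "0 \<le> s" "s \<le> t" "t \<le> D" for s t
  proof (cases "s = t")
    case True
    then show ?thesis using d_self by simp
  next
    case False
    then have "d (\<gamma> s) (\<gamma> t) \<le> curve_length A g s t \<gamma>"
      using st by (intro riem_dist_le linked_curve[OF pw]) auto
    also have "\<dots> = t - s" using curve_length_split[OF pw order_refl st] len st by simp
    finally show ?thesis .
  qed
  have eq: "d (\<gamma> s) (\<gamma> t) = t - s" if st: "0 \<le> s" "s \<le> t" "t \<le> D" for s t
  proof -
    have "D \<le> d (\<gamma> 0) (\<gamma> s) + (d (\<gamma> s) (\<gamma> t) + d (\<gamma> t) (\<gamma> D))"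
      using d_triangle[of "\<gamma> 0" "\<gamma> D" "\<gamma> s"] d_triangle[of "\<gamma> s" "\<gamma> D" "\<gamma> t"] ends by (simp add: D_def)
    then show ?thesis using upper[of 0 s] upper[of t D] upper[OF st] st by simp
  qed
  have "shortest d \<gamma> D"
    unfolding shortest_def
  proof (intro ballI)
    fix s t assume st: "s \<in> {0..D}" "t \<in> {0..D}"
    show "d (\<gamma> s) (\<gamma> t) = \<bar>s - t\<bar>"
      using eq[of s t] eq[of t s] st d_sym[of "\<gamma> s" "\<gamma> t"] by (cases "s \<le> t") simp_all
  qed
  then show "shortest d \<gamma> (d x p)" "\<gamma> 0 = x" "\<gamma> (d x p) = p" "\<gamma> \<in> extensional {0..d x p}"
    using ends ext by (simp_all add: D_def)
qed

text \<open>Minimal geodesics are extensional, so they differ exactly when they differ somewhere on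
  \<open>[0, D]\<close>; conversely shortest paths are made extensional by restriction. Both sides
  are false for empty \<open>Y\<close>.\<close>

lemma two_geodesics_iff:
  assumes comp: "riem_complete A g"
  shows "(\<exists>\<gamma>\<in>Omega A g Y p. \<exists>\<gamma>2\<in>Omega A g Y p. \<gamma> \<noteq> \<gamma>2) \<longleftrightarrow> geodesic_space.two_seg d Y p"
proof -
  interpret S: geodesic_space "riem_dist A g" by (rule geodesic_space[OF comp])
  define D where "D = S.dd Y p"
  have dts: "dist_to_set A g p Y = D" by (simp add: dist_to_set_def D_def S.dd_def)
  show ?thesis
  proof
    assume "\<exists>\<gamma>\<in>Omega A g Y p. \<exists>\<gamma>2\<in>Omega A g Y p. \<gamma> \<noteq> \<gamma>2"
    then obtain \<gamma> \<gamma>2 where om: "\<gamma> \<in> Omega A g Y p" "\<gamma>2 \<in> Omega A g Y p" and ne: "\<gamma> \<noteq> \<gamma>2" by blast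
    have props: "shortest d \<mu> D \<and> \<mu> 0 \<in> Y \<and> \<mu> D = p \<and> \<mu> \<in> extensional {0..D}" if \<mu>: "\<mu> \<in> Omega A g Y p" for \<mu>
    proof -
      obtain x where x: "x \<in> Y" "d p x = D" "minimal_geodesic A g x p \<mu>"
        using \<mu> unfolding Omega_def closest_points_def dts by blast
      have "d x p = D" using x(2) d_sym[of p x] by simp
      then show ?thesis using minimal_geodesicD[OF x(3)] x(1) by simp
    qed
    note 1 = props[OF om(1)] and 2 = props[OF om(2)]
    have "\<exists>t\<in>{0..D}. \<gamma> t \<noteq> \<gamma>2 t"
    proof (rule ccontr)
      assume "\<not> (\<exists>t\<in>{0..D}. \<gamma> t \<noteq> \<gamma>2 t)"
      then have "\<gamma> = \<gamma>2" using 1 2 by (intro extensionalityI[of \<gamma> "{0..D}" \<gamma>2]) auto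
      then show False using ne by simp
    qed
    then show "S.two_seg Y p" unfolding S.two_seg_def D_def[symmetric] using 1 2 by blast
  next
    assume "S.two_seg Y p"
    then obtain \<sigma> \<tau> t where \<sigma>: "shortest d \<sigma> D" "\<sigma> 0 \<in> Y" "\<sigma> D = p" and \<tau>: "shortest d \<tau> D" "\<tau> 0 \<in> Y" "\<tau> D = p"
      and t: "t \<in> {0..D}" "\<sigma> t \<noteq> \<tau> t"
      unfolding S.two_seg_def D_def[symmetric] by blast
    \<comment> \<open>Both paths end in \<open>p\<close>, so they can differ only before time
      \<open>D\<close>. This yields the positive length that \<open>minimal_geodesicI\<close>
      requires.\<close>
    have "t \<noteq> D" using t(2) \<sigma>(3) \<tau>(3) by auto
    then have D: "0 < D" using t(1) by simp
    have om: "restrict \<mu> {0..D} \<in> Omega A g Y p" if \<mu>: "shortest d \<mu> D" "\<mu> 0 \<in> Y" "\<mu> D = p" for \<mu>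
    proof -
      have dx: "d (\<mu> 0) p = D" using \<mu>(1,3) D unfolding shortest_def by force
      have "shortest d (restrict \<mu> {0..D}) D" using \<mu>(1) by (simp add: shortest_def)
      then have "minimal_geodesic A g (\<mu> 0) p (restrict \<mu> {0..D})"
        using \<mu> D by (intro minimal_geodesicI) (simp_all add: dx)
      moreover have "\<mu> 0 \<in> closest_points A g Y p"
        using \<mu>(2) dx d_sym[of p "\<mu> 0"] by (simp add: closest_points_def dts)
      ultimately show ?thesis unfolding Omega_def by blast
    qed
    have "restrict \<sigma> {0..D} t \<noteq> restrict \<tau> {0..D} t" using t by simp
    then have "restrict \<sigma> {0..D} \<noteq> restrict \<tau> {0..D}" by metis
    then show "\<exists>\<gamma>\<in>Omega A g Y p. \<exists>\<gamma>2\<in>Omega A g Y p. \<gamma> \<noteq> \<gamma>2"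
      using om[OF \<sigma>] om[OF \<tau>] by blast
  qed
qed

end

text \<open>Finite intersections along an enumeration of the countable basis, with repetitions if
  the basis is finite. Monotonicity places all later members in a given neighbourhood, as
  convergence of sequences of parameters demands.\<close>

lemma decreasing_nhds_basis:
  fixes t0 :: "'t::topological_space"
  assumes "countable_nhds_basis t0"
  shows "\<exists>V :: nat \<Rightarrow> 't set. (\<forall>n. open (V n) \<and> t0 \<in> V n) \<and>
    (\<forall>W. open W \<longrightarrow> t0 \<in> W \<longrightarrow> (\<exists>n. \<forall>m\<ge>n. V m \<subseteq> W))"
proof -
  obtain B where B: "countable B \<and> (\<forall>V\<in>B. open V \<and> t0 \<in> V) \<and>
      (\<forall>W. open W \<and> t0 \<in> W \<longrightarrow> (\<exists>V\<in>B. V \<subseteq> W))"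
    using assms unfolding countable_nhds_basis_def by (rule exE)
  have Bc: "countable B" using B by (rule conjunct1)
  have Bo: "open V \<and> t0 \<in> V" if "V \<in> B" for V using B that by simp
  have Bn: "\<exists>V\<in>B. V \<subseteq> W" if "open W" "t0 \<in> W" for W using B that by simp
  have Bne: "B \<noteq> {}" using Bn[of UNIV] by auto
  define V where "V = (\<lambda>n. \<Inter>i\<le>n. from_nat_into B i)"
  have mem: "from_nat_into B i \<in> B" for i by (rule from_nat_into[OF Bne])
  show ?thesis
  proof (intro exI[of _ V] conjI allI impI)
    show "open (V n)" for n unfolding V_def using Bo[OF mem] by (intro open_INT) auto
    show "t0 \<in> V n" for n unfolding V_def using Bo[OF mem] by blast
    fix W :: "'t set" assume "open W" "t0 \<in> W"
    then obtain b where b: "b \<in> B" "b \<subseteq> W" using Bn by blast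
    obtain n where n: "from_nat_into B n = b" using from_nat_into_surj[OF Bc b(1)] by blast
    have "V m \<subseteq> W" if "n \<le> m" for m using n b(2) that by (auto simp: V_def)
    then show "\<exists>n. \<forall>m\<ge>n. V m \<subseteq> W" by blast
  qed
qed

theorem theorem5p1:
  fixes A :: "('a::{t2_space,second_countable_topology}, 'e::euclidean_space) chart set"
    and g :: "('a, 'e) metric_tensor"
    and t0 :: "'t::t1_space"
    and X M :: "('t \<times> 'a) set"
  assumes "riemannian_manifold A g"
    and "connected (UNIV :: 'a set)"
    and "riem_complete A g"
    and "t0 islimpt UNIV"
    and "countable_nhds_basis t0"
    and "\<And>t. closed (X `` {t})"
    and "t0 \<in> closure (Domain X - {t0})"
    and "kuratowski_converges t0 X"
    and "M = {(t, p). \<exists>\<gamma>\<in>Omega A g (X `` {t}) p. \<exists>\<gamma>2\<in>Omega A g (X `` {t}) p. \<gamma> \<noteq> \<gamma>2}"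
  shows "M `` {t0} \<subseteq> kuratowski_liminf t0 M"
proof (rule subsetI, rule ccontr)
  fix p assume p: "p \<in> M `` {t0}" and np: "p \<notin> kuratowski_liminf t0 M"
  interpret riemannian_connected A g
    using assms(1,2) by (intro riemannian_connected.intro riemannian.intro riemannian_connected_axioms.intro)
  interpret S: geodesic_space "riem_dist A g" by (rule geodesic_space[OF assms(3)])
  have M: "q \<in> M `` {t} \<longleftrightarrow> S.two_seg (X `` {t}) q" for t q
    using two_geodesics_iff[OF assms(3), of "X `` {t}" q] unfolding assms(9) by simp
  \<comment> \<open>Two distinct shortest paths start in the section of \<open>X\<close>, which is
    therefore nonempty; parameters of \<open>M\<close> are parameters of \<open>X\<close>.\<close>
  have MX: "t \<in> Domain X" if tM: "t \<in> Domain M" for t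
  proof -
    obtain q where "q \<in> M `` {t}" using tM by blast
    then show ?thesis unfolding M S.two_seg_def by blast
  qed
  obtain V :: "nat \<Rightarrow> 't set" where V': "(\<forall>n. open (V n) \<and> t0 \<in> V n) \<and>
    (\<forall>W. open W \<longrightarrow> t0 \<in> W \<longrightarrow> (\<exists>n. \<forall>m\<ge>n. V m \<subseteq> W))"
    using decreasing_nhds_basis[OF assms(5)] by (rule exE)
  have V: "open (V n)" "t0 \<in> V n" for n using V' by simp_all
  have V3: "\<exists>n. \<forall>m\<ge>n. V m \<subseteq> W" if "open W" "t0 \<in> W" for W using V' that by simp
  \<comment> \<open>Failure of the lower limit takes two forms. If \<open>t0\<close> is adherent to
    the parameters of \<open>M\<close>, a neighbourhood of \<open>p\<close> is missed by medial axes
    arbitrarily close to \<open>t0\<close>. Otherwise the medial axes over the parameters of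
    \<open>X\<close> near \<open>t0\<close> are empty, and \<open>U\<close> may be the whole
    manifold.\<close>
  have "\<exists>U. open U \<and> p \<in> U \<and> (\<forall>n. \<exists>t\<in>Domain X \<inter> V n - {t0}. M `` {t} \<inter> U = {})"
  proof (cases "t0 \<in> closure (Domain M - {t0})")
    case True
    have "\<not> (\<forall>U. open U \<and> p \<in> U \<longrightarrow> (\<exists>V. open V \<and> t0 \<in> V \<and>
        (\<forall>t\<in>(Domain M \<inter> V) - {t0}. M `` {t} \<inter> U \<noteq> {})))"
      using np unfolding kuratowski_liminf_def if_P[OF True] mem_Collect_eq .
    then obtain U where U: "open U" "p \<in> U" and nV: "\<not> (\<exists>V. open V \<and> t0 \<in> V \<and>
        (\<forall>t\<in>(Domain M \<inter> V) - {t0}. M `` {t} \<inter> U \<noteq> {}))" by blast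
    have "\<exists>t\<in>Domain X \<inter> V n - {t0}. M `` {t} \<inter> U = {}" for n
    proof -
      have "\<not> (\<forall>t\<in>(Domain M \<inter> V n) - {t0}. M `` {t} \<inter> U \<noteq> {})" using nV V[of n] by blast
      then obtain t where t: "t \<in> Domain M" "t \<in> V n" "t \<noteq> t0" "M `` {t} \<inter> U = {}" by blast
      then show ?thesis using MX[OF t(1)] by (intro bexI[of _ t]) simp_all
    qed
    then show ?thesis using U by (intro exI[of _ U]) simp
  next
    case False
    have "\<exists>t\<in>Domain X \<inter> V n - {t0}. M `` {t} \<inter> UNIV = {}" for n
    proof -
      define W where "W = V n \<inter> - closure (Domain M - {t0})"
      have "open W" "t0 \<in> W" using V(1,2) False by (auto simp: W_def)
      then have "W \<inter> (Domain X - {t0}) \<noteq> {}"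
        using assms(7) open_Int_closure_eq_empty[of W "Domain X - {t0}"] by blast
      then obtain t where t: "t \<in> W" "t \<in> Domain X" "t \<noteq> t0" by blast
      have "t \<notin> Domain M" using t closure_subset[of "Domain M - {t0}"] by (auto simp: W_def)
      then have "M `` {t} = {}" by blast
      then show ?thesis using t by (auto simp: W_def)
    qed
    then show ?thesis by (intro exI[of _ UNIV]) simp
  qed
  then obtain U where U: "open U" "p \<in> U" and Ut: "\<forall>n. \<exists>t\<in>Domain X \<inter> V n - {t0}. M `` {t} \<inter> U = {}"
    by blast
  from Ut have "\<forall>n. \<exists>t. t \<in> Domain X \<inter> V n - {t0} \<and> M `` {t} \<inter> U = {}" unfolding Bex_def .
  then obtain t where t': "\<forall>n. t n \<in> Domain X \<inter> V n - {t0} \<and> M `` {t n} \<inter> U = {}"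
    by (rule choice[THEN exE])
  have t: "t n \<in> Domain X" "t n \<in> V n" "t n \<noteq> t0" "M `` {t n} \<inter> U = {}" for n
    using spec[OF t', of n] by simp_all
  have "\<not> S.two_seg (X `` {t0}) p"
  proof (rule S.not_two_seg_limit[of "\<lambda>n. X `` {t n}" _ U])
    show "closed (X `` {t n})" for n by (rule assms(6))
    show "X `` {t n} \<noteq> {}" for n using t(1)[of n] by blast
    show "closed (X `` {t0})" by (rule assms(6))
    show "open U" "p \<in> U" by (rule U)+
    show "\<not> S.two_seg (X `` {t n}) q" if "q \<in> U" for n q using t(4)[of n] that M[of q "t n"] by blast
  next
    fix x e assume x: "x \<in> X `` {t0}" and e: "0 < (e::real)"
    have "x \<in> kuratowski_liminf t0 X" using x assms(8) unfolding kuratowski_converges_def by blast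
    then have *: "\<forall>U. open U \<and> x \<in> U \<longrightarrow> (\<exists>V. open V \<and> t0 \<in> V \<and>
                 (\<forall>t\<in>(Domain X \<inter> V) - {t0}. X `` {t} \<inter> U \<noteq> {}))"
      unfolding kuratowski_liminf_def if_P[OF assms(7)] mem_Collect_eq .
    have "x \<in> {y. d x y < e}" using e d_self by simp
    then obtain W where W: "open W" "t0 \<in> W" "\<forall>t\<in>(Domain X \<inter> W) - {t0}. X `` {t} \<inter> {y. d x y < e} \<noteq> {}"
      using *[rule_format, of "{y. d x y < e}"] S.open_ob[of x e] by blast
    obtain n where n: "\<forall>m\<ge>n. V m \<subseteq> W" using V3[OF W(1,2)] by blast
    have "\<exists>y\<in>X `` {t m}. d y x < e" if "n \<le> m" for m
    proof -
      have "t m \<in> (Domain X \<inter> W) - {t0}" using n that t(1,2,3)[of m] by blast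
      then obtain y where "y \<in> X `` {t m}" "d x y < e" using W(3) by blast
      then show ?thesis using d_sym[of x y] by auto
    qed
    then show "\<forall>\<^sub>F n in sequentially. \<exists>y\<in>X `` {t n}. d y x < e"
      unfolding eventually_sequentially by blast
  next
    fix k :: "nat \<Rightarrow> nat" and y l
    assume k: "strict_mono k" and y: "\<And>n. y n \<in> X `` {t (k n)}" and lim: "y \<longlonglongrightarrow> l"
    have "l \<in> kuratowski_limsup t0 X"
      unfolding kuratowski_limsup_def
    proof (intro CollectI allI impI)
      fix U' W assume UW: "open U' \<and> l \<in> U' \<and> open W \<and> t0 \<in> W"
      obtain n where n: "\<forall>m\<ge>n. V m \<subseteq> W" using V3 UW by blast
      have "\<forall>\<^sub>F m in sequentially. y m \<in> U'" using lim UW by (auto dest: topological_tendstoD)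
      then obtain n' where n': "\<forall>m\<ge>n'. y m \<in> U'" unfolding eventually_sequentially by blast
      define m where "m = max n n'"
      \<comment> \<open>A strictly increasing sequence of indices dominates the identity, so the
        parameter \<open>t (k m)\<close> lies in \<open>W\<close> whenever \<open>m\<close> is at
        least \<open>n\<close>.\<close>
      have "n \<le> k m" using seq_suble[OF k, of m] by (simp add: m_def)
      then have "t (k m) \<in> (Domain X \<inter> W) - {t0}" using n t(1,2,3)[of "k m"] by blast
      moreover have "y m \<in> X `` {t (k m)} \<inter> U'" using y n' by (simp add: m_def)
      ultimately show "\<exists>t\<in>(Domain X \<inter> W) - {t0}. X `` {t} \<inter> U' \<noteq> {}" by blast
    qed
    then show "l \<in> X `` {t0}" using assms(8) unfolding kuratowski_converges_def by blast
  qed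
  then show False using p M by blast
qed

end
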